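(* Let $\Omega\subset\mathbb{R}^d$ be a bounded open set, $1<p<\infty$ and $f\in L^2(\Omega)$. For measurable $V:\Omega\to[0,+\infty]$ let $$\mathcal{E}_f(V)=\inf\left\{\int_\Omega\Big(\tfrac12|\nabla u|^2+\tfrac12V(x)u^2-f(x)u\Big)dx\ :\ u\in H^1_0(\Omega)\right\}.$$ Then the problem $$\min\left\{-\mathcal{E}_f(V)\ :\ V\ge0,\ \int_\Omega V^p\,dx\le1\right\}$$ has a unique solution $$V_p=\left(\int_\Omega|u_p|^{2p/(p-1)}\,dx\right)^{-1/p}|u_p|^{-1+(p+1)/(p-1)},$$ where $u_p\in H^1_0(\Omega)\cap L^{2p/(p-1)}(\Omega)$ is the minimizer of the functional $$J_p(u)=\frac12\int_\Omega|\nabla u|^2\,dx+\frac12\left(\int_\Omega|u|^{2p/(p-1)}\,dx\right)^{(p-1)/p}-\int_\Omega uf\,dx$$ over $u\in H^1_0(\Omega)$. Moreover, $\mathcal{E}_f(V_p)=J_p(u_p)$.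
   Context: $J_p(u)=+\infty$ if $u\notin L^{2p/(p-1)}(\Omega)$. Potentials are Lebesgue measurable functions, and uniqueness of the potential is understood up to almost everywhere equality.
   Formalization: Uniqueness of the optimal potential is claimed only when f is not a.e. zero: for f = 0 every admissible V is optimal, u_p = 0 and the formula for V_p contains the undefined factor 0^(-1/p), there read as V_p = 0; all other claims hold for every f. *)

theory Defs
  imports "HOL-Analysis.Analysis"
begin

text \<open>
  Elements of \<open>L\<^sup>p(\<Omega>)\<close> and of Sobolev spaces are represented by total functions on the ambient
  space; only their values on \<open>\<Omega>\<close>, up to null sets, matter.
\<close>

definition Lp_space :: "real \<Rightarrow> 'a::euclidean_space set \<Rightarrow> ('a \<Rightarrow> 'b::euclidean_space) set" where
  "Lp_space q \<Omega> = {u. u \<in> borel_measurable (lebesgue_on \<Omega>) \<and>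
                      integrable (lebesgue_on \<Omega>) (\<lambda>x. norm (u x) powr q)}"

primrec times_cont_diff :: "nat \<Rightarrow> ('a::euclidean_space \<Rightarrow> real) \<Rightarrow> bool" where
  "times_cont_diff 0 \<phi> \<longleftrightarrow> continuous_on UNIV \<phi>"
| "times_cont_diff (Suc k) \<phi> \<longleftrightarrow> \<phi> differentiable_on UNIV \<and>
     (\<forall>i\<in>Basis. times_cont_diff k (\<lambda>x. frechet_derivative \<phi> (at x) i))"

text \<open>The space \<open>C\<^sub>c\<^sup>\<infinity>(\<Omega>)\<close>, its elements being extended by zero outside \<open>\<Omega>\<close>.\<close>

definition test_functions :: "'a::euclidean_space set \<Rightarrow> ('a \<Rightarrow> real) set" where
  "test_functions \<Omega> = {\<phi>. (\<forall>k. times_cont_diff k \<phi>) \<and>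
     compact (closure {x. \<phi> x \<noteq> 0}) \<and> closure {x. \<phi> x \<noteq> 0} \<subseteq> \<Omega>}"

definition locally_integrable ::
    "'a::euclidean_space set \<Rightarrow> ('a \<Rightarrow> 'b::euclidean_space) \<Rightarrow> bool" where
  "locally_integrable \<Omega> u \<longleftrightarrow> (\<forall>K. compact K \<and> K \<subseteq> \<Omega> \<longrightarrow> u absolutely_integrable_on K)"

definition has_weak_gradient ::
    "'a::euclidean_space set \<Rightarrow> ('a \<Rightarrow> real) \<Rightarrow> ('a \<Rightarrow> 'a) \<Rightarrow> bool" where
  "has_weak_gradient \<Omega> u G \<longleftrightarrow> locally_integrable \<Omega> u \<and> locally_integrable \<Omega> G \<and>
     (\<forall>\<phi>\<in>test_functions \<Omega>. \<forall>i\<in>Basis.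
        (LINT x|lebesgue_on \<Omega>. u x * frechet_derivative \<phi> (at x) i) =
        - (LINT x|lebesgue_on \<Omega>. (G x \<bullet> i) * \<phi> x))"

text \<open>Weak gradients are unique almost everywhere on \<open>\<Omega>\<close>, so the choice below is harmless.\<close>

definition weak_gradient :: "'a::euclidean_space set \<Rightarrow> ('a \<Rightarrow> real) \<Rightarrow> 'a \<Rightarrow> 'a" where
  "weak_gradient \<Omega> u = (SOME G. has_weak_gradient \<Omega> u G)"

definition H1 :: "'a::euclidean_space set \<Rightarrow> ('a \<Rightarrow> real) set" where
  "H1 \<Omega> = {u. u \<in> Lp_space 2 \<Omega> \<and> (\<exists>G. G \<in> Lp_space 2 \<Omega> \<and> has_weak_gradient \<Omega> u G)}"

definition H1_norm :: "'a::euclidean_space set \<Rightarrow> ('a \<Rightarrow> real) \<Rightarrow> real" where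
  "H1_norm \<Omega> u = sqrt ((LINT x|lebesgue_on \<Omega>. (u x)\<^sup>2) +
                         (LINT x|lebesgue_on \<Omega>. (norm (weak_gradient \<Omega> u x))\<^sup>2))"

definition H10 :: "'a::euclidean_space set \<Rightarrow> ('a \<Rightarrow> real) set" where
  "H10 \<Omega> = {u \<in> H1 \<Omega>. \<forall>e>0. \<exists>\<phi>\<in>test_functions \<Omega>. H1_norm \<Omega> (\<lambda>x. u x - \<phi> x) < e}"

text \<open>
  The integral of \<open>\<bar>\<nabla>u\<bar>\<^sup>2/2 + V u\<^sup>2/2 - f u\<close>. For \<open>u \<in> H10 \<Omega>\<close> and \<open>f \<in> L\<^sup>2(\<Omega>)\<close> the first and the
  last term are integrable, while the nonnegative term in the middle may have integral \<open>\<infinity>\<close>.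
  Where \<open>V = \<infinity>\<close> and \<open>u = 0\<close> the product \<open>V u\<^sup>2\<close> is \<open>0\<close>, as usual.
\<close>

definition schroedinger_functional ::
    "'a::euclidean_space set \<Rightarrow> ('a \<Rightarrow> real) \<Rightarrow> ('a \<Rightarrow> ennreal) \<Rightarrow> ('a \<Rightarrow> real) \<Rightarrow> ereal" where
  "schroedinger_functional \<Omega> f V u =
     ereal (1/2 * (LINT x|lebesgue_on \<Omega>. (norm (weak_gradient \<Omega> u x))\<^sup>2))
     + ereal (1/2) * enn2ereal (\<integral>\<^sup>+x. V x * ennreal ((u x)\<^sup>2) \<partial>lebesgue_on \<Omega>)
     - ereal (LINT x|lebesgue_on \<Omega>. f x * u x)"

definition energy ::
    "'a::euclidean_space set \<Rightarrow> ('a \<Rightarrow> real) \<Rightarrow> ('a \<Rightarrow> ennreal) \<Rightarrow> ereal" where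
  "energy \<Omega> f V = (INF u\<in>H10 \<Omega>. schroedinger_functional \<Omega> f V u)"

definition ennreal_powr :: "ennreal \<Rightarrow> real \<Rightarrow> ennreal" where
  "ennreal_powr v p = (if v = \<infinity> then \<infinity> else ennreal (enn2real v powr p))"
  \<comment> \<open>meant for positive exponents \<open>p\<close> only\<close>

definition admissible_potential ::
    "real \<Rightarrow> 'a::euclidean_space set \<Rightarrow> ('a \<Rightarrow> ennreal) \<Rightarrow> bool" where
  "admissible_potential p \<Omega> V \<longleftrightarrow> V \<in> borel_measurable (lebesgue_on \<Omega>) \<and>
     (\<integral>\<^sup>+x. ennreal_powr (V x) p \<partial>lebesgue_on \<Omega>) \<le> 1"

definition J_functional ::
    "real \<Rightarrow> 'a::euclidean_space set \<Rightarrow> ('a \<Rightarrow> real) \<Rightarrow> ('a \<Rightarrow> real) \<Rightarrow> ereal" where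
  "J_functional p \<Omega> f u =
     (if u \<in> Lp_space (2 * p / (p - 1)) \<Omega> then
        ereal (1/2 * (LINT x|lebesgue_on \<Omega>. (norm (weak_gradient \<Omega> u x))\<^sup>2)
             + 1/2 * (LINT x|lebesgue_on \<Omega>. \<bar>u x\<bar> powr (2 * p / (p - 1))) powr ((p - 1) / p)
             - (LINT x|lebesgue_on \<Omega>. u x * f x))
      else \<infinity>)"

text \<open>
  If \<open>u = 0\<close> almost everywhere, the formula has the undefined factor \<open>0\<^bsup>-1/p\<^esup>\<close>;
  with \<^term>\<open>(powr)\<close> it yields the zero potential.
\<close>

definition optimal_potential ::
    "real \<Rightarrow> 'a::euclidean_space set \<Rightarrow> ('a \<Rightarrow> real) \<Rightarrow> 'a \<Rightarrow> ennreal" where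
  "optimal_potential p \<Omega> u x =
     ennreal ((LINT y|lebesgue_on \<Omega>. \<bar>u y\<bar> powr (2 * p / (p - 1))) powr (- 1 / p)
              * \<bar>u x\<bar> powr (- 1 + (p + 1) / (p - 1)))"

end

theory Submission
  imports Defs
begin

text \<open>
  Put \<open>q = 2p/(p-1)\<close>. By Hoelder's inequality, \<open>\<parallel>u\<parallel>\<^sub>q\<^sup>2\<close> is the maximum of \<open>\<integral> V u\<^sup>2\<close> over the
  admissible \<open>V\<close>, attained at the potential \<open>V\<^sub>u\<close> of the theorem and only there unless \<open>u = 0\<close>; so
  \<open>J\<^sub>p\<close> is the supremum over \<open>V\<close> of the Schroedinger functionals, and \<open>energy V \<le> min J\<^sub>p\<close>. The
  minimizer \<open>u\<close> exists by strong convexity (minimizing sequences are Cauchy in the Dirichlet norm)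
  and Fatou's lemma. Comparing \<open>u\<close> with \<open>w = u + t h\<close> through
  \<open>S(V\<^sub>w, w) = J\<^sub>p(w) \<ge> J\<^sub>p(u) \<ge> S(V\<^sub>w, u)\<close> and letting \<open>t\<close> tend to \<open>0\<close> shows, without
  differentiating the \<open>q\<close>-norm, that \<open>u\<close> also minimizes the functional with the fixed potential \<open>V\<^sub>u\<close>.
  Hence \<open>energy V\<^sub>u = J\<^sub>p(u)\<close>, and any other optimal \<open>V\<close> gives equality in Hoelder's inequality for \<open>u\<close>.
\<close>

section \<open>Smooth functions and test functions\<close>

text \<open>The definitions speak of a weak gradient picked by \<open>SOME\<close>, so nothing about
  \<open>H10\<close> can be computed before weak gradients are known to be unique almost everywhere;
  this is what the fundamental lemma and the explicit smooth bumps serve. With uniqueness,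
  \<open>H10\<close> can be replaced by pairs (u, gradient) that are L^2 limits of pairs (\<phi>,
  grad \<phi>), and the choice disappears. A second obstacle: the energy is an infimum over all of
  \<open>H10\<close>, whereas the comparison argument only reaches competitors in L^q, since J is
  infinite elsewhere. The truncation \<open>c * sin (s / c)\<close> closes this gap; being smooth,
  it maps test functions to test functions, so only the classical chain rule enters. The condition
  that \<open>f\<close> does not vanish almost everywhere in the uniqueness clause is forced: for
  vanishing \<open>f\<close> every admissible potential has energy 0, and all of them are optimal.
  For any other \<open>f\<close> the minimizer is not zero, as the equality case of Hoelder's
  inequality requires.\<close>

lemma times_cont_diff_SucI:
  assumes "\<And>x. (\<phi> has_derivative \<phi>' x) (at x)"
    and "\<And>i. i \<in> Basis \<Longrightarrow> times_cont_diff k (\<lambda>x. \<phi>' x i)"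
  shows "times_cont_diff (Suc k) \<phi>"
proof -
  have "frechet_derivative \<phi> (at x) = \<phi>' x" for x
    using assms(1) frechet_derivative_at by metis
  moreover have "\<phi> differentiable_on UNIV"
    using assms(1) by (auto simp: differentiable_on_def differentiable_def)
  ultimately show ?thesis using assms(2) by simp
qed

lemma times_cont_diff_has_derivative:
  assumes "times_cont_diff (Suc k) \<phi>"
  shows "(\<phi> has_derivative frechet_derivative \<phi> (at x)) (at x)"
  using assms by (simp add: differentiable_on_def flip: frechet_derivative_works)

lemma times_cont_diff_Suc_imp:
  assumes "times_cont_diff (Suc k) \<phi>"
  shows "times_cont_diff k \<phi>"
  using assms
proof (induction k arbitrary: \<phi>)
  case 0
  then show ?case by (simp add: differentiable_imp_continuous_on)
next
  case (Suc k)
  then show ?case by (metis times_cont_diff.simps(2))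
qed

lemma times_cont_diff_const: "times_cont_diff k (\<lambda>x. c)"
proof (induction k arbitrary: c)
  case (Suc k)
  show ?case by (rule times_cont_diff_SucI[where \<phi>' = "\<lambda>x v. 0"]) (use Suc in auto)
qed auto

lemma times_cont_diff_add:
  assumes "times_cont_diff k \<phi>" "times_cont_diff k \<psi>"
  shows "times_cont_diff k (\<lambda>x. \<phi> x + \<psi> x)"
  using assms
proof (induction k arbitrary: \<phi> \<psi>)
  case 0
  then show ?case by (auto intro: continuous_intros)
next
  case (Suc k)
  show ?case
  proof (rule times_cont_diff_SucI)
    show "((\<lambda>x. \<phi> x + \<psi> x) has_derivative (\<lambda>v. frechet_derivative \<phi> (at x) v + frechet_derivative \<psi> (at x) v)) (at x)" for x
      using times_cont_diff_has_derivative[OF Suc.prems(1)] times_cont_diff_has_derivative[OF Suc.prems(2)]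
      by (intro derivative_eq_intros) auto
  qed (use Suc in auto)
qed

lemma times_cont_diff_mult:
  assumes "times_cont_diff k \<phi>" "times_cont_diff k \<psi>"
  shows "times_cont_diff k (\<lambda>x. \<phi> x * \<psi> x)"
  using assms
proof (induction k arbitrary: \<phi> \<psi>)
  case 0
  then show ?case by (auto intro: continuous_intros)
next
  case (Suc k)
  show ?case
  proof (rule times_cont_diff_SucI)
    show "((\<lambda>x. \<phi> x * \<psi> x) has_derivative (\<lambda>v. \<phi> x * frechet_derivative \<psi> (at x) v + frechet_derivative \<phi> (at x) v * \<psi> x)) (at x)" for x
      using times_cont_diff_has_derivative[OF Suc.prems(1)] times_cont_diff_has_derivative[OF Suc.prems(2)]
      by (intro derivative_eq_intros) auto
    show "times_cont_diff k (\<lambda>x. \<phi> x * frechet_derivative \<psi> (at x) i + frechet_derivative \<phi> (at x) i * \<psi> x)"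
      if "i \<in> Basis" for i
      using Suc that times_cont_diff_Suc_imp by (intro times_cont_diff_add Suc.IH) auto
  qed
qed

lemma times_cont_diff_prod:
  assumes "finite I" "\<And>i. i \<in> I \<Longrightarrow> times_cont_diff k (\<phi> i)"
  shows "times_cont_diff k (\<lambda>x. \<Prod>i\<in>I. \<phi> i x)"
  using assms
  by (induction I rule: finite_induct) (auto intro: times_cont_diff_mult times_cont_diff_const)

text \<open>The induction differentiates the outer function as well, so it needs a whole sequence of
  successive derivatives and must run for every index \<open>j\<close> at once: the partial
  derivative of \<open>h j (\<phi> x)\<close> contains \<open>h (Suc j) (\<phi> x)\<close>.\<close>

lemma times_cont_diff_compose:
  fixes h :: "nat \<Rightarrow> real \<Rightarrow> real"
  assumes h: "\<And>j t. (h j has_real_derivative h (Suc j) t) (at t)"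
    and \<phi>: "times_cont_diff k \<phi>"
  shows "times_cont_diff k (\<lambda>x. h j (\<phi> x))"
  using \<phi>
proof (induction k arbitrary: j)
  case 0
  have "continuous_on UNIV (h j)"
    using h by (meson DERIV_continuous_on has_field_derivative_at_within)
  then show ?case using 0
    by (metis continuous_on_compose2 subset_UNIV times_cont_diff.simps(1))
next
  case (Suc k)
  show ?case
  proof (rule times_cont_diff_SucI)
    show "((\<lambda>x. h j (\<phi> x)) has_derivative (\<lambda>v. h (Suc j) (\<phi> x) * frechet_derivative \<phi> (at x) v)) (at x)" for x
      using has_derivative_compose[OF times_cont_diff_has_derivative[OF Suc.prems] h[unfolded has_field_derivative_def]]
      by simp
    show "times_cont_diff k (\<lambda>x. h (Suc j) (\<phi> x) * frechet_derivative \<phi> (at x) i)" if "i \<in> Basis" for i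
      using Suc that times_cont_diff_Suc_imp[OF Suc.prems] by (intro times_cont_diff_mult Suc.IH) auto
  qed
qed

lemma times_cont_diff_inner_diff: "times_cont_diff k (\<lambda>x. (x - a) \<bullet> v)"
proof (cases k)
  case 0
  then show ?thesis by (auto intro!: continuous_intros)
next
  case (Suc m)
  show ?thesis unfolding Suc
    by (rule times_cont_diff_SucI[where \<phi>' = "\<lambda>x w. w \<bullet> v"])
       (auto intro!: derivative_eq_intros times_cont_diff_const)
qed

lemma times_cont_diff_sin:
  assumes "times_cont_diff k \<phi>"
  shows "times_cont_diff k (\<lambda>x. c * sin (\<phi> x / c))"
proof -
  \<comment> \<open>Differentiating the sine shifts its argument by \<open>pi / 2\<close>, which
    gives the required sequence of derivatives in one formula.\<close>
  define h where "h j t = sin (t + real j * (pi / 2))" for j :: nat and t :: real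
  have h: "(h j has_real_derivative h (Suc j) t) (at t)" for j t
  proof -
    have "h (Suc j) t = cos (t + real j * (pi / 2))"
      using sin_add[of "t + real j * (pi / 2)" "pi / 2"] by (simp add: h_def algebra_simps add_divide_distrib)
    then show ?thesis unfolding h_def by (auto intro!: derivative_eq_intros)
  qed
  have "times_cont_diff k (\<lambda>x. c * h 0 (inverse c * \<phi> x))"
    by (intro times_cont_diff_mult times_cont_diff_const times_cont_diff_compose[where h = h] h assms)
  then show ?thesis by (simp add: h_def field_simps)
qed

text \<open>The \<open>j\<close>-th derivative of \<open>exp (-1/t)\<close> is \<open>P\<^sub>j(1/t) exp (-1/t)\<close> for these polynomials.\<close>

primrec flat_poly :: "nat \<Rightarrow> real poly" where
  "flat_poly 0 = 1"
| "flat_poly (Suc j) = [:0, 0, 1:] * (flat_poly j - pderiv (flat_poly j))"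

definition flat_deriv :: "nat \<Rightarrow> real \<Rightarrow> real" where
  "flat_deriv j t = (if t \<le> 0 then 0 else poly (flat_poly j) (1 / t) * exp (- 1 / t))"

lemma tendsto_poly_mult_exp_minus:
  "((\<lambda>x. poly P x * exp (- x)) \<longlongrightarrow> (0::real)) at_top"
proof -
  have "((\<lambda>x. \<Sum>i\<le>degree P. coeff P i * (x ^ i / exp x)) \<longlongrightarrow> (\<Sum>i\<le>degree P. coeff P i * 0)) at_top"
    by (intro tendsto_intros tendsto_power_div_exp_0)
  then show ?thesis
    by (simp add: poly_altdef sum_distrib_right sum_divide_distrib exp_minus field_simps)
qed

text \<open>For positive \<open>t\<close> the recursion of \<open>flat_poly\<close> is the product
  rule: the derivative of \<open>P(1/t) exp (-1/t)\<close> is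
  \<open>(1/t^2) (P - P')(1/t) exp (-1/t)\<close>. At 0 the right difference quotient tends to 0
  because the exponential beats every polynomial in \<open>1/t\<close>.\<close>

lemma flat_deriv_has_derivative: "(flat_deriv j has_real_derivative flat_deriv (Suc j) t) (at t)"
proof (cases t "0 :: real" rule: linorder_cases)
  case less
  have "((\<lambda>_. 0) has_real_derivative 0) (at t)" by simp
  moreover have "\<forall>\<^sub>F s in nhds t. flat_deriv j s = 0"
    using eventually_nhds_in_open[of "{..<0}" t] less
    by (auto elim!: eventually_mono simp: flat_deriv_def)
  ultimately show ?thesis
    using less by (subst DERIV_cong_ev[of _ t _ "\<lambda>_. 0"]) (auto simp: flat_deriv_def)
next
  case equal
  have "((\<lambda>h. (flat_deriv j (0 + h) - flat_deriv j 0) / h) \<longlongrightarrow> 0) (at 0)"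
  proof (rule filterlim_split_at)
    have "\<forall>\<^sub>F h in at_left 0. (flat_deriv j (0 + h) - flat_deriv j 0) / h = 0"
      by (auto elim!: eventually_mono simp: flat_deriv_def eventually_at_filter)
    then show "((\<lambda>h. (flat_deriv j (0 + h) - flat_deriv j 0) / h) \<longlongrightarrow> 0) (at_left 0)"
      by (rule tendsto_eventually)
    \<comment> \<open>The extra factor \<open>[:0,1:]\<close> is the division by \<open>h\<close> in
      the difference quotient, written as a multiplication by \<open>inverse h\<close>.\<close>
    have "((\<lambda>h. poly ([:0,1:] * flat_poly j) (inverse h) * exp (- inverse h)) \<longlongrightarrow> (0::real)) (at_right 0)"
      by (rule filterlim_compose[OF tendsto_poly_mult_exp_minus filterlim_inverse_at_top_right])
    moreover have "\<forall>\<^sub>F h in at_right 0. poly ([:0,1:] * flat_poly j) (inverse h) * exp (- inverse h) =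
        (flat_deriv j (0 + h) - flat_deriv j 0) / h"
      using eventually_at_right_less[of 0]
      by (auto elim!: eventually_mono simp: flat_deriv_def divide_simps)
    ultimately show "((\<lambda>h. (flat_deriv j (0 + h) - flat_deriv j 0) / h) \<longlongrightarrow> 0) (at_right 0)"
      by (rule Lim_transform_eventually)
  qed
  then show ?thesis using equal by (simp add: DERIV_def flat_deriv_def)
next
  case greater
  have "((\<lambda>s. poly (flat_poly j) (1 / s) * exp (- 1 / s)) has_real_derivative
     poly (flat_poly (Suc j)) (1 / t) * exp (- 1 / t)) (at t)"
    using greater
    by (auto intro!: derivative_eq_intros DERIV_chain2[OF poly_DERIV] simp: field_simps power2_eq_square)
  moreover have "\<forall>\<^sub>F s in nhds t. flat_deriv j s = poly (flat_poly j) (1 / s) * exp (- 1 / s)"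
    using eventually_nhds_in_open[of "{0<..}" t] greater
    by (auto elim!: eventually_mono simp: flat_deriv_def)
  ultimately show ?thesis
    using greater by (subst DERIV_cong_ev[OF refl _ refl]) (auto simp: flat_deriv_def)
qed

text \<open>Each \<open>flat_deriv\<close> sees the signed distance of \<open>x\<close> to one face
  of the box, magnified by \<open>Suc n\<close>. Growing \<open>n\<close> sharpens the profile
  toward the indicator of \<open>box a b\<close> while the support stays in \<open>cbox a b\<close>,
  so boxes are approximated from inside without convolution.\<close>

definition box_bump :: "'a::euclidean_space \<Rightarrow> 'a \<Rightarrow> nat \<Rightarrow> 'a \<Rightarrow> real" where
  "box_bump a b n x = (\<Prod>i\<in>Basis. flat_deriv 0 ((x - a) \<bullet> i * real (Suc n)) * flat_deriv 0 ((x - b) \<bullet> (- i) * real (Suc n)))"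

lemma times_cont_diff_box_bump: "times_cont_diff k (box_bump a b n)"
proof -
  have "times_cont_diff k (\<lambda>x. \<Prod>i\<in>Basis. flat_deriv 0 ((x - a) \<bullet> i * real (Suc n)) * flat_deriv 0 ((x - b) \<bullet> (- i) * real (Suc n)))"
    by (intro times_cont_diff_prod finite_Basis times_cont_diff_mult times_cont_diff_const
        times_cont_diff_compose[where h = flat_deriv] flat_deriv_has_derivative times_cont_diff_inner_diff)
  then show ?thesis by (simp only: box_bump_def[abs_def])
qed

lemma flat_deriv_0_bounds: "0 \<le> flat_deriv 0 t" "flat_deriv 0 t \<le> 1"
  by (auto simp: flat_deriv_def)

lemma box_bump_bounds: "0 \<le> box_bump a b n x" "box_bump a b n x \<le> 1"
  unfolding box_bump_def
  by (intro prod_nonneg prod_le_1 ballI conjI mult_le_one mult_nonneg_nonneg flat_deriv_0_bounds)+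

lemma box_bump_eq_0:
  assumes "x \<notin> box a b"
  shows "box_bump a b n x = 0"
proof -
  obtain i where i: "i \<in> Basis" "x \<bullet> i \<le> a \<bullet> i \<or> b \<bullet> i \<le> x \<bullet> i"
    using assms by (fastforce simp: mem_box)
  then have "(x - a) \<bullet> i * real (Suc n) \<le> 0 \<or> (x - b) \<bullet> (- i) * real (Suc n) \<le> 0"
    by (auto simp: inner_diff_left mult_le_0_iff)
  then have "flat_deriv 0 ((x - a) \<bullet> i * real (Suc n)) * flat_deriv 0 ((x - b) \<bullet> (- i) * real (Suc n)) = 0"
    by (auto simp: flat_deriv_def)
  then show ?thesis unfolding box_bump_def using i finite_Basis by (meson prod_zero)
qed

lemma box_bump_tendsto: "(\<lambda>n. box_bump a b n x) \<longlonglongrightarrow> indicator (box a b) x"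
proof (cases "x \<in> box a b")
  case True
  have *: "(\<lambda>n. flat_deriv 0 (t * real (Suc n))) \<longlonglongrightarrow> 1" if "t > 0" for t
  proof -
    have "(\<lambda>n. exp (- ((1 / t) * inverse (real (Suc n))))) \<longlonglongrightarrow> exp (- ((1 / t) * 0))"
      by (intro tendsto_intros LIMSEQ_inverse_real_of_nat)
    moreover have "flat_deriv 0 (t * real (Suc n)) = exp (- ((1 / t) * inverse (real (Suc n))))" for n
    proof -
      have "t * real (Suc n) > 0" using that by simp
      then have "\<not> t * real (Suc n) \<le> 0" by linarith
      then show ?thesis by (simp add: flat_deriv_def divide_simps del: of_nat_Suc)
    qed
    ultimately show ?thesis by simp
  qed
  have "(\<lambda>n. box_bump a b n x) \<longlonglongrightarrow> (\<Prod>i\<in>(Basis::'a set). 1 * 1)"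
    unfolding box_bump_def
    by (intro tendsto_prod tendsto_mult *) (use True in \<open>auto simp: mem_box inner_diff_left\<close>)
  then show ?thesis using True by simp
next
  case False
  then show ?thesis by (simp add: box_bump_eq_0)
qed

lemma box_bump_test_function:
  assumes "cbox a b \<subseteq> \<Omega>"
  shows "box_bump a b n \<in> test_functions \<Omega>"
proof -
  have "{x. box_bump a b n x \<noteq> 0} \<subseteq> cbox a b"
    using box_bump_eq_0 box_subset_cbox by blast
  then have "closure {x. box_bump a b n x \<noteq> 0} \<subseteq> cbox a b"
    by (simp add: closure_minimal closed_cbox)
  then show ?thesis
    using assms bounded_subset[OF bounded_cbox \<open>{x. box_bump a b n x \<noteq> 0} \<subseteq> cbox a b\<close>] times_cont_diff_box_bump
    by (auto simp: test_functions_def compact_closure simp del: times_cont_diff.simps)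
qed

lemma test_functions_sin:
  assumes "\<phi> \<in> test_functions \<Omega>"
  shows "(\<lambda>x. c * sin (\<phi> x / c)) \<in> test_functions \<Omega>"
proof -
  have "closure {x. c * sin (\<phi> x / c) \<noteq> 0} \<subseteq> closure {x. \<phi> x \<noteq> 0}"
    by (rule closure_mono) auto
  then show ?thesis
    using assms unfolding test_functions_def
    by (auto simp: compact_closure intro: times_cont_diff_sin bounded_subset)
qed

lemma test_functions_linear:
  assumes "\<phi> \<in> test_functions \<Omega>" "\<psi> \<in> test_functions \<Omega>"
  shows "(\<lambda>x. \<phi> x + c * \<psi> x) \<in> test_functions \<Omega>"
proof -
  have sub: "closure {x. \<phi> x + c * \<psi> x \<noteq> 0} \<subseteq> closure {x. \<phi> x \<noteq> 0} \<union> closure {x. \<psi> x \<noteq> 0}"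
    unfolding closure_Un[symmetric] by (rule closure_mono) auto
  moreover have "compact (closure {x. \<phi> x \<noteq> 0} \<union> closure {x. \<psi> x \<noteq> 0})"
    using assms by (auto simp: test_functions_def)
  ultimately have "compact (closure {x. \<phi> x + c * \<psi> x \<noteq> 0})"
    by (meson closed_closure compact_eq_bounded_closed bounded_subset)
  then show ?thesis
    using assms sub unfolding test_functions_def
    by (auto intro!: times_cont_diff_add times_cont_diff_mult times_cont_diff_const)
qed

lemma zero_in_test_functions: "(\<lambda>x. 0) \<in> test_functions \<Omega>"
  by (auto simp: test_functions_def times_cont_diff_const simp del: times_cont_diff.simps)

section \<open>The fundamental lemma of the calculus of variations\<close>

text \<open>Dynkin's argument: open boxes are stable under intersection and generate the Borel sets,
  and the sets with vanishing integral are closed under countable disjoint unions and, since the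
  full integral vanishes, under complements.\<close>

lemma set_integral_borel_zero:
  fixes F :: "'a::euclidean_space \<Rightarrow> real"
  assumes F: "integrable lebesgue F" and int: "integral\<^sup>L lebesgue F = 0"
    and box: "\<And>a b. (LINT x:box a b|lebesgue. F x) = 0"
    and A: "A \<in> sets borel"
  shows "(LINT x:A|lebesgue. F x) = 0"
proof -
  have SI: "set_integrable lebesgue B F" if "B \<in> sets borel" for B
    using integrable_mult_indicator[OF _ F, of B] that by (simp add: set_integrable_def)
  have "Int_stable (range (\<lambda>(a, b). box a b :: 'a set))"
    by (auto simp: Int_stable_def box_Int_box)
  moreover have "(range (\<lambda>(a, b). box a b :: 'a set)) \<subseteq> Pow UNIV"
    by auto
  moreover have "A \<in> sigma_sets UNIV (range (\<lambda>(a, b). box a b))"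
    using A unfolding borel_eq_box by simp
  ultimately show ?thesis
  proof (induction rule: sigma_sets_induct_disjoint)
    case (basic A) then show ?case using box by auto
  next
    case empty then show ?case by (simp add: set_lebesgue_integral_def)
  next
    case (compl A)
    then have A: "A \<in> sets borel" by (simp add: borel_eq_box)
    have "(LINT x:(UNIV - A)|lebesgue. F x) = (LINT x|lebesgue. F x - indicator A x *\<^sub>R F x)"
      unfolding set_lebesgue_integral_def
      by (intro Bochner_Integration.integral_cong) (auto split: split_indicator)
    also have "\<dots> = 0"
      using compl.IH int F SI[OF A] by (simp add: set_lebesgue_integral_def set_integrable_def)
    finally show ?case .
  next
    case (union D)
    then have D: "\<And>i. D i \<in> sets borel" by (simp add: borel_eq_box subset_eq)
    show ?case
      using union D SI[of "\<Union>i. D i"]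
      by (subst lebesgue_integral_countable_add) (auto simp: disjoint_family_on_def)
  qed
qed

text \<open>A Lebesgue set differs from its Borel \<open>main_part\<close> by a null set, so the
  Borel case gives vanishing integrals over all measurable sets, and an integrable function is
  determined by these.\<close>

lemma AE_zero_if_box_integrals_zero:
  fixes F :: "'a::euclidean_space \<Rightarrow> real"
  assumes F: "integrable lebesgue F" and int: "integral\<^sup>L lebesgue F = 0"
    and box: "\<And>a b. (LINT x:box a b|lebesgue. F x) = 0"
  shows "AE x in lebesgue. F x = 0"
proof (rule density_unique_real[OF F integrable_zero])
  fix A :: "'a set" assume A: "A \<in> sets lebesgue"
  have "AE x in lebesgue. x \<notin> null_part lborel A"
    using AE_notin_null_part[OF A] by (rule AE_completion)
  then have "AE x in lebesgue. x \<in> A \<longleftrightarrow> x \<in> main_part lborel A"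
    using main_part_null_part_Un[OF A] by (auto elim!: eventually_mono)
  then have "(LINT x:A|lebesgue. F x) = (LINT x:main_part lborel A|lebesgue. F x)"
    unfolding set_lebesgue_integral_def using A F main_part_sets[OF A]
    by (intro integral_cong_AE borel_measurable_scaleR borel_measurable_indicator)
       (auto elim!: eventually_mono split: split_indicator)
  also have "\<dots> = 0"
    using set_integral_borel_zero[OF F int box] main_part_sets[OF A] by simp
  finally show "(LINT x:A|lebesgue. F x) = (LINT x:A|lebesgue. 0)"
    by (simp add: set_lebesgue_integral_def)
qed

text \<open>The bumps stay between 0 and 1 and converge to the indicator of the open box, so the
  restriction of \<bar>h\<bar> to the closed box dominates.\<close>

lemma fundamental_lemma_box:
  fixes h :: "'a::euclidean_space \<Rightarrow> real"
  assumes "open \<Omega>" and h: "locally_integrable \<Omega> h" and ab: "cbox a b \<subseteq> \<Omega>"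
    and zero: "\<And>\<phi>. \<phi> \<in> test_functions \<Omega> \<Longrightarrow> (LINT x|lebesgue_on \<Omega>. h x * \<phi> x) = 0"
  shows "(LINT x:box a b|lebesgue. h x) = 0"
proof -
  have \<Omega>: "\<Omega> \<in> sets lebesgue" using \<open>open \<Omega>\<close> by simp
  have hi: "integrable lebesgue (\<lambda>x. indicator (cbox a b) x * h x)"
    using h ab compact_cbox by (auto simp: locally_integrable_def set_integrable_def)
  have eq: "indicator (cbox a b) x * h x * box_bump a b n x = indicator \<Omega> x * (h x * box_bump a b n x)" for n x
    using ab box_bump_eq_0[of x a b n] box_subset_cbox[of a b] by (auto split: split_indicator)
  have meas: "box_bump a b n \<in> borel_measurable lebesgue" for n
    using times_cont_diff_box_bump[of 0 a b n] by (simp add: borel_measurable_continuous_onI measurable_completion)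
  have "(\<lambda>n. LINT x|lebesgue. indicator (cbox a b) x * h x * box_bump a b n x)
      \<longlonglongrightarrow> (LINT x|lebesgue. indicator (cbox a b) x * h x * indicator (box a b) x)"
  proof (rule integral_dominated_convergence[where w = "\<lambda>x. \<bar>indicator (cbox a b) x * h x\<bar>"])
    show "AE x in lebesgue. norm (indicator (cbox a b) x * h x * box_bump a b n x) \<le> \<bar>indicator (cbox a b) x * h x\<bar>" for n
      using box_bump_bounds[of a b n] by (intro AE_I2) (simp add: abs_mult mult_left_le)
    show "AE x in lebesgue. (\<lambda>n. indicator (cbox a b) x * h x * box_bump a b n x)
        \<longlonglongrightarrow> indicator (cbox a b) x * h x * indicator (box a b) x"
      by (intro AE_I2 tendsto_mult tendsto_const box_bump_tendsto)
    show "(\<lambda>x. indicator (cbox a b) x * h x * indicator (box a b) x) \<in> borel_measurable lebesgue"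
      by (rule borel_measurable_times[OF borel_measurable_integrable[OF hi] borel_measurable_indicator]) simp
    show "(\<lambda>x. indicator (cbox a b) x * h x * box_bump a b n x) \<in> borel_measurable lebesgue" for n
      by (rule borel_measurable_times[OF borel_measurable_integrable[OF hi] meas])
    show "integrable lebesgue (\<lambda>x. \<bar>indicator (cbox a b) x * h x\<bar>)"
      using hi by (rule integrable_abs)
  qed
  moreover have "(LINT x|lebesgue. indicator (cbox a b) x * h x * box_bump a b n x) = 0" for n
    using zero[OF box_bump_test_function[OF ab, of n]] \<Omega>
    by (subst eq) (simp add: integral_restrict_space)
  ultimately have "(LINT x|lebesgue. indicator (cbox a b) x * h x * indicator (box a b) x) = 0"
    by (simp add: LIMSEQ_const_iff)
  also have "(\<lambda>x. indicator (cbox a b) x * h x * indicator (box a b) x) = (\<lambda>x. indicator (box a b) x * h x)"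
    using box_subset_cbox[of a b] by (auto simp: fun_eq_iff split: split_indicator)
  finally show ?thesis by (simp add: set_lebesgue_integral_def)
qed

text \<open>Local integrability gives no integrable function on the whole space, so \<open>h\<close>
  is first cut off to a box inside \<open>\<Omega>\<close>; countably many closed boxes then exhaust
  the open set.\<close>

lemma fundamental_lemma:
  fixes h :: "'a::euclidean_space \<Rightarrow> real"
  assumes "open \<Omega>" and h: "locally_integrable \<Omega> h"
    and zero: "\<And>\<phi>. \<phi> \<in> test_functions \<Omega> \<Longrightarrow> (LINT x|lebesgue_on \<Omega>. h x * \<phi> x) = 0"
  shows "AE x in lebesgue_on \<Omega>. h x = 0"
proof -
  have cbox: "AE x in lebesgue. x \<in> cbox c d \<longrightarrow> h x = 0" if cd: "cbox c d \<subseteq> \<Omega>" for c d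
  proof -
    define F where "F x = indicator (box c d) x * h x" for x
    have hi: "integrable lebesgue (\<lambda>x. indicator (cbox c d) x * h x)"
      using h cd compact_cbox by (auto simp: locally_integrable_def set_integrable_def)
    have "F = (\<lambda>x. indicator (box c d) x *\<^sub>R (indicator (cbox c d) x * h x))"
      using box_subset_cbox[of c d] by (auto simp: F_def fun_eq_iff split: split_indicator)
    then have F: "integrable lebesgue F"
      using integrable_mult_indicator[OF _ hi, of "box c d"] by simp
    have F0: "(LINT x:box a b|lebesgue. F x) = 0" for a b
    proof -
      obtain a' b' where ab': "box a b \<inter> box c d = box a' b'"
        by (auto simp: box_Int_box)
      have "(LINT x:box a b|lebesgue. F x) = (LINT x:box a' b'|lebesgue. h x)"
        unfolding set_lebesgue_integral_def ab'[symmetric] F_def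
        by (intro Bochner_Integration.integral_cong) (auto split: split_indicator)
      also have "\<dots> = 0"
      proof (cases "box a' b' = {}")
        case False
        \<comment> \<open>A nonempty open box is dense in its closed box, which places
          \<open>cbox a' b'\<close> inside \<open>cbox c d\<close>. The corners of an empty box
          carry no such information, hence the case distinction.\<close>
        then have "cbox a' b' = closure (box a' b')" by simp
        also have "\<dots> \<subseteq> cbox c d"
          using ab' box_subset_cbox[of c d] by (intro closure_minimal) auto
        finally show ?thesis
          using fundamental_lemma_box[OF \<open>open \<Omega>\<close> h _ zero, of a' b'] cd by auto
      qed (simp add: set_lebesgue_integral_def)
      finally show ?thesis .
    qed
    have "integral\<^sup>L lebesgue F = (LINT x:box c d|lebesgue. F x)"
      unfolding set_lebesgue_integral_def F_def
      by (intro Bochner_Integration.integral_cong) (auto split: split_indicator)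
    then have "AE x in lebesgue. F x = 0"
      using AE_zero_if_box_integrals_zero[OF F _ F0] F0 by simp
    moreover have "AE x in lebesgue. x \<notin> cbox c d - box c d"
    proof (rule AE_not_in)
      show "cbox c d - box c d \<in> null_sets lebesgue"
        using negligible_frontier_interval[of c d] by (simp add: negligible_iff_null_sets)
    qed
    ultimately show ?thesis
      by eventually_elim (auto simp: F_def split: split_indicator_asm)
  qed
  obtain \<D> where D: "countable \<D>" "\<D> \<subseteq> Pow \<Omega>" "\<And>X. X \<in> \<D> \<Longrightarrow> \<exists>a b. X = cbox a b" "\<Union>\<D> = \<Omega>"
    using open_countable_Union_open_cbox[OF \<open>open \<Omega>\<close>] by metis
  have "AE x in lebesgue. \<forall>X\<in>\<D>. x \<in> X \<longrightarrow> h x = 0"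
  proof (subst AE_ball_countable[OF D(1)], rule ballI)
    fix X assume "X \<in> \<D>"
    moreover obtain c d where "X = cbox c d" using D(3) \<open>X \<in> \<D>\<close> by blast
    ultimately show "AE x in lebesgue. x \<in> X \<longrightarrow> h x = 0"
      using cbox[of c d] D(2) by auto
  qed
  then have "AE x in lebesgue. x \<in> \<Omega> \<longrightarrow> h x = 0"
    using D(4) by (auto elim!: eventually_mono)
  then show ?thesis
    using \<open>open \<Omega>\<close> by (subst AE_restrict_space_iff) auto
qed

section \<open>Integration by parts\<close>

lemma continuous_bounded_on_cball:
  fixes f :: "'a::euclidean_space \<Rightarrow> real"
  assumes "continuous_on UNIV f"
  obtains B where "\<And>x. norm x \<le> r \<Longrightarrow> \<bar>f x\<bar> \<le> B" "B > 0"
proof -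
  have "bounded (f ` cball 0 r)"
    using assms by (intro compact_imp_bounded compact_continuous_image compact_cball) (auto intro: continuous_on_subset)
  then obtain B where "B > 0" "\<forall>x\<in>cball 0 r. \<bar>f x\<bar> \<le> B"
    by (auto simp: bounded_pos)
  then show ?thesis by (intro that[of B]) auto
qed

lemma integrable_indicator_cball:
  "integrable lborel (\<lambda>x. C * indicator (cball a r) x :: real)"
  using emeasure_bounded_finite[OF bounded_cball[of a r]]
  by (intro integrable_mult_right integrable_real_indicator) (auto simp: top.not_eq_extremum)

text \<open>The integrals of the difference quotients vanish by translation invariance.\<close>

lemma integral_directional_derivative_zero:
  fixes \<psi> :: "'a::euclidean_space \<Rightarrow> real"
  assumes deriv: "\<And>x. (\<psi> has_derivative \<psi>' x) (at x)"
    and cont: "continuous_on UNIV (\<lambda>x. \<psi>' x v)"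
    and supp: "bounded {x. \<psi> x \<noteq> 0}"
  shows "(LINT x|lebesgue. \<psi>' x v) = 0"
proof -
  have c\<psi>: "continuous_on UNIV \<psi>"
    by (rule has_derivative_continuous_on[of _ _ \<psi>']) (rule deriv)
  obtain R where R: "\<And>x. \<psi> x \<noteq> 0 \<Longrightarrow> norm x \<le> R" "R > 0"
    using supp by (auto simp: bounded_pos)
  \<comment> \<open>If \<open>norm x > S\<close> and the step is at most 1, then neither
    \<open>x\<close> nor the shifted point lies in the ball of radius \<open>R\<close>, so the
    difference quotients vanish there.\<close>
  define S where "S = R + norm v"
  obtain B where B: "\<And>x. norm x \<le> S + norm v \<Longrightarrow> \<bar>\<psi>' x v\<bar> \<le> B" "B > 0"
    using continuous_bounded_on_cball[OF cont] by blast
  have m: "f \<in> borel_measurable lborel" if "continuous_on UNIV f" for f :: "'a \<Rightarrow> real"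
    using that by (simp add: borel_measurable_continuous_onI)
  have lin: "\<psi>' x (h *\<^sub>R v) = \<psi>' x v * h" for x h
    using linear_scale[OF has_derivative_linear[OF deriv], of x h v] by simp
  define q where "q n x = real (Suc n) * (\<psi> (x + (1 / real (Suc n)) *\<^sub>R v) - \<psi> x)" for n x
  have qc: "continuous_on UNIV (q n)" for n
  proof -
    have "continuous_on UNIV (\<lambda>x. \<psi> (x + (1 / real (Suc n)) *\<^sub>R v))"
      by (rule continuous_on_compose2[OF c\<psi>]) (auto intro!: continuous_intros)
    then show ?thesis unfolding q_def using c\<psi> by (intro continuous_intros)
  qed
  have \<psi>i: "integrable lborel \<psi>"
  proof -
    obtain C where C: "\<And>x. norm x \<le> R \<Longrightarrow> \<bar>\<psi> x\<bar> \<le> C" "C > 0"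
      using continuous_bounded_on_cball[OF c\<psi>] by blast
    show ?thesis
    proof (rule Bochner_Integration.integrable_bound)
      show "integrable lborel (\<lambda>x. C * indicator (cball 0 R) x)"
        by (rule integrable_indicator_cball)
      show "AE x in lborel. norm (\<psi> x) \<le> norm (C * indicator (cball 0 R) x)"
        proof (rule AE_I2)
        fix x show "norm (\<psi> x) \<le> norm (C * indicator (cball 0 R) x)"
          using C(1)[of x] C(2) R(1)[of x] by (cases "\<psi> x = 0") auto
      qed
    qed (use m c\<psi> in auto)
  qed
  have shift: "(LINT x|lborel. \<psi> (x + c)) = (LINT x|lborel. \<psi> x)" "integrable lborel (\<lambda>x. \<psi> (x + c))" for c
  proof -
    have "(LINT x|distr lborel borel ((+) c). \<psi> x) = (LINT x|lborel. \<psi> (c + x))"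
      using m[OF c\<psi>] by (intro integral_distr) auto
    then show "(LINT x|lborel. \<psi> (x + c)) = (LINT x|lborel. \<psi> x)"
      by (simp add: lborel_distr_plus add.commute)
    have "integrable (distr lborel borel ((+) c)) \<psi> = integrable lborel (\<lambda>x. \<psi> (c + x))"
      using m[OF c\<psi>] by (intro integrable_distr_eq) auto
    then show "integrable lborel (\<lambda>x. \<psi> (x + c))"
      using \<psi>i by (simp add: lborel_distr_plus add.commute)
  qed
  have "(\<lambda>n. LINT x|lborel. q n x) \<longlonglongrightarrow> (LINT x|lborel. \<psi>' x v)"
  proof (rule integral_dominated_convergence[where w = "\<lambda>x. B * indicator (cball 0 S) x"])
    show "integrable lborel (\<lambda>x. B * indicator (cball 0 S) x)"
      by (rule integrable_indicator_cball)
    show "AE x in lborel. norm (q n x) \<le> B * indicator (cball 0 S) x" for n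
    proof (rule AE_I2)
      fix x
      define t where "t = 1 / real (Suc n)"
      have t: "0 < t" "t \<le> 1" by (auto simp: t_def)
      have nt: "norm (s *\<^sub>R v) \<le> norm v" if "0 \<le> s" "s \<le> t" for s
        using that t by (simp add: mult_left_le_one_le)
      show "norm (q n x) \<le> B * indicator (cball 0 S) x"
      proof (cases "norm x \<le> S")
        case True
        have "((\<lambda>s. \<psi> (x + s *\<^sub>R v)) has_real_derivative \<psi>' (x + s *\<^sub>R v) v) (at s)" for s
        proof -
          have "((\<lambda>s. \<psi> (x + s *\<^sub>R v)) has_derivative (\<lambda>h. \<psi>' (x + s *\<^sub>R v) (h *\<^sub>R v))) (at s)"
            by (rule has_derivative_compose[OF _ deriv]) (auto intro!: derivative_eq_intros)
          moreover have "\<psi>' (x + s *\<^sub>R v) (h *\<^sub>R v) = \<psi>' (x + s *\<^sub>R v) v * h" for h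
            using lin[of "x + s *\<^sub>R v" h] by simp
          ultimately show ?thesis by (simp add: has_field_derivative_def)
        qed
        then obtain s where s: "0 < s" "s < t" "\<psi> (x + t *\<^sub>R v) - \<psi> (x + 0 *\<^sub>R v) = (t - 0) * \<psi>' (x + s *\<^sub>R v) v"
          using MVT2[OF t(1), of "\<lambda>s. \<psi> (x + s *\<^sub>R v)" "\<lambda>s. \<psi>' (x + s *\<^sub>R v) v"] by blast
        have "q n x = \<psi>' (x + s *\<^sub>R v) v"
          using s(3) by (simp add: q_def t_def field_simps)
        moreover have "norm (x + s *\<^sub>R v) \<le> S + norm v"
          using True nt[of s] s norm_triangle_ineq[of x "s *\<^sub>R v"] by linarith
        ultimately show ?thesis using B True by simp
      next
        case False
        have "norm x \<le> norm (x + t *\<^sub>R v) + norm v"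
          using nt[of t] t norm_triangle_ineq4[of "x + t *\<^sub>R v" "t *\<^sub>R v"] by simp
        then have "\<not> norm (x + t *\<^sub>R v) \<le> R" "\<not> norm x \<le> R"
          using False norm_ge_zero[of v] unfolding S_def by linarith+
        then have "\<psi> (x + t *\<^sub>R v) = 0" "\<psi> x = 0"
          using R(1) by blast+
        then show ?thesis using False by (simp add: q_def t_def)
      qed
    qed
    show "AE x in lborel. (\<lambda>n. q n x) \<longlonglongrightarrow> \<psi>' x v"
    proof (rule AE_I2)
      fix x
      have "((\<lambda>s. \<psi> (x + s *\<^sub>R v)) has_derivative (\<lambda>h. \<psi>' x (h *\<^sub>R v))) (at 0)"
        by (rule has_derivative_compose[where g = \<psi>, OF _ ]) (auto intro!: derivative_eq_intros deriv)
      then have "((\<lambda>s. \<psi> (x + s *\<^sub>R v)) has_real_derivative \<psi>' x v) (at 0)"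
        by (simp add: has_field_derivative_def lin)
      then have "((\<lambda>h. (\<psi> (x + h *\<^sub>R v) - \<psi> x) / h) \<longlongrightarrow> \<psi>' x v) (at 0)"
        by (simp add: DERIV_def)
      moreover have "filterlim (\<lambda>n. 1 / real (Suc n)) (at 0) sequentially"
        using LIMSEQ_inverse_real_of_nat by (simp add: filterlim_at inverse_eq_divide)
      ultimately have "(\<lambda>n. (\<psi> (x + (1 / real (Suc n)) *\<^sub>R v) - \<psi> x) / (1 / real (Suc n))) \<longlonglongrightarrow> \<psi>' x v"
        by (rule filterlim_compose)
      then show "(\<lambda>n. q n x) \<longlonglongrightarrow> \<psi>' x v" by (simp add: q_def mult.commute)
    qed
  qed (use m[OF qc] m[OF cont] in auto)
  moreover have "(LINT x|lborel. q n x) = 0" for n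
    unfolding q_def using shift \<psi>i by simp
  ultimately have "(LINT x|lborel. \<psi>' x v) = 0" by (simp add: LIMSEQ_const_iff)
  then show ?thesis using m[OF cont] by (subst integral_completion) auto
qed

section \<open>Square integrable functions\<close>

text \<open>Fatou's lemma is applied to \<open>ennreal\<close> integrals, so that integrability of
  the limit comes out together with the bound. It serves both the completeness of L^2 and the lower
  semicontinuity of the L^q term.\<close>

lemma integral_fatou_bound:
  fixes u :: "nat \<Rightarrow> 'a \<Rightarrow> real"
  assumes u: "\<And>n. integrable M (u n)" "\<And>n x. 0 \<le> u n x" and v: "v \<in> borel_measurable M"
    and lim: "AE x in M. (\<lambda>n. u n x) \<longlonglongrightarrow> v x"
    and bound: "\<forall>\<^sub>F n in sequentially. integral\<^sup>L M (u n) \<le> e"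
  shows "integrable M v \<and> integral\<^sup>L M v \<le> e"
proof -
  have v0: "AE x in M. 0 \<le> v x"
    using lim by eventually_elim (rule LIMSEQ_le_const, auto simp: u)
  obtain N where N: "\<And>n. n \<ge> N \<Longrightarrow> integral\<^sup>L M (u n) \<le> e"
    using bound by (auto simp: eventually_sequentially)
  have e0: "0 \<le> e"
    using N[of N] Bochner_Integration.integral_nonneg[of M "u N", OF u(2)] by linarith
  have "(\<integral>\<^sup>+x. ennreal (v x) \<partial>M) = (\<integral>\<^sup>+x. liminf (\<lambda>n. ennreal (u n x)) \<partial>M)"
  proof (rule nn_integral_cong_AE)
    show "AE x in M. ennreal (v x) = liminf (\<lambda>n. ennreal (u n x))"
      using lim by eventually_elim (metis lim_imp_Liminf sequentially_bot tendsto_ennrealI)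
  qed
  also have "\<dots> \<le> liminf (\<lambda>n. \<integral>\<^sup>+x. ennreal (u n x) \<partial>M)"
    by (rule nn_integral_liminf) (use u(1) in auto)
  also have "\<dots> \<le> ennreal e"
  proof (rule Liminf_le)
    show "\<forall>\<^sub>F n in sequentially. (\<integral>\<^sup>+x. ennreal (u n x) \<partial>M) \<le> ennreal e"
      using bound by eventually_elim (simp add: nn_integral_eq_integral u ennreal_leI)
  qed simp
  finally have le: "(\<integral>\<^sup>+x. ennreal (v x) \<partial>M) \<le> ennreal e" .
  have int: "integrable M v"
  proof (rule integrableI_bounded[OF v])
    have "(\<integral>\<^sup>+x. ennreal (norm (v x)) \<partial>M) = (\<integral>\<^sup>+x. ennreal (v x) \<partial>M)"
      by (rule nn_integral_cong_AE) (use v0 in \<open>auto elim!: eventually_mono\<close>)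
    then show "(\<integral>\<^sup>+x. ennreal (norm (v x)) \<partial>M) < \<infinity>"
      using le by (auto intro: le_less_trans simp: ennreal_less_top)
  qed
  have "ennreal (integral\<^sup>L M v) \<le> ennreal e"
    using nn_integral_eq_integral[OF int v0] le by simp
  then show ?thesis using int e0 by (simp add: ennreal_le_iff)
qed

text \<open>Values lie in a general Euclidean space so that functions, gradients and pairs of both
  share one L^2 theory.\<close>

definition square_integrable :: "'a measure \<Rightarrow> ('a \<Rightarrow> 'b::euclidean_space) \<Rightarrow> bool" where
  "square_integrable M f \<longleftrightarrow> f \<in> borel_measurable M \<and> integrable M (\<lambda>x. (norm (f x))\<^sup>2)"

definition l2_sq :: "'a measure \<Rightarrow> ('a \<Rightarrow> 'b::euclidean_space) \<Rightarrow> real" where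
  "l2_sq M f = (LINT x|M. (norm (f x))\<^sup>2)"

lemma l2_sq_nonneg: "0 \<le> l2_sq M f"
  by (simp add: l2_sq_def)

lemma square_integrable_measurable: "square_integrable M f \<Longrightarrow> f \<in> borel_measurable M"
  by (simp add: square_integrable_def)

lemma square_integrable_zero: "square_integrable M (\<lambda>x. 0)"
  by (simp add: square_integrable_def)

lemma square_integrable_bound:
  assumes "square_integrable M g" "f \<in> borel_measurable M" "AE x in M. norm (f x) \<le> norm (g x)"
  shows "square_integrable M f"
  unfolding square_integrable_def
proof
  show "integrable M (\<lambda>x. (norm (f x))\<^sup>2)"
    by (rule Bochner_Integration.integrable_bound[of _ "\<lambda>x. (norm (g x))\<^sup>2"])
       (use assms in \<open>auto simp: square_integrable_def elim!: eventually_mono intro: power_mono\<close>)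
qed fact

lemma square_integrable_scaleR:
  assumes "square_integrable M f"
  shows "square_integrable M (\<lambda>x. c *\<^sub>R f x)"
  using assms by (auto simp: square_integrable_def power_mult_distrib intro!: borel_measurable_const_scaleR)

lemma square_integrable_inner:
  assumes "square_integrable M f" "square_integrable M g"
  shows "integrable M (\<lambda>x. f x \<bullet> g x)"
proof (rule Bochner_Integration.integrable_bound)
  show "integrable M (\<lambda>x. (norm (f x))\<^sup>2 + (norm (g x))\<^sup>2)"
    using assms by (simp add: square_integrable_def)
  have "\<bar>y \<bullet> z\<bar> \<le> (norm y)\<^sup>2 + (norm z)\<^sup>2" for y z :: 'b
  proof -
    have "\<bar>y \<bullet> z\<bar> \<le> norm y * norm z" by (rule Cauchy_Schwarz_ineq2)
    also have "2 * (norm y * norm z) \<le> (norm y)\<^sup>2 + (norm z)\<^sup>2"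
      using sum_squares_bound[of "norm y" "norm z"] by (simp add: power2_eq_square)
    finally show ?thesis using mult_nonneg_nonneg[of "norm y" "norm z"] by linarith
  qed
  then show "AE x in M. norm (f x \<bullet> g x) \<le> norm ((norm (f x))\<^sup>2 + (norm (g x))\<^sup>2)"
    by (intro AE_I2) (simp add: abs_of_nonneg)
qed (use assms in \<open>auto simp: square_integrable_def\<close>)

lemma norm_add_scaleR_sq:
  fixes a b :: "'b::real_inner"
  shows "(norm (a + c *\<^sub>R b))\<^sup>2 = (norm a)\<^sup>2 + 2 * c * (a \<bullet> b) + c\<^sup>2 * (norm b)\<^sup>2"
  unfolding power2_norm_eq_inner
  by (simp add: inner_add_left inner_add_right inner_commute power2_eq_square algebra_simps)

lemma square_integrable_add_scaleR:
  assumes "square_integrable M f" "square_integrable M g"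
  shows "square_integrable M (\<lambda>x. f x + c *\<^sub>R g x)"
  using assms square_integrable_inner[OF assms]
  unfolding square_integrable_def norm_add_scaleR_sq by (auto intro!: integrable_mult_right)

lemma l2_sq_add_scaleR:
  assumes "square_integrable M f" "square_integrable M g"
  shows "l2_sq M (\<lambda>x. f x + c *\<^sub>R g x) = l2_sq M f + 2 * c * (LINT x|M. f x \<bullet> g x) + c\<^sup>2 * l2_sq M g"
  using assms square_integrable_inner[OF assms]
  unfolding l2_sq_def norm_add_scaleR_sq square_integrable_def by simp

lemma square_integrable_diff:
  assumes "square_integrable M f" "square_integrable M g"
  shows "square_integrable M (\<lambda>x. f x - g x)"
  using square_integrable_add_scaleR[OF assms, of "-1"] by simp

lemma l2_sq_diff:
  assumes "square_integrable M f" "square_integrable M g"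
  shows "l2_sq M (\<lambda>x. f x - g x) = l2_sq M f - 2 * (LINT x|M. f x \<bullet> g x) + l2_sq M g"
  using l2_sq_add_scaleR[OF assms, of "-1"] by simp

lemma l2_sq_commute: "l2_sq M (\<lambda>x. f x - g x) = l2_sq M (\<lambda>x. g x - f x)"
  by (simp add: l2_sq_def norm_minus_commute)

lemma l2_sq_cong_AE:
  assumes "f \<in> borel_measurable M" "g \<in> borel_measurable M" "AE x in M. f x = g x"
  shows "l2_sq M f = l2_sq M g"
  unfolding l2_sq_def using assms by (intro integral_cong_AE) (auto elim!: eventually_mono)

text \<open>The squared norm of \<open>f + c g\<close> is a nonnegative quadratic polynomial in
  \<open>c\<close>.\<close>

lemma l2_Cauchy_Schwarz:
  assumes "square_integrable M f" "square_integrable M g"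
  shows "(LINT x|M. f x \<bullet> g x)\<^sup>2 \<le> l2_sq M f * l2_sq M g"
proof -
  define I where "I = (LINT x|M. f x \<bullet> g x)"
  have q: "0 \<le> l2_sq M f + 2 * c * I + c\<^sup>2 * l2_sq M g" for c
    using l2_sq_add_scaleR[OF assms, of c] l2_sq_nonneg by (metis I_def)
  show ?thesis
  proof (cases "l2_sq M g = 0")
    case True
    have "I = 0"
    proof (rule ccontr)
      assume "I \<noteq> 0"
      \<comment> \<open>For null \<open>g\<close> the polynomial is affine in \<open>c\<close>; at
        this \<open>c\<close> it equals -1.\<close>
      then show False using q[of "- (l2_sq M f + 1) / (2 * I)"] True by (simp add: field_simps)
    qed
    then show ?thesis using True by (simp add: I_def)
  next
    case False
    then have g: "l2_sq M g > 0" using l2_sq_nonneg[of M g] by linarith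
    \<comment> \<open>This \<open>c\<close> minimizes the polynomial.\<close>
    have "0 \<le> l2_sq M f + 2 * (- I / l2_sq M g) * I + (- I / l2_sq M g)\<^sup>2 * l2_sq M g" by (rule q)
    also have "\<dots> = l2_sq M f - I\<^sup>2 / l2_sq M g" using g by (simp add: power2_eq_square field_simps)
    finally show ?thesis using g by (simp add: I_def field_simps)
  qed
qed

lemma l2_Cauchy_Schwarz_sqrt:
  assumes "square_integrable M f" "square_integrable M g"
  shows "\<bar>LINT x|M. f x \<bullet> g x\<bar> \<le> sqrt (l2_sq M f) * sqrt (l2_sq M g)"
  using real_sqrt_le_mono[OF l2_Cauchy_Schwarz[OF assms]] by (simp add: real_sqrt_mult)

text \<open>Adding the expansions for \<open>c = 1\<close> and \<open>c = -1\<close> is the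
  parallelogram identity, from which the squared norm of the difference is dropped.\<close>

lemma l2_sq_add_le:
  assumes "square_integrable M f" "square_integrable M g"
  shows "l2_sq M (\<lambda>x. f x + g x) \<le> 2 * l2_sq M f + 2 * l2_sq M g"
  using l2_sq_add_scaleR[OF assms, of 1] l2_sq_add_scaleR[OF assms, of "-1"]
    l2_sq_nonneg[of M "\<lambda>x. f x + (-1) *\<^sub>R g x"] by simp

lemma l2_sq_triangle:
  assumes "square_integrable M f" "square_integrable M g" "square_integrable M h"
  shows "l2_sq M (\<lambda>x. f x - h x) \<le> 2 * l2_sq M (\<lambda>x. f x - g x) + 2 * l2_sq M (\<lambda>x. g x - h x)"
  using l2_sq_add_le[OF square_integrable_diff[OF assms(1,2)] square_integrable_diff[OF assms(2,3)]]
  by simp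

lemma l2_tendsto_inner:
  assumes f: "\<And>n. square_integrable M (f n)" and g: "square_integrable M g" and h: "square_integrable M h"
    and lim: "(\<lambda>n. l2_sq M (\<lambda>x. f n x - g x)) \<longlonglongrightarrow> 0"
  shows "(\<lambda>n. LINT x|M. f n x \<bullet> h x) \<longlonglongrightarrow> (LINT x|M. g x \<bullet> h x)"
proof -
  have "(\<lambda>n. (LINT x|M. f n x \<bullet> h x) - (LINT x|M. g x \<bullet> h x)) \<longlonglongrightarrow> 0"
  proof (rule Lim_null_comparison)
    have "norm ((LINT x|M. f n x \<bullet> h x) - (LINT x|M. g x \<bullet> h x)) \<le>
        sqrt (l2_sq M (\<lambda>x. f n x - g x)) * sqrt (l2_sq M h)" for n
      using l2_Cauchy_Schwarz_sqrt[OF square_integrable_diff[OF f g] h, of n]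
        square_integrable_inner[OF f h, of n] square_integrable_inner[OF g h]
      by (simp add: inner_diff_left)
    then show "\<forall>\<^sub>F n in sequentially. norm ((LINT x|M. f n x \<bullet> h x) - (LINT x|M. g x \<bullet> h x)) \<le>
        sqrt (l2_sq M (\<lambda>x. f n x - g x)) * sqrt (l2_sq M h)" by simp
    show "(\<lambda>n. sqrt (l2_sq M (\<lambda>x. f n x - g x)) * sqrt (l2_sq M h)) \<longlonglongrightarrow> 0"
      using tendsto_mult_left_zero[OF tendsto_real_sqrt[OF lim, unfolded real_sqrt_zero]] .
  qed
  then show ?thesis by (simp add: LIM_zero_iff)
qed

lemma l2_tendsto_l2_sq:
  assumes f: "\<And>n. square_integrable M (f n)" and g: "square_integrable M g"
    and lim: "(\<lambda>n. l2_sq M (\<lambda>x. f n x - g x)) \<longlonglongrightarrow> 0"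
  shows "(\<lambda>n. l2_sq M (f n)) \<longlonglongrightarrow> l2_sq M g"
proof -
  have eq: "l2_sq M (f n) = l2_sq M (\<lambda>x. f n x - g x) + 2 * (LINT x|M. f n x \<bullet> g x) - l2_sq M g" for n
    using l2_sq_diff[OF f g, of n] by simp
  have "(\<lambda>n. l2_sq M (f n)) \<longlonglongrightarrow> 0 + 2 * (LINT x|M. g x \<bullet> g x) - l2_sq M g"
    unfolding eq by (intro tendsto_intros lim l2_tendsto_inner f g)
  moreover have "(LINT x|M. g x \<bullet> g x) = l2_sq M g"
    by (simp add: l2_sq_def power2_norm_eq_inner)
  ultimately show ?thesis by simp
qed

lemma l2_tendsto_AE_subseq:
  assumes f: "\<And>n. square_integrable M (f n)" and g: "square_integrable M g"
    and lim: "(\<lambda>n. l2_sq M (\<lambda>x. f n x - g x)) \<longlonglongrightarrow> 0"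
  shows "\<exists>r::nat\<Rightarrow>nat. strict_mono r \<and> (AE x in M. (\<lambda>n. f (r n) x) \<longlonglongrightarrow> g x)"
proof -
  have "\<exists>r::nat\<Rightarrow>nat. strict_mono r \<and> (AE x in M. (\<lambda>n. (norm (f (r n) x - g x))\<^sup>2) \<longlonglongrightarrow> 0)"
    using tendsto_L1_AE_subseq[of M "\<lambda>n x. (norm (f n x - g x))\<^sup>2"]
      square_integrable_diff[OF f g] lim by (auto simp: square_integrable_def l2_sq_def)
  then obtain r :: "nat \<Rightarrow> nat" where r: "strict_mono r"
    "AE x in M. (\<lambda>n. (norm (f (r n) x - g x))\<^sup>2) \<longlonglongrightarrow> 0" by blast
  from r(2) have "AE x in M. (\<lambda>n. f (r n) x) \<longlonglongrightarrow> g x"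
  proof eventually_elim
    case (elim x)
    from tendsto_real_sqrt[OF this] have "(\<lambda>n. norm (f (r n) x - g x)) \<longlonglongrightarrow> 0" by simp
    then show ?case by (simp add: tendsto_norm_zero_iff LIM_zero_iff)
  qed
  then show ?thesis using r(1) by blast
qed

section \<open>Completeness of L^2\<close>

text \<open>Finiteness of the weighted sum bounds every single term, so \<open>d k\<close> decays
  like \<open>(1/2) ^ k\<close>. This turns the finiteness of a sum of squares, which integrals can
  provide at almost every point, into absolute convergence there.\<close>

lemma summable_of_weighted_square_sum:
  fixes d :: "nat \<Rightarrow> real"
  assumes "\<And>k. 0 \<le> d k" "(\<Sum>k. ennreal (4 ^ k * (d k)\<^sup>2)) \<noteq> \<infinity>"
  shows "summable d"
proof -
  define C where "C = enn2real (\<Sum>k. ennreal (4 ^ k * (d k)\<^sup>2))"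
  have C: "(\<Sum>k. ennreal (4 ^ k * (d k)\<^sup>2)) = ennreal C" "0 \<le> C"
    using assms(2) by (simp_all add: C_def less_top)
  have "norm (d k) \<le> sqrt C * (1 / 2) ^ k" for k
  proof -
    have "ennreal (4 ^ k * (d k)\<^sup>2) \<le> ennreal C"
      using sum_le_suminf[of "\<lambda>k. ennreal (4 ^ k * (d k)\<^sup>2)" "{k}"] C by simp
    then have "(2 ^ k * d k)\<^sup>2 \<le> C"
    proof -
      have "(4::real) ^ k = (2 ^ k)\<^sup>2" by (simp add: power2_eq_square flip: power_mult_distrib)
      then show ?thesis using C \<open>ennreal (4 ^ k * (d k)\<^sup>2) \<le> ennreal C\<close>
        by (simp add: power_mult_distrib)
    qed
    then have "2 ^ k * d k \<le> sqrt C" by (rule real_le_rsqrt)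
    then have "d k \<le> sqrt C / 2 ^ k" by (simp add: pos_le_divide_eq mult.commute)
    then show ?thesis using assms(1)[of k] by (simp add: power_divide)
  qed
  moreover have "summable (\<lambda>k. sqrt C * (1 / 2 :: real) ^ k)"
    by (intro summable_mult summable_geometric) simp
  ultimately show ?thesis
    by (intro summable_comparison_test'[of "\<lambda>k. sqrt C * (1 / 2) ^ k" 0 d]) auto
qed

lemma l2_complete:
  fixes f :: "nat \<Rightarrow> 'a \<Rightarrow> 'b::euclidean_space"
  assumes f: "\<And>n. square_integrable M (f n)"
    and Cauchy: "\<And>e. e > 0 \<Longrightarrow> \<exists>N. \<forall>m\<ge>N. \<forall>n\<ge>N. l2_sq M (\<lambda>x. f m x - f n x) < e"
  shows "\<exists>g. square_integrable M g \<and> (\<lambda>n. l2_sq M (\<lambda>x. f n x - g x)) \<longlonglongrightarrow> 0"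
proof -
  \<comment> \<open>A squared distance \<open>(1/16) ^ k\<close> against the weight
    \<open>4 ^ k\<close> leaves the summable bound \<open>(1/4) ^ k\<close>.\<close>
  have "\<forall>k. \<exists>N. \<forall>m\<ge>N. \<forall>n\<ge>N. l2_sq M (\<lambda>x. f m x - f n x) < (1 / 16) ^ k"
    using Cauchy by simp
  then obtain R where R: "\<And>k m n. m \<ge> R k \<Longrightarrow> n \<ge> R k \<Longrightarrow> l2_sq M (\<lambda>x. f m x - f n x) < (1 / 16) ^ k"
    by metis
  \<comment> \<open>Partial sums put both \<open>r k\<close> and \<open>r (Suc k)\<close> above the
    threshold \<open>R k\<close>; the added \<open>k\<close> makes \<open>r\<close> tend to
    infinity.\<close>
  define r where "r k = (\<Sum>j\<le>k. R j) + k" for k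
  have r: "r k \<ge> R k" "r (Suc k) \<ge> R k" "r k \<ge> k" for k
    using member_le_sum[of k "{..k}" R] by (auto simp: r_def)
  define d where "d k x = norm (f (r (Suc k)) x - f (r k) x)" for k x
  note [measurable] = square_integrable_measurable[OF f]
  have dm [measurable]: "d k \<in> borel_measurable M" for k
    unfolding d_def by measurable
  have dint: "(\<integral>\<^sup>+x. ennreal (4 ^ k * (d k x)\<^sup>2) \<partial>M) \<le> ennreal ((1 / 4) ^ k)" for k
  proof -
    have "integrable M (\<lambda>x. (d k x)\<^sup>2)"
      using square_integrable_diff[OF f f] by (simp add: d_def square_integrable_def)
    then have "(\<integral>\<^sup>+x. ennreal (4 ^ k * (d k x)\<^sup>2) \<partial>M) = ennreal (4 ^ k * l2_sq M (\<lambda>x. f (r (Suc k)) x - f (r k) x))"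
      by (subst nn_integral_eq_integral) (auto simp: d_def l2_sq_def)
    also have "\<dots> \<le> ennreal (4 ^ k * (1 / 16) ^ k)"
      using R[OF r(2,1), of k] by (intro ennreal_leI mult_left_mono) auto
    also have "(4::real) ^ k * (1 / 16) ^ k = (1 / 4) ^ k"
      by (simp flip: power_mult_distrib)
    finally show ?thesis .
  qed
  have "(\<integral>\<^sup>+x. (\<Sum>k. ennreal (4 ^ k * (d k x)\<^sup>2)) \<partial>M) = (\<Sum>k. \<integral>\<^sup>+x. ennreal (4 ^ k * (d k x)\<^sup>2) \<partial>M)"
    by (rule nn_integral_suminf) measurable
  also have "\<dots> \<le> (\<Sum>k. ennreal ((1 / 4) ^ k))"
    by (intro suminf_le dint) auto
  also have "\<dots> = ennreal (\<Sum>k. (1 / 4) ^ k)"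
    by (rule suminf_ennreal2) (auto intro: summable_geometric)
  finally have "(\<integral>\<^sup>+x. (\<Sum>k. ennreal (4 ^ k * (d k x)\<^sup>2)) \<partial>M) \<noteq> \<infinity>"
    by (auto simp: top_unique)
  then have "AE x in M. (\<Sum>k. ennreal (4 ^ k * (d k x)\<^sup>2)) \<noteq> \<infinity>"
    by (intro nn_integral_PInf_AE) measurable
  then have conv: "AE x in M. convergent (\<lambda>k. f (r k) x)"
  proof eventually_elim
    case (elim x)
    have "summable (\<lambda>k. d k x)"
      by (rule summable_of_weighted_square_sum) (use elim in \<open>auto simp: d_def\<close>)
    then have "summable (\<lambda>k. f (r (Suc k)) x - f (r k) x)"
      unfolding d_def by (rule summable_norm_cancel)
    then have "convergent (\<lambda>n. \<Sum>k<n. f (r (Suc k)) x - f (r k) x)"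
      by (simp add: summable_iff_convergent)
    then have "convergent (\<lambda>n. f (r n) x - f (r 0) x)"
      by (simp only: sum_lessThan_telescope[of "\<lambda>k. f (r k) x"])
    then show ?case by (simp only: convergent_diff_const_right_iff)
  qed
  define g where "g x = lim (\<lambda>k. f (r k) x)" for x
  have gm [measurable]: "g \<in> borel_measurable M"
    unfolding g_def by measurable
  have lim: "AE x in M. (\<lambda>k. f (r k) x) \<longlonglongrightarrow> g x"
    using conv by eventually_elim (simp add: g_def convergent_LIMSEQ_iff)
  \<comment> \<open>This passes from the subsequence to the whole sequence: \<open>f n\<close> is
    compared with \<open>f (r k)\<close>, and Fatou's lemma is applied as \<open>k\<close>
    grows.\<close>
  have key: "square_integrable M (\<lambda>x. f n x - g x) \<and> l2_sq M (\<lambda>x. f n x - g x) \<le> e"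
    if N: "\<And>m. m \<ge> N \<Longrightarrow> l2_sq M (\<lambda>x. f n x - f m x) \<le> e" for n N e
  proof -
    have "integrable M (\<lambda>x. (norm (f n x - g x))\<^sup>2) \<and> (LINT x|M. (norm (f n x - g x))\<^sup>2) \<le> e"
    proof (rule integral_fatou_bound[where u = "\<lambda>k x. (norm (f n x - f (r k) x))\<^sup>2"])
      show "integrable M (\<lambda>x. (norm (f n x - f (r k) x))\<^sup>2)" for k
        using square_integrable_diff[OF f f] by (simp add: square_integrable_def)
      show "AE x in M. (\<lambda>k. (norm (f n x - f (r k) x))\<^sup>2) \<longlonglongrightarrow> (norm (f n x - g x))\<^sup>2"
        using lim by eventually_elim (intro tendsto_intros)
      show "\<forall>\<^sub>F k in sequentially. (LINT x|M. (norm (f n x - f (r k) x))\<^sup>2) \<le> e"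
        using N r(3) unfolding l2_sq_def eventually_sequentially by (meson order_trans)
    qed auto
    then show ?thesis by (simp add: square_integrable_def l2_sq_def)
  qed
  have small: "\<exists>N. \<forall>n\<ge>N. square_integrable M (\<lambda>x. f n x - g x) \<and> l2_sq M (\<lambda>x. f n x - g x) \<le> e" if e: "e > 0" for e
  proof -
    obtain N where "\<forall>m\<ge>N. \<forall>n\<ge>N. l2_sq M (\<lambda>x. f m x - f n x) < e" using Cauchy[OF e] by blast
    then show ?thesis using key[of N _ e] by (meson less_imp_le)
  qed
  obtain N where "square_integrable M (\<lambda>x. f N x - g x)" using small[of 1] by auto
  then have "square_integrable M g"
    using square_integrable_diff[OF f[of N]] by fastforce
  moreover have "(\<lambda>n. l2_sq M (\<lambda>x. f n x - g x)) \<longlonglongrightarrow> 0"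
  proof (rule LIMSEQ_I)
    fix e :: real assume "e > 0"
    then obtain N where "\<forall>n\<ge>N. l2_sq M (\<lambda>x. f n x - g x) \<le> e / 2" using small[of "e / 2"] by auto
    then show "\<exists>N. \<forall>n\<ge>N. norm (l2_sq M (\<lambda>x. f n x - g x) - 0) < e"
      using \<open>e > 0\<close> by (intro exI[of _ N]) (fastforce simp: l2_sq_nonneg)
  qed
  ultimately show ?thesis by blast
qed

section \<open>Test functions, Poincare's inequality and weak gradients\<close>

definition grad :: "('a::euclidean_space \<Rightarrow> real) \<Rightarrow> 'a \<Rightarrow> 'a" where
  "grad \<phi> x = (\<Sum>i\<in>Basis. frechet_derivative \<phi> (at x) i *\<^sub>R i)"

text \<open>With value and gradient in one vector, the squared H^1 norm is \<open>l2_sq\<close> of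
  the jet, and limits in H^1 become limits in L^2.\<close>

definition jet :: "('a::euclidean_space \<Rightarrow> real) \<Rightarrow> 'a \<Rightarrow> real \<times> 'a" where
  "jet \<phi> x = (\<phi> x, grad \<phi> x)"

lemma grad_inner: "i \<in> Basis \<Longrightarrow> grad \<phi> x \<bullet> i = frechet_derivative \<phi> (at x) i"
  by (simp add: grad_def inner_sum_left inner_Basis if_distrib cong: if_cong)

lemma test_function_times_cont_diff: "\<phi> \<in> test_functions \<Omega> \<Longrightarrow> times_cont_diff k \<phi>"
  by (simp add: test_functions_def)

lemma test_function_has_derivative:
  "\<phi> \<in> test_functions \<Omega> \<Longrightarrow> (\<phi> has_derivative frechet_derivative \<phi> (at x)) (at x)"
  using times_cont_diff_has_derivative[of 0] test_function_times_cont_diff by blast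

lemma test_function_continuous: "\<phi> \<in> test_functions \<Omega> \<Longrightarrow> continuous_on UNIV \<phi>"
  using test_function_times_cont_diff[of \<phi> \<Omega> 0] by simp

lemma test_function_zero_outside:
  assumes "\<phi> \<in> test_functions \<Omega>" "x \<notin> \<Omega>"
  shows "\<phi> x = 0"
  using assms closure_subset[of "{x. \<phi> x \<noteq> 0}"] by (auto simp: test_functions_def)

lemma frechet_derivative_zero_outside_support:
  assumes "x \<notin> closure {x. \<phi> x \<noteq> 0}"
  shows "frechet_derivative \<phi> (at x) = (\<lambda>v. 0)"
proof -
  have "((\<lambda>_. 0) has_derivative (\<lambda>v. 0)) (at x)" by simp
  then have "(\<phi> has_derivative (\<lambda>v. 0)) (at x)"
  proof (rule has_derivative_transform_within_open)
    show "open (- closure {x. \<phi> x \<noteq> 0})" by (rule open_Compl[OF closed_closure])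
    show "0 = \<phi> y" if "y \<in> - closure {x. \<phi> x \<noteq> 0}" for y
      using that closure_subset[of "{x. \<phi> x \<noteq> 0}"] by auto
  qed (use assms in auto)
  then show ?thesis by (metis frechet_derivative_at)
qed

lemma test_functions_partial:
  assumes "\<phi> \<in> test_functions \<Omega>" "i \<in> Basis"
  shows "(\<lambda>x. frechet_derivative \<phi> (at x) i) \<in> test_functions \<Omega>"
proof -
  have "closure {x. frechet_derivative \<phi> (at x) i \<noteq> 0} \<subseteq> closure {x. \<phi> x \<noteq> 0}"
  proof (intro closure_minimal subsetI closed_closure)
    fix x assume "x \<in> {x. frechet_derivative \<phi> (at x) i \<noteq> 0}"
    then show "x \<in> closure {x. \<phi> x \<noteq> 0}"
      using frechet_derivative_zero_outside_support[of x \<phi>] by force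
  qed
  moreover have "times_cont_diff k (\<lambda>x. frechet_derivative \<phi> (at x) i)" for k
    using test_function_times_cont_diff[OF assms(1), of "Suc k"] assms(2) by simp
  moreover have "compact (closure {x. \<phi> x \<noteq> 0})" "closure {x. \<phi> x \<noteq> 0} \<subseteq> \<Omega>"
    using assms by (auto simp: test_functions_def)
  ultimately show ?thesis
    unfolding test_functions_def
    by (auto simp: compact_eq_bounded_closed dest: bounded_subset)
qed

lemma test_function_bounded:
  assumes "\<phi> \<in> test_functions \<Omega>"
  obtains B where "B > 0" "\<And>x. \<bar>\<phi> x\<bar> \<le> B"
proof -
  have "compact (closure {x. \<phi> x \<noteq> 0})" using assms by (simp add: test_functions_def)
  then have "bounded (\<phi> ` closure {x. \<phi> x \<noteq> 0})"
    using test_function_continuous[OF assms]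
    by (intro compact_imp_bounded compact_continuous_image) (auto intro: continuous_on_subset)
  then obtain B where B: "B > 0" "\<forall>x\<in>closure {x. \<phi> x \<noteq> 0}. \<bar>\<phi> x\<bar> \<le> B"
    by (auto simp: bounded_pos)
  have "\<bar>\<phi> x\<bar> \<le> B" for x
    using B closure_subset[of "{x. \<phi> x \<noteq> 0}"] by (cases "\<phi> x = 0") auto
  then show ?thesis using that B(1) by blast
qed

lemma frechet_derivative_sin_scaled:
  assumes "\<phi> \<in> test_functions \<Omega>" "c > 0"
  shows "frechet_derivative (\<lambda>x. c * sin (\<phi> x / c)) (at x) v = cos (\<phi> x / c) * frechet_derivative \<phi> (at x) v"
proof -
  have "((\<lambda>x. c * sin (\<phi> x / c)) has_derivative (\<lambda>v. cos (\<phi> x / c) * frechet_derivative \<phi> (at x) v)) (at x)"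
    using assms(2) by (auto intro!: derivative_eq_intros test_function_has_derivative[OF assms(1)])
  then show ?thesis by (metis frechet_derivative_at)
qed

lemma grad_sin:
  assumes "\<phi> \<in> test_functions \<Omega>" "c > 0"
  shows "grad (\<lambda>x. c * sin (\<phi> x / c)) x = cos (\<phi> x / c) *\<^sub>R grad \<phi> x"
  by (simp add: grad_def frechet_derivative_sin_scaled[OF assms] scaleR_sum_right)

lemma jet_linear:
  assumes "\<phi> \<in> test_functions \<Omega>" "\<psi> \<in> test_functions \<Omega>"
  shows "jet (\<lambda>x. \<phi> x + c * \<psi> x) x = jet \<phi> x + c *\<^sub>R jet \<psi> x"
proof -
  have "((\<lambda>x. \<phi> x + c * \<psi> x) has_derivative (\<lambda>v. frechet_derivative \<phi> (at x) v + c * frechet_derivative \<psi> (at x) v)) (at x)"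
    by (auto intro!: derivative_eq_intros test_function_has_derivative[OF assms(1)] test_function_has_derivative[OF assms(2)])
  then have "frechet_derivative (\<lambda>x. \<phi> x + c * \<psi> x) (at x) = (\<lambda>v. frechet_derivative \<phi> (at x) v + c * frechet_derivative \<psi> (at x) v)"
    by (metis frechet_derivative_at)
  then show ?thesis
    by (simp add: jet_def grad_def scaleR_sum_right algebra_simps sum.distrib)
qed

lemma l2_sq_pair:
  assumes "square_integrable M F"
  shows "square_integrable M (\<lambda>x. fst (F x))" "square_integrable M (\<lambda>x. snd (F x))"
    "l2_sq M F = l2_sq M (\<lambda>x. fst (F x)) + l2_sq M (\<lambda>x. snd (F x))"
proof -
  have m: "F \<in> borel_measurable M" using assms by (rule square_integrable_measurable)
  have mf: "(\<lambda>x. fst (F x)) \<in> borel_measurable M" "(\<lambda>x. snd (F x)) \<in> borel_measurable M"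
    using m by (auto intro: borel_measurable_continuous_on[of fst, OF continuous_on_fst[OF continuous_on_id]]
        borel_measurable_continuous_on[of snd, OF continuous_on_snd[OF continuous_on_id]])
  show 1: "square_integrable M (\<lambda>x. fst (F x))"
    by (rule square_integrable_bound[OF assms mf(1)]) (intro AE_I2, metis norm_fst_le prod.collapse)
  show 2: "square_integrable M (\<lambda>x. snd (F x))"
    by (rule square_integrable_bound[OF assms mf(2)]) (intro AE_I2, metis norm_snd_le prod.collapse)
  have "(norm z)\<^sup>2 = (norm (fst z))\<^sup>2 + (norm (snd z))\<^sup>2" for z :: "'b \<times> 'c"
    by (cases z) (simp add: norm_Pair)
  then show "l2_sq M F = l2_sq M (\<lambda>x. fst (F x)) + l2_sq M (\<lambda>x. snd (F x))"
    using 1 2 by (simp add: l2_sq_def square_integrable_def)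
qed

lemma square_integrable_Pair:
  assumes "square_integrable M f" "square_integrable M g"
  shows "square_integrable M (\<lambda>x. (f x, g x))"
  using assms by (auto simp: square_integrable_def norm_Pair intro!: borel_measurable_Pair)

lemma Lp_space_2: "Lp_space 2 \<Omega> = {u. square_integrable (lebesgue_on \<Omega>) u}"
  by (simp add: Lp_space_def square_integrable_def)

section \<open>Test functions on a bounded domain\<close>

locale bounded_domain =
  fixes \<Omega> :: "'a::euclidean_space set"
  assumes open_\<Omega>: "open \<Omega>" and bounded_\<Omega>: "bounded \<Omega>"
begin

abbreviation "M \<equiv> lebesgue_on \<Omega>"

lemma sets_\<Omega>: "\<Omega> \<in> sets lebesgue"
  using open_\<Omega> by simp

lemma finite_measure_M: "finite_measure M"
  using open_\<Omega> bounded_\<Omega> by (intro finite_measure_lebesgue_on) (simp add: lmeasurable_open)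

lemma bounded_square_integrable:
  assumes "f \<in> borel_measurable M" "\<And>x. norm (f x) \<le> B"
  shows "square_integrable M f"
proof -
  have "integrable M (\<lambda>x. (norm (f x))\<^sup>2)"
    using assms power_mono[OF assms(2) norm_ge_zero, of _ 2]
    by (intro finite_measure.integrable_const_bound[OF finite_measure_M, of _ "B\<^sup>2"]) auto
  then show ?thesis using assms by (simp add: square_integrable_def)
qed

lemma test_function_measurable:
  "\<phi> \<in> test_functions \<Omega> \<Longrightarrow> \<phi> \<in> borel_measurable M"
  by (meson continuous_imp_measurable_on_sets_lebesgue continuous_on_subset sets_\<Omega> subset_UNIV test_function_continuous)

lemma test_function_square_integrable:
  assumes "\<phi> \<in> test_functions \<Omega>"
  shows "square_integrable M \<phi>"
proof -
  obtain B where "\<And>x. \<bar>\<phi> x\<bar> \<le> B" using test_function_bounded[OF assms] by blast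
  then show ?thesis
    using test_function_measurable[OF assms] by (intro bounded_square_integrable) auto
qed

lemma square_integrable_grad:
  assumes "\<phi> \<in> test_functions \<Omega>"
  shows "square_integrable M (grad \<phi>)"
proof -
  have *: "square_integrable M (\<lambda>x. \<Sum>i\<in>I. frechet_derivative \<phi> (at x) i *\<^sub>R i)"
    if "I \<subseteq> Basis" "finite I" for I :: "'a set"
    using that(2,1)
  proof induction
    case (insert i I)
    have "square_integrable M (\<lambda>x. frechet_derivative \<phi> (at x) i)"
      using insert test_functions_partial[OF assms] by (auto intro: test_function_square_integrable)
    then have "square_integrable M (\<lambda>x. frechet_derivative \<phi> (at x) i *\<^sub>R i)"
      using insert by (auto simp: square_integrable_def)
    then have "square_integrable M (\<lambda>x. frechet_derivative \<phi> (at x) i *\<^sub>R i + 1 *\<^sub>R (\<Sum>i\<in>I. frechet_derivative \<phi> (at x) i *\<^sub>R i))"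
      using insert by (intro square_integrable_add_scaleR) auto
    then show ?case using insert by simp
  qed (simp add: square_integrable_zero)
  show ?thesis using *[of Basis] by (simp add: grad_def[abs_def])
qed

lemma square_integrable_jet:
  "\<phi> \<in> test_functions \<Omega> \<Longrightarrow> square_integrable M (jet \<phi>)"
  unfolding jet_def[abs_def]
  by (intro square_integrable_Pair test_function_square_integrable square_integrable_grad)

lemma integral_lebesgue_on_support:
  fixes f :: "'a \<Rightarrow> real"
  assumes "\<And>x. x \<notin> \<Omega> \<Longrightarrow> f x = 0"
  shows "(LINT x|lebesgue. f x) = (LINT x|M. f x)"
proof -
  have "(LINT x|M. f x) = (LINT x|lebesgue. indicator \<Omega> x *\<^sub>R f x)"
    using sets_\<Omega> by (intro integral_restrict_space) auto
  also have "\<dots> = (LINT x|lebesgue. f x)"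
    using assms by (intro Bochner_Integration.integral_cong) (auto split: split_indicator)
  finally show ?thesis by simp
qed

text \<open>The product of two test functions has compact support, so its partial derivatives
  integrate to zero.\<close>

lemma integration_by_parts:
  assumes "\<phi> \<in> test_functions \<Omega>" "\<psi> \<in> test_functions \<Omega>" "i \<in> Basis"
  shows "(LINT x|M. \<phi> x * frechet_derivative \<psi> (at x) i) = - (LINT x|M. frechet_derivative \<phi> (at x) i * \<psi> x)"
proof -
  let ?d = "\<lambda>x v. \<phi> x * frechet_derivative \<psi> (at x) v + frechet_derivative \<phi> (at x) v * \<psi> x"
  have "(LINT x|lebesgue. ?d x i) = 0"
  proof (rule integral_directional_derivative_zero[of "\<lambda>x. \<phi> x * \<psi> x" ?d i])
    show "((\<lambda>x. \<phi> x * \<psi> x) has_derivative ?d x) (at x)" for x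
      by (auto intro!: derivative_eq_intros test_function_has_derivative[OF assms(1)] test_function_has_derivative[OF assms(2)])
    show "continuous_on UNIV (\<lambda>x. ?d x i)"
      by (intro continuous_on_add continuous_on_mult test_function_continuous[of _ \<Omega>] test_functions_partial assms)
    have "bounded (closure {x. \<phi> x \<noteq> 0})"
      using assms by (auto simp: test_functions_def compact_imp_bounded)
    then show "bounded {x. \<phi> x * \<psi> x \<noteq> 0}"
      by (rule bounded_subset) (use closure_subset in fastforce)
  qed
  moreover have "(LINT x|lebesgue. ?d x i) = (LINT x|M. ?d x i)"
    using sets_\<Omega> test_function_zero_outside[OF assms(1)] test_function_zero_outside[OF assms(2)]
    by (intro integral_lebesgue_on_support) auto
  moreover have "(LINT x|M. ?d x i) = (LINT x|M. \<phi> x * frechet_derivative \<psi> (at x) i) + (LINT x|M. frechet_derivative \<phi> (at x) i * \<psi> x)"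
    using square_integrable_inner[of M \<phi> "\<lambda>x. frechet_derivative \<psi> (at x) i"]
      square_integrable_inner[of M "\<lambda>x. frechet_derivative \<phi> (at x) i" \<psi>]
      test_function_square_integrable test_functions_partial assms
    by (intro Bochner_Integration.integral_add) auto
  ultimately show ?thesis by simp
qed

text \<open>Integrate the derivative of \<open>\<phi>\<^sup>2 x\<^sub>i\<close> in the direction \<open>i\<close> and absorb the mixed term.\<close>

lemma poincare_test_function:
  assumes \<phi>: "\<phi> \<in> test_functions \<Omega>" and R: "\<And>x. x \<in> \<Omega> \<Longrightarrow> norm x \<le> R"
  shows "l2_sq M \<phi> \<le> 4 * R\<^sup>2 * l2_sq M (grad \<phi>)"
proof -
  obtain i :: 'a where i: "i \<in> Basis" using nonempty_Basis by blast
  let ?d = "\<lambda>x v. (\<phi> x * \<phi> x) * (v \<bullet> i) + (2 * \<phi> x * frechet_derivative \<phi> (at x) v) * (x \<bullet> i)"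
  have "(LINT x|lebesgue. ?d x i) = 0"
  proof (rule integral_directional_derivative_zero[of "\<lambda>x. (\<phi> x * \<phi> x) * (x \<bullet> i)" ?d i])
    show "((\<lambda>x. (\<phi> x * \<phi> x) * (x \<bullet> i)) has_derivative ?d x) (at x)" for x
      by (auto intro!: derivative_eq_intros test_function_has_derivative[OF \<phi>] simp: algebra_simps)
    show "continuous_on UNIV (\<lambda>x. ?d x i)"
      using test_function_continuous[OF \<phi>] test_function_continuous[OF test_functions_partial[OF \<phi> i]]
      by (intro continuous_on_add continuous_on_mult continuous_on_inner continuous_on_const continuous_on_id)
    have "bounded (closure {x. \<phi> x \<noteq> 0})"
      using \<phi> by (auto simp: test_functions_def compact_imp_bounded)
    then show "bounded {x. (\<phi> x * \<phi> x) * (x \<bullet> i) \<noteq> 0}"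
      by (rule bounded_subset) (use closure_subset in fastforce)
  qed
  moreover have "(LINT x|lebesgue. ?d x i) = (LINT x|M. ?d x i)"
    using test_function_zero_outside[OF \<phi>] by (intro integral_lebesgue_on_support) auto
  moreover have "(1/2) * l2_sq M \<phi> - 2 * R\<^sup>2 * l2_sq M (grad \<phi>) \<le> (LINT x|M. ?d x i)"
  proof -
    have g: "integrable M (\<lambda>x. (norm (grad \<phi> x))\<^sup>2)" "integrable M (\<lambda>x. (norm (\<phi> x))\<^sup>2)"
      using square_integrable_grad[OF \<phi>] test_function_square_integrable[OF \<phi>] by (auto simp: square_integrable_def)
    have d: "integrable M (\<lambda>x. ?d x i)"
    proof (rule Bochner_Integration.integrable_add)
      show "integrable M (\<lambda>x. \<phi> x * \<phi> x * (i \<bullet> i))"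
        using g(2) by (simp add: power2_eq_square)
      have "(\<lambda>x. x \<bullet> i) \<in> borel_measurable M"
        by (intro continuous_imp_measurable_on_sets_lebesgue sets_\<Omega> continuous_on_inner continuous_on_id continuous_on_const)
      then have "square_integrable M (\<lambda>x. frechet_derivative \<phi> (at x) i * (x \<bullet> i))"
      proof (intro square_integrable_bound[OF square_integrable_scaleR[OF test_function_square_integrable[OF test_functions_partial[OF \<phi> i]], of R]])
        show "AE x in M. norm (frechet_derivative \<phi> (at x) i * (x \<bullet> i)) \<le> norm (R *\<^sub>R frechet_derivative \<phi> (at x) i)"
        proof (rule AE_I2)
          fix x assume "x \<in> space M"
          then have "norm x \<le> R" using R by simp
          then have "\<bar>x \<bullet> i\<bar> \<le> \<bar>R\<bar>" using Basis_le_norm[OF i, of x] by linarith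
          then show "norm (frechet_derivative \<phi> (at x) i * (x \<bullet> i)) \<le> norm (R *\<^sub>R frechet_derivative \<phi> (at x) i)"
            by (simp add: abs_mult mult.commute mult_right_mono)
        qed
      qed (use test_function_measurable[OF test_functions_partial[OF \<phi> i]] in auto)
      from square_integrable_inner[OF test_function_square_integrable[OF \<phi>] this]
      show "integrable M (\<lambda>x. 2 * \<phi> x * frechet_derivative \<phi> (at x) i * (x \<bullet> i))"
        by (simp add: mult.assoc)
    qed
    have "(1/2) * l2_sq M \<phi> - 2 * R\<^sup>2 * l2_sq M (grad \<phi>) = (LINT x|M. (1/2) * (norm (\<phi> x))\<^sup>2 - 2 * R\<^sup>2 * (norm (grad \<phi> x))\<^sup>2)"
      using g by (simp add: l2_sq_def)
    also have "\<dots> \<le> (LINT x|M. ?d x i)"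
    proof (rule integral_mono)
      fix x assume "x \<in> space M"
      then have x: "norm x \<le> R" using R by simp
      let ?a = "\<phi> x" and ?b = "frechet_derivative \<phi> (at x) i" and ?c = "x \<bullet> i"
      have "?b\<^sup>2 \<le> (norm (grad \<phi> x))\<^sup>2"
        using Basis_le_norm[OF i, of "grad \<phi> x"] by (simp add: grad_inner[OF i] abs_le_square_iff[symmetric])
      moreover have "?c\<^sup>2 \<le> R\<^sup>2"
        using Basis_le_norm[OF i, of x] x by (simp add: abs_le_square_iff[symmetric])
      ultimately have "?b\<^sup>2 * ?c\<^sup>2 \<le> (norm (grad \<phi> x))\<^sup>2 * R\<^sup>2"
        by (intro mult_mono) auto
      \<comment> \<open>Half of this square gives
        \<open>?a^2 + 2 ?a ?b ?c >= ?a^2 / 2 - 2 ?b^2 ?c^2\<close>, which is the source of the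
        constant \<open>4 * R\<^sup>2\<close>.\<close>
      moreover have "0 \<le> (?a + 2 * (?b * ?c))\<^sup>2" by simp
      then have "0 \<le> ?a\<^sup>2 + 4 * (?a * ?b * ?c) + 4 * (?b\<^sup>2 * ?c\<^sup>2)"
        by (simp add: power2_eq_square algebra_simps)
      ultimately show "(1/2) * (norm (\<phi> x))\<^sup>2 - 2 * R\<^sup>2 * (norm (grad \<phi> x))\<^sup>2 \<le> ?d x i"
        using i by (simp add: power2_eq_square[of ?a] algebra_simps)
    qed (use g d in auto)
    finally show ?thesis .
  qed
  ultimately show ?thesis by simp
qed

end

section \<open>Uniqueness and limits of weak gradients\<close>

lemma has_weak_gradient_weak_gradient:
  "has_weak_gradient \<Omega> u G \<Longrightarrow> has_weak_gradient \<Omega> u (weak_gradient \<Omega> u)"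
  unfolding weak_gradient_def by (rule someI[of "has_weak_gradient \<Omega> u"])

context bounded_domain
begin

lemma locally_integrable_mult_test_function:
  assumes h: "locally_integrable \<Omega> h" and \<phi>: "\<phi> \<in> test_functions \<Omega>"
  shows "integrable M (\<lambda>x. h x * \<phi> x)"
proof -
  define K where "K = closure {x. \<phi> x \<noteq> 0}"
  have K: "compact K" "K \<subseteq> \<Omega>" using \<phi> by (auto simp: K_def test_functions_def)
  have hK: "integrable lebesgue (\<lambda>x. indicator K x * h x)"
    using h K by (simp add: locally_integrable_def set_integrable_def)
  obtain B where B: "B > 0" "\<And>x. \<bar>\<phi> x\<bar> \<le> B" using test_function_bounded[OF \<phi>] by blast
  have m: "\<phi> \<in> borel_measurable lebesgue"
    using test_function_continuous[OF \<phi>] by (simp add: borel_measurable_continuous_onI measurable_completion)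
  have "integrable lebesgue (\<lambda>x. indicator K x * h x * \<phi> x)"
  proof (rule Bochner_Integration.integrable_bound)
    show "integrable lebesgue (\<lambda>x. B * (indicator K x * h x))"
      by (rule integrable_mult_right[OF hK])
    show "(\<lambda>x. indicator K x * h x * \<phi> x) \<in> borel_measurable lebesgue"
      by (rule borel_measurable_times[OF borel_measurable_integrable[OF hK] m])
    show "AE x in lebesgue. norm (indicator K x * h x * \<phi> x) \<le> norm (B * (indicator K x * h x))"
    proof (rule AE_I2)
      fix x
      have "\<bar>\<phi> x\<bar> * \<bar>indicator K x * h x\<bar> \<le> B * \<bar>indicator K x * h x\<bar>"
        using B by (intro mult_right_mono) auto
      then show "norm (indicator K x * h x * \<phi> x) \<le> norm (B * (indicator K x * h x))"
        using B(1) by (simp only: real_norm_def abs_mult) (simp add: mult_ac)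
    qed
  qed
  moreover have "(\<lambda>x. indicator K x * h x * \<phi> x) = (\<lambda>x. indicator \<Omega> x *\<^sub>R (h x * \<phi> x))"
    using K(2) closure_subset[of "{x. \<phi> x \<noteq> 0}"] test_function_zero_outside[OF \<phi>]
    by (force simp: fun_eq_iff K_def split: split_indicator)
  ultimately show ?thesis
    using sets_\<Omega> by (simp add: integrable_restrict_space)
qed

lemma square_integrable_imp_integrable:
  assumes "square_integrable M f"
  shows "integrable M f"
proof (rule Bochner_Integration.integrable_bound)
  interpret finite_measure M by (rule finite_measure_M)
  show "integrable M (\<lambda>x. 1 + (norm (f x))\<^sup>2)"
    using assms by (simp add: square_integrable_def)
  have "t \<le> 1 + t\<^sup>2" for t :: real
    using zero_le_power2[of "t - 1/2"] by (simp add: power2_eq_square algebra_simps)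
  then show "AE x in M. norm (f x) \<le> norm (1 + (norm (f x))\<^sup>2)" by simp
qed (use assms in \<open>simp add: square_integrable_def\<close>)

lemma square_integrable_imp_locally_integrable:
  fixes f :: "'a \<Rightarrow> 'b::euclidean_space"
  assumes "square_integrable M f"
  shows "locally_integrable \<Omega> f"
proof -
  have "set_integrable lebesgue \<Omega> f"
    using square_integrable_imp_integrable[OF assms] sets_\<Omega>
    by (simp add: set_integrable_def integrable_restrict_space)
  then show ?thesis
    unfolding locally_integrable_def
    using set_integrable_subset fmeasurableD[OF lmeasurable_compact] by blast
qed

text \<open>Each component of the difference integrates to zero against every test function, so the
  fundamental lemma applies. This makes the choice in \<open>weak_gradient\<close>
  immaterial.\<close>

lemma weak_gradient_unique:
  assumes "has_weak_gradient \<Omega> u G" "has_weak_gradient \<Omega> u H"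
  shows "AE x in M. G x = H x"
proof -
  have comp: "AE x in M. (G x - H x) \<bullet> i = 0" if i: "i \<in> Basis" for i
  proof (rule fundamental_lemma[OF open_\<Omega>])
    have GH: "locally_integrable \<Omega> (\<lambda>x. G x \<bullet> i)" "locally_integrable \<Omega> (\<lambda>x. H x \<bullet> i)"
      using assms i by (auto simp: has_weak_gradient_def locally_integrable_def absolutely_integrable_component)
    then show "locally_integrable \<Omega> (\<lambda>x. (G x - H x) \<bullet> i)"
      by (simp add: locally_integrable_def inner_diff_left set_integral_diff)
    fix \<phi> assume \<phi>: "\<phi> \<in> test_functions \<Omega>"
    have "(LINT x|M. (G x \<bullet> i) * \<phi> x) = (LINT x|M. (H x \<bullet> i) * \<phi> x)"
    proof -
      have "- (LINT x|M. (G x \<bullet> i) * \<phi> x) = (LINT x|M. u x * frechet_derivative \<phi> (at x) i)"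
        "- (LINT x|M. (H x \<bullet> i) * \<phi> x) = (LINT x|M. u x * frechet_derivative \<phi> (at x) i)"
        using assms i \<phi> by (simp_all add: has_weak_gradient_def)
      then show ?thesis by linarith
    qed
    then show "(LINT x|M. ((G x - H x) \<bullet> i) * \<phi> x) = 0"
      using locally_integrable_mult_test_function[OF GH(1) \<phi>] locally_integrable_mult_test_function[OF GH(2) \<phi>]
      by (simp add: inner_diff_left left_diff_distrib)
  qed
  have "AE x in M. \<forall>i\<in>Basis. (G x - H x) \<bullet> i = 0"
    using comp by (subst AE_ball_countable) (auto simp: countable_finite)
  then show ?thesis
    by eventually_elim (simp add: euclidean_eq_iff[where 'a='a] inner_diff_left)
qed

lemma has_weak_gradient_add_scale:
  assumes u: "has_weak_gradient \<Omega> u G" and v: "has_weak_gradient \<Omega> v H"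
  shows "has_weak_gradient \<Omega> (\<lambda>x. u x + c * v x) (\<lambda>x. G x + c *\<^sub>R H x)"
  unfolding has_weak_gradient_def
proof (intro conjI ballI)
  show "locally_integrable \<Omega> (\<lambda>x. u x + c * v x)" "locally_integrable \<Omega> (\<lambda>x. G x + c *\<^sub>R H x)"
    using u v unfolding has_weak_gradient_def locally_integrable_def
    by (auto intro!: set_integral_add set_integrable_mult_right absolutely_integrable_scaleR_left)
  fix \<phi> i assume \<phi>: "\<phi> \<in> test_functions \<Omega>" and i: "i \<in> (Basis :: 'a set)"
  have l: "locally_integrable \<Omega> u" "locally_integrable \<Omega> v"
    "locally_integrable \<Omega> (\<lambda>x. G x \<bullet> i)" "locally_integrable \<Omega> (\<lambda>x. H x \<bullet> i)"
    using u v i by (auto simp: has_weak_gradient_def locally_integrable_def absolutely_integrable_component)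
  note int = locally_integrable_mult_test_function[OF l(1) test_functions_partial[OF \<phi> i]]
    locally_integrable_mult_test_function[OF l(2) test_functions_partial[OF \<phi> i]]
    locally_integrable_mult_test_function[OF l(3) \<phi>] locally_integrable_mult_test_function[OF l(4) \<phi>]
  have eq: "(LINT x|M. u x * frechet_derivative \<phi> (at x) i) = - (LINT x|M. (G x \<bullet> i) * \<phi> x)"
    "(LINT x|M. v x * frechet_derivative \<phi> (at x) i) = - (LINT x|M. (H x \<bullet> i) * \<phi> x)"
    using u v \<phi> i by (auto simp: has_weak_gradient_def)
  show "(LINT x|M. (u x + c * v x) * frechet_derivative \<phi> (at x) i) =
        - (LINT x|M. ((G x + c *\<^sub>R H x) \<bullet> i) * \<phi> x)"
    using int eq by (simp add: distrib_right inner_add_left mult.assoc)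
qed

text \<open>Integration by parts holds for each approximating test function, and both sides are
  continuous under L^2 convergence.\<close>

lemma has_weak_gradient_limit:
  assumes F: "square_integrable M F" and \<phi>: "\<And>n. \<phi> n \<in> test_functions \<Omega>"
    and lim: "(\<lambda>n. l2_sq M (\<lambda>x. jet (\<phi> n) x - F x)) \<longlonglongrightarrow> 0"
  shows "has_weak_gradient \<Omega> (\<lambda>x. fst (F x)) (\<lambda>x. snd (F x))"
  unfolding has_weak_gradient_def
proof (intro conjI ballI)
  show "locally_integrable \<Omega> (\<lambda>x. fst (F x))" "locally_integrable \<Omega> (\<lambda>x. snd (F x))"
    using l2_sq_pair[OF F] by (auto intro: square_integrable_imp_locally_integrable)
  fix \<psi> i assume \<psi>: "\<psi> \<in> test_functions \<Omega>" and i: "i \<in> (Basis :: 'a set)"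
  let ?d = "\<lambda>x. frechet_derivative \<psi> (at x) i"
  have d: "square_integrable M ?d"
    by (rule test_function_square_integrable[OF test_functions_partial[OF \<psi> i]])
  have \<psi>2: "square_integrable M (\<lambda>x. \<psi> x *\<^sub>R i)"
    using test_function_square_integrable[OF \<psi>] i by (auto simp: square_integrable_def)
  have jet: "square_integrable M (jet (\<phi> n))" for n
    by (rule square_integrable_jet[OF \<phi>])
  \<comment> \<open>Testing against a pair with one zero slot isolates the value; the second pair
    below isolates the \<open>i\<close>-th component of the gradient.\<close>
  have "(\<lambda>n. LINT x|M. jet (\<phi> n) x \<bullet> (?d x, 0)) \<longlonglongrightarrow> (LINT x|M. F x \<bullet> (?d x, 0))"
    by (intro l2_tendsto_inner[OF jet F _ lim] square_integrable_Pair d square_integrable_zero)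
  then have 1: "(\<lambda>n. LINT x|M. \<phi> n x * ?d x) \<longlonglongrightarrow> (LINT x|M. fst (F x) * ?d x)"
    by (simp add: jet_def inner_prod_def)
  have "(\<lambda>n. LINT x|M. jet (\<phi> n) x \<bullet> (0, \<psi> x *\<^sub>R i)) \<longlonglongrightarrow> (LINT x|M. F x \<bullet> (0, \<psi> x *\<^sub>R i))"
    by (intro l2_tendsto_inner[OF jet F _ lim] square_integrable_Pair \<psi>2 square_integrable_zero)
  then have 2: "(\<lambda>n. LINT x|M. frechet_derivative (\<phi> n) (at x) i * \<psi> x) \<longlonglongrightarrow> (LINT x|M. (snd (F x) \<bullet> i) * \<psi> x)"
    by (simp add: jet_def inner_prod_def grad_inner[OF i] mult.commute)
  have "(\<lambda>n. LINT x|M. \<phi> n x * ?d x) \<longlonglongrightarrow> - (LINT x|M. (snd (F x) \<bullet> i) * \<psi> x)"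
    using tendsto_minus[OF 2] by (simp add: integration_by_parts[OF \<phi> \<psi> i])
  then show "(LINT x|M. fst (F x) * ?d x) = - (LINT x|M. (snd (F x) \<bullet> i) * \<psi> x)"
    using 1 LIMSEQ_unique by blast
qed

text \<open>Membership in \<open>H10 \<Omega>\<close> as a closure of jets in \<open>L\<^sup>2\<close>, which does not mention the chosen weak gradient.\<close>

definition h10_pair :: "('a \<Rightarrow> real \<times> 'a) \<Rightarrow> bool" where
  "h10_pair F \<longleftrightarrow> square_integrable M F \<and>
    (\<exists>\<phi>. (\<forall>n. \<phi> n \<in> test_functions \<Omega>) \<and> (\<lambda>n::nat. l2_sq M (\<lambda>x. jet (\<phi> n) x - F x)) \<longlonglongrightarrow> 0)"

lemma h10_pair_square_integrable:
  assumes "h10_pair F"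
  shows "square_integrable M F" "square_integrable M (\<lambda>x. fst (F x))" "square_integrable M (\<lambda>x. snd (F x))"
  using assms l2_sq_pair by (auto simp: h10_pair_def)

lemma h10_pairI:
  assumes F: "square_integrable M F"
    and small: "\<And>e. e > 0 \<Longrightarrow> \<exists>\<phi>\<in>test_functions \<Omega>. l2_sq M (\<lambda>x. jet \<phi> x - F x) < e"
  shows "h10_pair F"
proof -
  have "\<forall>n::nat. \<exists>\<phi>. \<phi> \<in> test_functions \<Omega> \<and> l2_sq M (\<lambda>x. jet \<phi> x - F x) < inverse (real (Suc n))"
    using small by (metis inverse_positive_iff_positive of_nat_0_less_iff zero_less_Suc)
  then obtain \<phi> where \<phi>: "\<And>n. \<phi> n \<in> test_functions \<Omega>"
    "\<And>n. l2_sq M (\<lambda>x. jet (\<phi> n) x - F x) < inverse (real (Suc n))" by metis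
  have "(\<lambda>n. l2_sq M (\<lambda>x. jet (\<phi> n) x - F x)) \<longlonglongrightarrow> 0"
    by (rule tendsto_sandwich[OF _ _ tendsto_const LIMSEQ_inverse_real_of_nat])
       (auto simp: l2_sq_nonneg intro!: always_eventually less_imp_le[OF \<phi>(2)] simp del: of_nat_Suc)
  then show ?thesis using F \<phi>(1) unfolding h10_pair_def by blast
qed

lemma h10_pair_jet: "\<phi> \<in> test_functions \<Omega> \<Longrightarrow> h10_pair (jet \<phi>)"
  unfolding h10_pair_def
  by (intro conjI square_integrable_jet exI[of _ "\<lambda>_. \<phi>"]) (auto simp: l2_sq_def)

lemma h10_pair_zero: "h10_pair (\<lambda>x. 0)"
proof -
  have "jet (\<lambda>x. 0) = (\<lambda>x::'a. 0)" by (simp add: jet_def fun_eq_iff grad_def zero_prod_def)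
  then show ?thesis using h10_pair_jet[OF zero_in_test_functions] by metis
qed

lemma h10_pair_add_scaleR:
  assumes "h10_pair F" "h10_pair G"
  shows "h10_pair (\<lambda>x. F x + c *\<^sub>R G x)"
proof -
  obtain \<phi> where \<phi>: "\<And>n. \<phi> n \<in> test_functions \<Omega>" "(\<lambda>n. l2_sq M (\<lambda>x. jet (\<phi> n) x - F x)) \<longlonglongrightarrow> 0"
    using assms(1) by (auto simp: h10_pair_def)
  obtain \<psi> where \<psi>: "\<And>n. \<psi> n \<in> test_functions \<Omega>" "(\<lambda>n. l2_sq M (\<lambda>x. jet (\<psi> n) x - G x)) \<longlonglongrightarrow> 0"
    using assms(2) by (auto simp: h10_pair_def)
  note sF = h10_pair_square_integrable(1)[OF assms(1)] and sG = h10_pair_square_integrable(1)[OF assms(2)]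
  have le: "l2_sq M (\<lambda>x. jet (\<lambda>x. \<phi> n x + c * \<psi> n x) x - (F x + c *\<^sub>R G x)) \<le>
      2 * l2_sq M (\<lambda>x. jet (\<phi> n) x - F x) + 2 * (c\<^sup>2 * l2_sq M (\<lambda>x. jet (\<psi> n) x - G x))" for n
  proof -
    note d = square_integrable_diff[OF square_integrable_jet[OF \<phi>(1)] sF, of n]
      square_integrable_scaleR[OF square_integrable_diff[OF square_integrable_jet[OF \<psi>(1)] sG, of n], of c]
    have "l2_sq M (\<lambda>x. c *\<^sub>R (jet (\<psi> n) x - G x)) = c\<^sup>2 * l2_sq M (\<lambda>x. jet (\<psi> n) x - G x)"
      by (simp add: l2_sq_def power_mult_distrib)
    moreover have "(\<lambda>x. jet (\<lambda>x. \<phi> n x + c * \<psi> n x) x - (F x + c *\<^sub>R G x)) =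
        (\<lambda>x. (jet (\<phi> n) x - F x) + c *\<^sub>R (jet (\<psi> n) x - G x))"
      by (simp add: jet_linear[OF \<phi>(1) \<psi>(1)] fun_eq_iff algebra_simps)
    ultimately show ?thesis using l2_sq_add_le[OF d] by simp
  qed
  have lim: "(\<lambda>n. 2 * l2_sq M (\<lambda>x. jet (\<phi> n) x - F x) + 2 * (c\<^sup>2 * l2_sq M (\<lambda>x. jet (\<psi> n) x - G x))) \<longlonglongrightarrow> 0"
    using tendsto_add[OF tendsto_mult_right_zero[OF \<phi>(2), of 2] tendsto_mult_right_zero[OF tendsto_mult_right_zero[OF \<psi>(2), of "c\<^sup>2"], of 2]]
    by simp
  have "(\<lambda>n. l2_sq M (\<lambda>x. jet (\<lambda>x. \<phi> n x + c * \<psi> n x) x - (F x + c *\<^sub>R G x))) \<longlonglongrightarrow> 0"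
    by (rule tendsto_sandwich[OF always_eventually always_eventually tendsto_const lim])
       (use le in \<open>auto simp: l2_sq_nonneg\<close>)
  then show ?thesis
    unfolding h10_pair_def using test_functions_linear[OF \<phi>(1) \<psi>(1)] sF sG
    by (auto intro!: square_integrable_add_scaleR exI[of _ "\<lambda>n x. \<phi> n x + c * \<psi> n x"])
qed

lemma h10_pair_complete:
  assumes F: "\<And>n::nat. h10_pair (F n)"
    and Cauchy: "\<And>e. e > 0 \<Longrightarrow> \<exists>N. \<forall>m\<ge>N. \<forall>n\<ge>N. l2_sq M (\<lambda>x. F m x - F n x) < e"
  shows "\<exists>G. h10_pair G \<and> (\<lambda>n. l2_sq M (\<lambda>x. F n x - G x)) \<longlonglongrightarrow> 0"
proof -
  note sF = h10_pair_square_integrable(1)[OF F]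
  obtain G where G: "square_integrable M G" "(\<lambda>n. l2_sq M (\<lambda>x. F n x - G x)) \<longlonglongrightarrow> 0"
    using l2_complete[OF sF Cauchy] by blast
  have "h10_pair G"
  proof (rule h10_pairI[OF G(1)])
    fix e :: real assume e: "e > 0"
    have "\<forall>\<^sub>F n in sequentially. l2_sq M (\<lambda>x. F n x - G x) < e / 4"
      using order_tendstoD(2)[OF G(2), of "e / 4"] e by simp
    then obtain n where n: "l2_sq M (\<lambda>x. F n x - G x) < e / 4"
      by (auto simp: eventually_sequentially)
    obtain \<phi> where \<phi>: "\<And>k. \<phi> k \<in> test_functions \<Omega>" "(\<lambda>k. l2_sq M (\<lambda>x. jet (\<phi> k) x - F n x)) \<longlonglongrightarrow> 0"
      using F[of n] by (auto simp: h10_pair_def)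
    have "\<forall>\<^sub>F k in sequentially. l2_sq M (\<lambda>x. jet (\<phi> k) x - F n x) < e / 4"
      using order_tendstoD(2)[OF \<phi>(2), of "e / 4"] e by simp
    then obtain k where k: "l2_sq M (\<lambda>x. jet (\<phi> k) x - F n x) < e / 4"
      by (auto simp: eventually_sequentially)
    \<comment> \<open>Two errors below \<open>e / 4\<close>, each doubled by the triangle inequality
      for squares, add up to less than \<open>e\<close>.\<close>
    have "l2_sq M (\<lambda>x. jet (\<phi> k) x - G x) < e"
      using l2_sq_triangle[OF square_integrable_jet[OF \<phi>(1)] sF G(1), of k n] n k by linarith
    then show "\<exists>\<phi>\<in>test_functions \<Omega>. l2_sq M (\<lambda>x. jet \<phi> x - G x) < e" using \<phi>(1) by blast
  qed
  then show ?thesis using G(2) by blast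
qed

lemma poincare_h10_pair:
  "\<exists>C>0. \<forall>F. h10_pair F \<longrightarrow> l2_sq M (\<lambda>x. fst (F x)) \<le> C * l2_sq M (\<lambda>x. snd (F x))"
proof -
  obtain R where R: "R > 0" "\<And>x. x \<in> \<Omega> \<Longrightarrow> norm x \<le> R"
    using bounded_\<Omega> by (auto simp: bounded_pos)
  have "l2_sq M (\<lambda>x. fst (F x)) \<le> (4 * R\<^sup>2) * l2_sq M (\<lambda>x. snd (F x))" if F: "h10_pair F" for F
  proof -
    obtain \<phi> where \<phi>: "\<And>n. \<phi> n \<in> test_functions \<Omega>" "(\<lambda>n. l2_sq M (\<lambda>x. jet (\<phi> n) x - F x)) \<longlonglongrightarrow> 0"
      using F by (auto simp: h10_pair_def)
    note sF = h10_pair_square_integrable[OF F]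
    have d: "square_integrable M (\<lambda>x. jet (\<phi> n) x - F x)" for n
      by (rule square_integrable_diff[OF square_integrable_jet[OF \<phi>(1)] sF(1)])
    have "(\<lambda>n. l2_sq M (\<lambda>x. \<phi> n x - fst (F x))) \<longlonglongrightarrow> 0"
      by (rule tendsto_sandwich[OF always_eventually always_eventually tendsto_const \<phi>(2)])
         (use l2_sq_pair(3)[OF d] in \<open>auto simp: l2_sq_nonneg jet_def\<close>)
    then have 1: "(\<lambda>n. l2_sq M (\<phi> n)) \<longlonglongrightarrow> l2_sq M (\<lambda>x. fst (F x))"
      by (rule l2_tendsto_l2_sq[OF test_function_square_integrable[OF \<phi>(1)] sF(2)])
    have "(\<lambda>n. l2_sq M (\<lambda>x. grad (\<phi> n) x - snd (F x))) \<longlonglongrightarrow> 0"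
      by (rule tendsto_sandwich[OF always_eventually always_eventually tendsto_const \<phi>(2)])
         (use l2_sq_pair(3)[OF d] in \<open>auto simp: l2_sq_nonneg jet_def\<close>)
    then have 2: "(\<lambda>n. l2_sq M (grad (\<phi> n))) \<longlonglongrightarrow> l2_sq M (\<lambda>x. snd (F x))"
      by (rule l2_tendsto_l2_sq[OF square_integrable_grad[OF \<phi>(1)] sF(3)])
    show ?thesis
      by (rule LIMSEQ_le[OF 1 tendsto_mult[OF tendsto_const 2]])
         (use poincare_test_function[OF \<phi>(1) R(2)] in auto)
  qed
  then show ?thesis using R(1) by (intro exI[of _ "4 * R\<^sup>2"]) auto
qed

section \<open>Pairs and the space \<open>H10\<close>\<close>

text \<open>A gradient picked by \<open>SOME\<close> is known only up to a null set; completeness of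
  Lebesgue measure still makes it measurable. Extension by zero transports this to the restricted
  measure.\<close>

lemma borel_measurable_AE_M:
  fixes G H :: "'a \<Rightarrow> 'b::euclidean_space"
  assumes "G \<in> borel_measurable M" "AE x in M. G x = H x"
  shows "H \<in> borel_measurable M"
proof -
  have "(\<lambda>x. if x \<in> \<Omega> then G x else 0) \<in> borel_measurable lebesgue"
    using assms(1) sets_\<Omega> by (simp add: borel_measurable_if)
  moreover have "AE x in lebesgue. (if x \<in> \<Omega> then G x else 0) = (if x \<in> \<Omega> then H x else 0)"
    using assms(2) sets_\<Omega> by (subst (asm) AE_restrict_space_iff) (auto elim!: eventually_mono)
  ultimately have "(\<lambda>x. if x \<in> \<Omega> then H x else 0) \<in> borel_measurable lebesgue"
    by (rule borel_measurable_AE)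
  then show ?thesis using sets_\<Omega> by (simp add: borel_measurable_if)
qed

text \<open>The first component determines the second almost everywhere, so the chosen
  \<open>weak_gradient\<close> inherits square integrability and the norm from it.\<close>

lemma h10_pair_weak_gradient:
  assumes "h10_pair F"
  shows "has_weak_gradient \<Omega> (\<lambda>x. fst (F x)) (\<lambda>x. snd (F x))"
    "AE x in M. weak_gradient \<Omega> (\<lambda>x. fst (F x)) x = snd (F x)"
    "square_integrable M (weak_gradient \<Omega> (\<lambda>x. fst (F x)))"
    "l2_sq M (weak_gradient \<Omega> (\<lambda>x. fst (F x))) = l2_sq M (\<lambda>x. snd (F x))"
proof -
  note s = h10_pair_square_integrable[OF assms]
  show 1: "has_weak_gradient \<Omega> (\<lambda>x. fst (F x)) (\<lambda>x. snd (F x))"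
    using assms has_weak_gradient_limit[of F] by (auto simp: h10_pair_def)
  then have "has_weak_gradient \<Omega> (\<lambda>x. fst (F x)) (weak_gradient \<Omega> (\<lambda>x. fst (F x)))"
    by (rule has_weak_gradient_weak_gradient)
  from weak_gradient_unique[OF this 1]
  show 2: "AE x in M. weak_gradient \<Omega> (\<lambda>x. fst (F x)) x = snd (F x)" .
  have m: "weak_gradient \<Omega> (\<lambda>x. fst (F x)) \<in> borel_measurable M"
    by (rule borel_measurable_AE_M[OF square_integrable_measurable[OF s(3)]])
       (use 2 in \<open>auto elim!: eventually_mono\<close>)
  show "square_integrable M (weak_gradient \<Omega> (\<lambda>x. fst (F x)))"
    by (rule square_integrable_bound[OF s(3) m]) (use 2 in \<open>auto elim!: eventually_mono\<close>)
  show "l2_sq M (weak_gradient \<Omega> (\<lambda>x. fst (F x))) = l2_sq M (\<lambda>x. snd (F x))"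
    by (rule l2_sq_cong_AE[OF m square_integrable_measurable[OF s(3)] 2])
qed

text \<open>\<open>H1_norm\<close> evaluates the gradient chosen for the difference
  \<open>u - \<phi>\<close> itself; linearity and uniqueness replace it by
  \<open>G - grad \<phi>\<close>.\<close>

lemma H1_norm_diff_test_function:
  assumes u: "square_integrable M u" and G: "square_integrable M G" "has_weak_gradient \<Omega> u G"
    and \<phi>: "\<phi> \<in> test_functions \<Omega>"
  shows "H1_norm \<Omega> (\<lambda>x. u x - \<phi> x) = sqrt (l2_sq M (\<lambda>x. jet \<phi> x - (u x, G x)))"
proof -
  note s\<phi> = square_integrable_jet[OF \<phi>]
  have "has_weak_gradient \<Omega> \<phi> (grad \<phi>)"
    using h10_pair_weak_gradient(1)[OF h10_pair_jet[OF \<phi>]] by (simp add: jet_def[abs_def])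
  then have *: "has_weak_gradient \<Omega> (\<lambda>x. u x - \<phi> x) (\<lambda>x. G x - grad \<phi> x)"
    using has_weak_gradient_add_scale[OF G(2), of \<phi> "grad \<phi>" "-1"] by simp
  then have "has_weak_gradient \<Omega> (\<lambda>x. u x - \<phi> x) (weak_gradient \<Omega> (\<lambda>x. u x - \<phi> x))"
    by (rule has_weak_gradient_weak_gradient)
  from weak_gradient_unique[OF this *]
  have AE: "AE x in M. weak_gradient \<Omega> (\<lambda>x. u x - \<phi> x) x = G x - grad \<phi> x" .
  have mG: "(\<lambda>x. G x - grad \<phi> x) \<in> borel_measurable M"
    using square_integrable_diff[OF G(1) square_integrable_grad[OF \<phi>]] by (rule square_integrable_measurable)
  have m: "weak_gradient \<Omega> (\<lambda>x. u x - \<phi> x) \<in> borel_measurable M"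
    by (rule borel_measurable_AE_M[OF mG]) (use AE in \<open>auto elim!: eventually_mono\<close>)
  have "l2_sq M (weak_gradient \<Omega> (\<lambda>x. u x - \<phi> x)) = l2_sq M (\<lambda>x. G x - grad \<phi> x)"
    by (rule l2_sq_cong_AE[OF m mG AE])
  moreover have "l2_sq M (\<lambda>x. jet \<phi> x - (u x, G x)) = l2_sq M (\<lambda>x. u x - \<phi> x) + l2_sq M (\<lambda>x. G x - grad \<phi> x)"
    using l2_sq_pair(3)[OF square_integrable_diff[OF s\<phi> square_integrable_Pair[OF u G(1)]]]
    by (simp add: jet_def l2_sq_commute[of M \<phi>] l2_sq_commute[of M "grad \<phi>"])
  ultimately show ?thesis by (simp add: H1_norm_def l2_sq_def)
qed

lemma h10_pair_imp_H10:
  assumes "h10_pair F"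
  shows "(\<lambda>x. fst (F x)) \<in> H10 \<Omega>"
proof -
  note s = h10_pair_square_integrable[OF assms] and w = h10_pair_weak_gradient[OF assms]
  obtain \<phi> where \<phi>: "\<And>n. \<phi> n \<in> test_functions \<Omega>" "(\<lambda>n. l2_sq M (\<lambda>x. jet (\<phi> n) x - F x)) \<longlonglongrightarrow> 0"
    using assms by (auto simp: h10_pair_def)
  have "\<exists>\<phi>\<in>test_functions \<Omega>. H1_norm \<Omega> (\<lambda>x. fst (F x) - \<phi> x) < e" if "e > 0" for e
  proof -
    have "(\<lambda>n. sqrt (l2_sq M (\<lambda>x. jet (\<phi> n) x - F x))) \<longlonglongrightarrow> 0"
      using tendsto_real_sqrt[OF \<phi>(2)] by simp
    then have "\<forall>\<^sub>F n in sequentially. sqrt (l2_sq M (\<lambda>x. jet (\<phi> n) x - F x)) < e"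
      using order_tendstoD(2) that by blast
    then obtain n where "sqrt (l2_sq M (\<lambda>x. jet (\<phi> n) x - F x)) < e"
      by (auto simp: eventually_sequentially)
    then show ?thesis
      using H1_norm_diff_test_function[OF s(2,3) w(1) \<phi>(1), of n] \<phi>(1)[of n]
      by (intro bexI[of _ "\<phi> n"]) auto
  qed
  then show ?thesis using s w(1) by (auto simp: H10_def H1_def Lp_space_2)
qed

lemma H10_imp_h10_pair:
  assumes "u \<in> H10 \<Omega>"
  shows "h10_pair (\<lambda>x. (u x, weak_gradient \<Omega> u x))"
proof -
  obtain G where G: "square_integrable M u" "square_integrable M G" "has_weak_gradient \<Omega> u G"
    using assms by (auto simp: H10_def H1_def Lp_space_2)
  have "h10_pair (\<lambda>x. (u x, G x))"
  proof (rule h10_pairI[OF square_integrable_Pair[OF G(1,2)]])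
    fix e :: real assume "e > 0"
    then have "sqrt e > 0" by simp
    then obtain \<phi> where \<phi>: "\<phi> \<in> test_functions \<Omega>" "H1_norm \<Omega> (\<lambda>x. u x - \<phi> x) < sqrt e"
      using assms unfolding H10_def by blast
    then show "\<exists>\<phi>\<in>test_functions \<Omega>. l2_sq M (\<lambda>x. jet \<phi> x - (u x, G x)) < e"
      using H1_norm_diff_test_function[OF G \<phi>(1)] by auto
  qed
  then have pair: "h10_pair (\<lambda>x. (u x, G x))" and
    AE: "AE x in M. weak_gradient \<Omega> u x = G x" and s: "square_integrable M (weak_gradient \<Omega> u)"
    using h10_pair_weak_gradient[of "\<lambda>x. (u x, G x)"] by auto
  \<comment> \<open>Changing the gradient on a null set leaves all distances to jets unchanged, so
    the \<open>G\<close> provided by \<open>H1\<close> may be exchanged for the chosen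
    gradient.\<close>
  have "l2_sq M (\<lambda>x. jet \<phi> x - (u x, G x)) = l2_sq M (\<lambda>x. jet \<phi> x - (u x, weak_gradient \<Omega> u x))"
    if "\<phi> \<in> test_functions \<Omega>" for \<phi>
    using AE square_integrable_jet[OF that] square_integrable_Pair[OF G(1,2)] square_integrable_Pair[OF G(1) s]
    by (intro l2_sq_cong_AE square_integrable_measurable square_integrable_diff) (auto elim!: eventually_mono)
  moreover obtain \<phi> where "\<And>n. \<phi> n \<in> test_functions \<Omega>" "(\<lambda>n::nat. l2_sq M (\<lambda>x. jet (\<phi> n) x - (u x, G x))) \<longlonglongrightarrow> 0"
    using pair by (auto simp: h10_pair_def)
  ultimately show ?thesis
    using square_integrable_Pair[OF G(1) s] unfolding h10_pair_def by (intro conjI exI[of _ \<phi>]) auto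
qed

end

section \<open>Potentials and Hoelder duality\<close>

text \<open>For positive \<open>a\<close> and \<open>b\<close>, with \<open>X\<close>,
  \<open>Y\<close>, \<open>T\<close> as below, equality reads
  \<open>ln T = ln X / p + ln Y / q\<close>. The two nonnegative slacks in
  \<open>ln z <= z - 1\<close>, at \<open>z = X / T\<close> and \<open>z = Y / T\<close>, then have
  weighted sum zero, so both vanish and \<open>X = T = Y\<close>.\<close>

lemma Youngs_equality:
  fixes a b :: real
  assumes pq: "p > 1" "q > 1" "1 / p + 1 / q = 1" and ab: "0 \<le> a" "0 \<le> b"
    and eq: "a * b = a powr p / p + b powr q / q"
  shows "a powr p = b powr q"
proof (cases "a = 0 \<or> b = 0")
  case True
  then show ?thesis
  proof
    assume "a = 0"
    then show ?thesis using eq pq by simp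
  next
    assume "b = 0"
    then show ?thesis using eq pq by simp
  qed
next
  case False
  define X Y where "X = a powr p" and "Y = b powr q"
  define T where "T = X / p + Y / q"
  have pos: "X > 0" "Y > 0" "T > 0" "a > 0" "b > 0"
    using False ab pq by (auto simp: X_def Y_def T_def intro!: add_pos_pos)
  have "a * b = T" using eq by (simp add: T_def X_def Y_def)
  then have "ln T = ln a + ln b" using pos by (metis ln_mult_pos)
  also have "\<dots> = ln X / p + ln Y / q" using pos pq by (simp add: X_def Y_def ln_powr)
  finally have lnT: "ln T = ln X / p + ln Y / q" .
  have lX: "ln X - ln T \<le> X / T - 1" and lY: "ln Y - ln T \<le> Y / T - 1"
    using ln_le_minus_one[of "X / T"] ln_le_minus_one[of "Y / T"] pos by (simp_all add: ln_div)
  have "(X / T - 1 - (ln X - ln T)) / p + (Y / T - 1 - (ln Y - ln T)) / q =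
      (X / p + Y / q) / T - (1 / p + 1 / q) - (ln X / p + ln Y / q) + (1 / p + 1 / q) * ln T"
    by (simp add: diff_divide_distrib add_divide_distrib algebra_simps)
  also have "\<dots> = 0" using pq(3) lnT pos(3) by (simp flip: T_def)
  finally have "(X / T - 1 - (ln X - ln T)) / p + (Y / T - 1 - (ln Y - ln T)) / q = 0" .
  moreover have "(X / T - 1 - (ln X - ln T)) / p \<ge> 0" "(Y / T - 1 - (ln Y - ln T)) / q \<ge> 0"
    using lX lY pq by auto
  ultimately have "(X / T - 1 - (ln X - ln T)) / p = 0" "(Y / T - 1 - (ln Y - ln T)) / q = 0"
    by linarith+
  then have "ln (X / T) = X / T - 1" "ln (Y / T) = Y / T - 1"
    using pq pos by (auto simp: ln_div)
  then have "X / T = 1" "Y / T = 1"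
    using ln_eq_minus_one[OF divide_pos_pos[OF pos(1,3)]] ln_eq_minus_one[OF divide_pos_pos[OF pos(2,3)]] by blast+
  then show ?thesis using pos by (simp add: X_def Y_def)
qed

lemma ennreal_powr_measurable: "(\<lambda>v. ennreal_powr v r) \<in> borel_measurable borel"
  unfolding ennreal_powr_def by (intro measurable_If) (auto intro: closed_Collect_eq)

locale schroedinger_problem = bounded_domain +
  fixes p :: real and f :: "'a \<Rightarrow> real"
  assumes p: "1 < p" and f: "square_integrable (lebesgue_on \<Omega>) f"
begin

definition q :: real where "q = 2 * p / (p - 1)"

definition A :: "('a \<Rightarrow> real) \<Rightarrow> real" where "A u = (LINT x|M. \<bar>u x\<bar> powr q)"

text \<open>Since \<open>(p - 1) / p = 2 / q\<close>, this is the squared L^q norm; for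
  \<open>u\<close> in L^q it is the largest potential term over admissible potentials.\<close>

definition N :: "('a \<Rightarrow> real) \<Rightarrow> real" where "N u = A u powr ((p - 1) / p)"

text \<open>For \<open>A u > 0\<close> the \<open>p\<close>-th power of this potential is the
  probability density \<open>\<bar>u\<bar>^q / A u\<close>, so the constraint is active; for
  \<open>A u = 0\<close> the convention \<open>0 powr s = 0\<close> makes it the zero
  potential.\<close>

definition Vr :: "('a \<Rightarrow> real) \<Rightarrow> 'a \<Rightarrow> real" where
  "Vr u x = A u powr (- 1 / p) * \<bar>u x\<bar> powr (2 / (p - 1))"

abbreviation Lq :: "('a \<Rightarrow> real) set" where "Lq \<equiv> Lp_space q \<Omega>"

lemma q_gt_2: "q > 2"
  using p by (simp add: q_def field_simps)

lemma q_eqs: "2 / (p - 1) * p = q" "2 / (p - 1) + 2 = q" "q / p = 2 / (p - 1)" "2 * (p / (p - 1)) = q"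
  using p by (simp_all add: q_def field_simps)

lemma optimal_potential_eq: "optimal_potential p \<Omega> u x = ennreal (Vr u x)"
proof -
  have "- 1 + (p + 1) / (p - 1) = 2 / (p - 1)" using p by (simp add: field_simps)
  then show ?thesis by (simp add: optimal_potential_def Vr_def A_def q_def)
qed

lemma Lq_iff: "u \<in> Lq \<longleftrightarrow> u \<in> borel_measurable M \<and> integrable M (\<lambda>x. \<bar>u x\<bar> powr q)"
  by (simp add: Lp_space_def)

lemma A_nonneg: "A u \<ge> 0"
  by (simp add: A_def)

lemma N_nonneg: "N u \<ge> 0"
  by (simp add: N_def)

lemma Vr_nonneg: "Vr u x \<ge> 0"
  by (simp add: Vr_def)

lemma A_zero_iff: "u \<in> Lq \<Longrightarrow> A u = 0 \<longleftrightarrow> (AE x in M. u x = 0)"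
  unfolding A_def by (subst integral_nonneg_eq_0_iff_AE) (auto simp: Lq_iff)

lemma Vr_measurable:
  assumes [measurable]: "u \<in> borel_measurable M"
  shows "Vr u \<in> borel_measurable M"
  unfolding Vr_def[abs_def] by measurable

lemma admissible_Vr:
  assumes "u \<in> Lq"
  shows "admissible_potential p \<Omega> (\<lambda>x. ennreal (Vr u x))"
  unfolding admissible_potential_def
proof
  note [measurable] = Vr_measurable[of u]
  have [measurable]: "u \<in> borel_measurable M" using assms by (simp add: Lq_iff)
  show "(\<lambda>x. ennreal (Vr u x)) \<in> borel_measurable M" by measurable
  have eq: "ennreal_powr (ennreal (Vr u x)) p = ennreal ((A u powr (- 1 / p)) powr p * \<bar>u x\<bar> powr q)" for x
    unfolding ennreal_powr_def using p by (simp add: Vr_nonneg) (simp add: Vr_def powr_mult powr_powr q_def)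
  have "(\<integral>\<^sup>+x. ennreal_powr (ennreal (Vr u x)) p \<partial>M) = ennreal ((A u powr (- 1 / p)) powr p * A u)"
    unfolding eq A_def using assms by (subst nn_integral_eq_integral) (auto simp: Lq_iff)
  also have "\<dots> \<le> 1"
  proof (cases "A u = 0")
    case False
    then have "A u > 0" using A_nonneg[of u] by simp
    have "(A u powr (- 1 / p)) powr p = A u powr (- 1)" using p by (simp only: powr_powr) simp
    then show ?thesis using \<open>A u > 0\<close> by (simp add: powr_minus_divide)
  qed simp
  finally show "(\<integral>\<^sup>+x. ennreal_powr (ennreal (Vr u x)) p \<partial>M) \<le> 1" .
qed

lemma Vr_times_square: "Vr u x * (u x)\<^sup>2 = A u powr (- 1 / p) * \<bar>u x\<bar> powr q"
proof (cases "u x = 0")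
  case False
  then have "\<bar>u x\<bar> powr q = \<bar>u x\<bar> powr (2 / (p - 1)) * \<bar>u x\<bar> powr 2"
    by (simp only: powr_add[symmetric] q_eqs)
  then show ?thesis using False by (simp add: Vr_def)
qed (simp add: Vr_def)

lemma Vr_square_integral:
  assumes "u \<in> Lq"
  shows "integrable M (\<lambda>x. Vr u x * (u x)\<^sup>2)" "(LINT x|M. Vr u x * (u x)\<^sup>2) = N u"
proof -
  show "integrable M (\<lambda>x. Vr u x * (u x)\<^sup>2)"
    unfolding Vr_times_square using assms by (simp add: Lq_iff)
  have "(LINT x|M. Vr u x * (u x)\<^sup>2) = A u powr (- 1 / p) * A u"
    unfolding Vr_times_square by (simp add: A_def)
  also have "\<dots> = N u"
  proof (cases "A u = 0")
    case False
    then have "A u > 0" using A_nonneg[of u] by simp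
    then have "A u powr (- 1 / p) * A u = A u powr (- 1 / p + 1)" by (subst powr_add) simp
    also have "- 1 / p + 1 = (p - 1) / p" using p by (simp add: field_simps)
    finally show ?thesis by (simp add: N_def)
  qed (simp add: N_def)
  finally show "(LINT x|M. Vr u x * (u x)\<^sup>2) = N u" .
qed

text \<open>Young's inequality for \<open>v\<close> and \<open>(u x)\<^sup>2 / N u\<close> with
  exponents \<open>p\<close> and \<open>p / (p - 1)\<close>, multiplied by \<open>N u\<close>. With
  this scaling the right-hand side integrates to at most \<open>N u\<close> as soon as
  \<open>v^p\<close> has integral at most 1.\<close>

lemma young_pointwise:
  assumes "A u > 0" "v \<ge> 0"
  shows "v * (u x)\<^sup>2 \<le> N u / p * v powr p + (p - 1) / p * N u / A u * \<bar>u x\<bar> powr q"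
    and "v * (u x)\<^sup>2 = N u / p * v powr p + (p - 1) / p * N u / A u * \<bar>u x\<bar> powr q \<Longrightarrow> v = Vr u x"
proof -
  define r where "r = p / (p - 1)"
  have r: "r > 1" "1 / p + 1 / r = 1" using p by (simp_all add: r_def field_simps)
  have N: "N u > 0" using assms by (simp add: N_def)
  have "N u powr r = A u" using assms(1) p by (simp add: N_def r_def powr_powr)
  then have b: "((u x)\<^sup>2 / N u) powr r = \<bar>u x\<bar> powr q / A u"
  proof (cases "u x = 0")
    case False
    then have "(u x)\<^sup>2 = \<bar>u x\<bar> powr 2" by simp
    then have "(u x)\<^sup>2 powr r = \<bar>u x\<bar> powr q" by (simp only: powr_powr r_def q_eqs)
    then show ?thesis using N \<open>N u powr r = A u\<close> by (simp add: powr_divide)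
  qed simp
  have rhs: "N u / p * v powr p + (p - 1) / p * N u / A u * \<bar>u x\<bar> powr q =
      N u * (v powr p / p + ((u x)\<^sup>2 / N u) powr r / r)"
    using p unfolding b by (simp add: r_def field_simps)
  have lhs: "v * (u x)\<^sup>2 = N u * (v * ((u x)\<^sup>2 / N u))" using N by simp
  have b0: "0 \<le> (u x)\<^sup>2 / N u" using N by simp
  show "v * (u x)\<^sup>2 \<le> N u / p * v powr p + (p - 1) / p * N u / A u * \<bar>u x\<bar> powr q"
    unfolding rhs lhs using N Youngs_inequality[OF p r assms(2) b0] by (intro mult_left_mono) auto
  assume "v * (u x)\<^sup>2 = N u / p * v powr p + (p - 1) / p * N u / A u * \<bar>u x\<bar> powr q"
  then have "v * ((u x)\<^sup>2 / N u) = v powr p / p + ((u x)\<^sup>2 / N u) powr r / r"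
    unfolding rhs lhs using N by simp
  from Youngs_equality[OF p r assms(2) b0 this] have "v powr p = \<bar>u x\<bar> powr q / A u" by (simp add: b)
  then have "(v powr p) powr (1 / p) = (\<bar>u x\<bar> powr q / A u) powr (1 / p)" by simp
  then show "v = Vr u x"
    using p assms by (simp add: powr_powr powr_divide Vr_def q_eqs powr_minus_divide)
qed

text \<open>Integrating the pointwise Young bound also covers points where the potential is
  infinite, since the term with \<open>ennreal_powr\<close> is infinite there as well.\<close>

lemma hoelder_ennreal:
  assumes V: "admissible_potential p \<Omega> V" and u: "u \<in> Lq"
  shows "(\<integral>\<^sup>+x. V x * ennreal ((u x)\<^sup>2) \<partial>M) \<le> ennreal (N u)"
proof (cases "A u = 0")
  case True
  then have "AE x in M. u x = 0" using A_zero_iff[OF u] by simp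
  \<comment> \<open>Infinity times 0 is 0, so the integrand vanishes almost everywhere even where
    \<open>V\<close> is infinite.\<close>
  then have "(\<integral>\<^sup>+x. V x * ennreal ((u x)\<^sup>2) \<partial>M) = (\<integral>\<^sup>+x. 0 \<partial>M)"
    by (intro nn_integral_cong_AE) (auto elim!: eventually_mono)
  then show ?thesis by simp
next
  case False
  then have A: "A u > 0" using A_nonneg[of u] by simp
  then have N: "N u > 0" by (simp add: N_def)
  have [measurable]: "V \<in> borel_measurable M" "u \<in> borel_measurable M"
    using V u by (auto simp: admissible_potential_def Lq_iff)
  note [measurable] = measurable_compose[OF _ ennreal_powr_measurable, of V M p]
  define k where "k = (p - 1) / p * N u / A u"
  have c: "k \<ge> 0" using p A N by (simp add: k_def)
  have pw: "V x * ennreal ((u x)\<^sup>2) \<le> ennreal (N u / p) * ennreal_powr (V x) p + ennreal (k * \<bar>u x\<bar> powr q)" for x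
  proof (cases "V x = \<infinity>")
    case True
    then show ?thesis using N p by (simp add: ennreal_powr_def ennreal_mult_top)
  next
    case False
    then obtain v where v: "V x = ennreal v" "v \<ge> 0" by (cases "V x") auto
    then have "V x * ennreal ((u x)\<^sup>2) = ennreal (v * (u x)\<^sup>2)" by (simp add: ennreal_mult)
    also have "\<dots> \<le> ennreal (N u / p * v powr p + k * \<bar>u x\<bar> powr q)"
      unfolding k_def by (rule ennreal_leI[OF young_pointwise(1)[OF A v(2)]])
    also have "\<dots> = ennreal (N u / p) * ennreal_powr (V x) p + ennreal (k * \<bar>u x\<bar> powr q)"
    proof -
      have "0 \<le> k * \<bar>u x\<bar> powr q" "0 \<le> N u / p"
        using mult_nonneg_nonneg[OF c powr_ge_zero] N p by simp_all
      then show ?thesis using v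
        by (simp only: ennreal_plus[OF mult_nonneg_nonneg[OF _ powr_ge_zero]] ennreal_mult[OF _ powr_ge_zero])
           (simp add: ennreal_powr_def)
    qed
    finally show ?thesis .
  qed
  have "(\<integral>\<^sup>+x. V x * ennreal ((u x)\<^sup>2) \<partial>M) \<le>
      (\<integral>\<^sup>+x. ennreal (N u / p) * ennreal_powr (V x) p + ennreal (k * \<bar>u x\<bar> powr q) \<partial>M)"
    by (intro nn_integral_mono pw)
  also have "\<dots> = ennreal (N u / p) * (\<integral>\<^sup>+x. ennreal_powr (V x) p \<partial>M) + (\<integral>\<^sup>+x. ennreal (k * \<bar>u x\<bar> powr q) \<partial>M)"
    by (subst nn_integral_add) (auto simp: nn_integral_cmult)
  also have "(\<integral>\<^sup>+x. ennreal (k * \<bar>u x\<bar> powr q) \<partial>M) = ennreal (k * A u)"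
    unfolding A_def using u c by (subst nn_integral_eq_integral) (auto simp: Lq_iff A_def)
  also have "ennreal (N u / p) * (\<integral>\<^sup>+x. ennreal_powr (V x) p \<partial>M) \<le> ennreal (N u / p) * 1"
    using V by (intro mult_left_mono) (auto simp: admissible_potential_def)
  also have "ennreal (N u / p) * 1 + ennreal (k * A u) = ennreal (N u / p + k * A u)"
    using N p A c by simp
  also have "N u / p + k * A u = N u" using A p by (simp add: k_def field_simps)
  finally show ?thesis by (simp add: add_right_mono)
qed

text \<open>The deficit \<open>h\<close> in Young's inequality is nonnegative, while the assumption
  makes its integral nonpositive. Hence \<open>h = 0\<close> almost everywhere, and Young's equality
  case identifies \<open>V\<close> pointwise.\<close>

lemma hoelder_equality:
  assumes V: "admissible_potential p \<Omega> V" and u: "u \<in> Lq" and A: "A u > 0"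
    and eq: "ennreal (N u) \<le> (\<integral>\<^sup>+x. V x * ennreal ((u x)\<^sup>2) \<partial>M)"
  shows "AE x in M. V x = ennreal (Vr u x)"
proof -
  have N: "N u > 0" using A by (simp add: N_def)
  have [measurable]: "V \<in> borel_measurable M" "u \<in> borel_measurable M"
    using V u by (auto simp: admissible_potential_def Lq_iff)
  note [measurable] = measurable_compose[OF _ ennreal_powr_measurable, of V M p]
  define v where "v x = enn2real (V x)" for x
  have [measurable]: "v \<in> borel_measurable M" unfolding v_def by measurable
  have v0: "v x \<ge> 0" for x by (simp add: v_def)
  have Vp: "(\<integral>\<^sup>+x. ennreal_powr (V x) p \<partial>M) \<le> 1" using V by (simp add: admissible_potential_def)
  \<comment> \<open>The integral constraint makes \<open>V\<close> finite almost everywhere, so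
    passing to the real-valued \<open>v\<close> loses nothing.\<close>
  then have "AE x in M. ennreal_powr (V x) p \<noteq> \<infinity>"
    by (intro nn_integral_PInf_AE) (auto simp: top_unique)
  then have fin: "AE x in M. V x = ennreal (v x)"
    by eventually_elim (auto simp: ennreal_powr_def v_def less_top split: if_splits)
  have "(\<integral>\<^sup>+x. ennreal (v x powr p) \<partial>M) = (\<integral>\<^sup>+x. ennreal_powr (V x) p \<partial>M)"
    using fin by (intro nn_integral_cong_AE) (auto elim!: eventually_mono simp: ennreal_powr_def v0)
  then have vp: "(\<integral>\<^sup>+x. ennreal (v x powr p) \<partial>M) \<le> 1" using Vp by simp
  have vpi: "integrable M (\<lambda>x. v x powr p)"
    using vp by (intro integrableI_nonneg) (auto intro: le_less_trans)
  have vp1: "(LINT x|M. v x powr p) \<le> 1"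
    using vp nn_integral_eq_integral[OF vpi] by simp
  have vu: "(\<integral>\<^sup>+x. ennreal (v x * (u x)\<^sup>2) \<partial>M) = (\<integral>\<^sup>+x. V x * ennreal ((u x)\<^sup>2) \<partial>M)"
    using fin by (intro nn_integral_cong_AE) (auto elim!: eventually_mono simp: v0 ennreal_mult)
  have vui: "integrable M (\<lambda>x. v x * (u x)\<^sup>2)"
    using vu hoelder_ennreal[OF V u] by (intro integrableI_nonneg) (auto simp: v0 intro: le_less_trans)
  have vu1: "(LINT x|M. v x * (u x)\<^sup>2) \<ge> N u"
  proof -
    have "ennreal (N u) \<le> ennreal (LINT x|M. v x * (u x)\<^sup>2)"
      using vu eq nn_integral_eq_integral[OF vui] by (simp add: v0)
    moreover have "0 \<le> (LINT x|M. v x * (u x)\<^sup>2)" by (simp add: v0)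
    ultimately show ?thesis by (simp only: ennreal_le_iff)
  qed
  let ?c = "(p - 1) / p * N u / A u"
  define h where "h x = N u / p * v x powr p + ?c * \<bar>u x\<bar> powr q - v x * (u x)\<^sup>2" for x
  have h0: "h x \<ge> 0" for x using young_pointwise(1)[OF A v0] by (simp add: h_def)
  have hi: "integrable M h" unfolding h_def using vpi vui u by (auto simp: Lq_iff)
  have "(LINT x|M. h x) = N u / p * (LINT x|M. v x powr p) + ?c * A u - (LINT x|M. v x * (u x)\<^sup>2)"
    unfolding h_def A_def using vpi vui u by (simp add: Lq_iff)
  also have "\<dots> \<le> N u / p * 1 + ?c * A u - N u"
    using vp1 vu1 N p by (intro diff_mono add_right_mono mult_left_mono) auto
  also have "\<dots> = 0" using A p by (simp add: field_simps)
  finally have "(LINT x|M. h x) \<le> 0" .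
  moreover have "(LINT x|M. h x) \<ge> 0" using h0 by simp
  ultimately have "(LINT x|M. h x) = 0" by linarith
  then have "AE x in M. h x = 0"
    using integral_nonneg_eq_0_iff_AE[OF hi] h0 by simp
  then show ?thesis using fin
  proof eventually_elim
    case (elim x)
    then have "v x = Vr u x" using young_pointwise(2)[OF A v0[of x], of x] by (simp add: h_def)
    then show ?case using elim by simp
  qed
qed

text \<open>The optimal potential of one function is tested on another one; this is what makes
  \<open>N\<close> a supremum of quadratic forms.\<close>

lemma hoelder_Vr:
  assumes w: "w \<in> Lq" and u: "u \<in> Lq"
  shows "integrable M (\<lambda>x. Vr w x * (u x)\<^sup>2)" "(LINT x|M. Vr w x * (u x)\<^sup>2) \<le> N u"
proof -
  have [measurable]: "w \<in> borel_measurable M" "u \<in> borel_measurable M"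
    using w u by (auto simp: Lq_iff)
  note [measurable] = Vr_measurable[of w]
  have le: "(\<integral>\<^sup>+x. ennreal (Vr w x * (u x)\<^sup>2) \<partial>M) \<le> ennreal (N u)"
    using hoelder_ennreal[OF admissible_Vr[OF w] u] by (simp add: ennreal_mult Vr_nonneg)
  show i: "integrable M (\<lambda>x. Vr w x * (u x)\<^sup>2)"
    using le by (intro integrableI_nonneg) (auto simp: Vr_nonneg intro: le_less_trans)
  show "(LINT x|M. Vr w x * (u x)\<^sup>2) \<le> N u"
    using le nn_integral_eq_integral[OF i] by (simp add: Vr_nonneg N_nonneg)
qed

lemma powr_q_add_le:
  assumes "0 \<le> a" "0 \<le> b"
  shows "(a + b) powr q \<le> 2 powr q * (a powr q + b powr q)"
proof -
  have "(a + b) powr q \<le> (2 * max a b) powr q"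
    using assms q_gt_2 by (intro powr_mono2) auto
  also have "\<dots> = 2 powr q * max a b powr q" using assms by (simp add: powr_mult)
  also have "max a b powr q \<le> a powr q + b powr q" by (simp add: max_def)
  finally show ?thesis by simp
qed

lemma Lq_abs_add:
  assumes "u \<in> Lq" "v \<in> Lq"
  shows "integrable M (\<lambda>x. (\<bar>u x\<bar> + \<bar>v x\<bar>) powr q)"
proof (rule Bochner_Integration.integrable_bound)
  show "integrable M (\<lambda>x. 2 powr q * (\<bar>u x\<bar> powr q + \<bar>v x\<bar> powr q))"
    using assms by (simp add: Lq_iff)
  have [measurable]: "u \<in> borel_measurable M" "v \<in> borel_measurable M" using assms by (auto simp: Lq_iff)
  show "(\<lambda>x. (\<bar>u x\<bar> + \<bar>v x\<bar>) powr q) \<in> borel_measurable M" by measurable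
  show "AE x in M. norm ((\<bar>u x\<bar> + \<bar>v x\<bar>) powr q) \<le> norm (2 powr q * (\<bar>u x\<bar> powr q + \<bar>v x\<bar> powr q))"
    using powr_q_add_le[of "\<bar>u _\<bar>" "\<bar>v _\<bar>"] by (simp add: abs_mult)
qed

lemma Lq_add:
  assumes "u \<in> Lq" "v \<in> Lq"
  shows "(\<lambda>x. u x + v x) \<in> Lq"
  unfolding Lq_iff
proof
  show m: "(\<lambda>x. u x + v x) \<in> borel_measurable M" using assms by (auto simp: Lq_iff)
  show "integrable M (\<lambda>x. \<bar>u x + v x\<bar> powr q)"
    by (rule Bochner_Integration.integrable_bound[OF Lq_abs_add[OF assms]])
       (use m q_gt_2 in \<open>auto intro!: AE_I2 powr_mono2\<close>)
qed

lemma Lq_scale: "u \<in> Lq \<Longrightarrow> (\<lambda>x. c * u x) \<in> Lq"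
  by (auto simp: Lq_iff abs_mult powr_mult)

text \<open>No Minkowski inequality: test the midpoint against its own optimal potential.\<close>

lemma N_midpoint:
  assumes "u \<in> Lq" "v \<in> Lq"
  shows "N (\<lambda>x. (u x + v x) / 2) \<le> (N u + N v) / 2"
proof -
  define w where "w x = (u x + v x) / 2" for x
  have w: "w \<in> Lq"
    using Lq_scale[OF Lq_add[OF assms], of "1/2"] by (simp add: w_def[abs_def])
  have "N w = (LINT x|M. Vr w x * (w x)\<^sup>2)" using Vr_square_integral[OF w] by simp
  also have "\<dots> \<le> (LINT x|M. (Vr w x * (u x)\<^sup>2 + Vr w x * (v x)\<^sup>2) / 2)"
  proof (rule integral_mono)
    fix x
    have "(w x)\<^sup>2 \<le> ((u x)\<^sup>2 + (v x)\<^sup>2) / 2"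
      using zero_le_power2[of "u x - v x"] by (simp add: w_def power2_eq_square field_simps)
    from mult_left_mono[OF this Vr_nonneg[of w x]]
    show "Vr w x * (w x)\<^sup>2 \<le> (Vr w x * (u x)\<^sup>2 + Vr w x * (v x)\<^sup>2) / 2"
      by (simp add: algebra_simps)
  qed (use Vr_square_integral[OF w] hoelder_Vr[OF w assms(1)] hoelder_Vr[OF w assms(2)] in auto)
  also have "\<dots> = ((LINT x|M. Vr w x * (u x)\<^sup>2) + (LINT x|M. Vr w x * (v x)\<^sup>2)) / 2"
    using hoelder_Vr[OF w assms(1)] hoelder_Vr[OF w assms(2)] by simp
  also have "\<dots> \<le> (N u + N v) / 2"
    using hoelder_Vr[OF w assms(1)] hoelder_Vr[OF w assms(2)] by simp
  finally show ?thesis by (simp add: w_def[abs_def])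
qed

lemma bounded_in_Lq:
  assumes "u \<in> borel_measurable M" "\<And>x. \<bar>u x\<bar> \<le> B"
  shows "u \<in> Lq"
  unfolding Lq_iff
proof
  show "integrable M (\<lambda>x. \<bar>u x\<bar> powr q)"
    using assms q_gt_2
    by (intro finite_measure.integrable_const_bound[OF finite_measure_M, of _ "B powr q"])
       (auto intro!: AE_I2 powr_mono2)
qed fact

lemma test_function_in_Lq: "\<phi> \<in> test_functions \<Omega> \<Longrightarrow> \<phi> \<in> Lq"
  using test_function_bounded test_function_measurable bounded_in_Lq by metis

subsection \<open>The direct method\<close>

abbreviation val :: "('a \<Rightarrow> real \<times> 'a) \<Rightarrow> 'a \<Rightarrow> real" where "val F \<equiv> \<lambda>x. fst (F x)"
abbreviation der :: "('a \<Rightarrow> real \<times> 'a) \<Rightarrow> 'a \<Rightarrow> 'a" where "der F \<equiv> \<lambda>x. snd (F x)"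

definition Lin :: "('a \<Rightarrow> real) \<Rightarrow> real" where "Lin u = (LINT x|M. u x * f x)"

text \<open>The gradient is carried as data of the pair, so the minimization never meets the choice
  in \<open>weak_gradient\<close>.\<close>

definition Jr :: "('a \<Rightarrow> real \<times> 'a) \<Rightarrow> real" where
  "Jr F = (l2_sq M (der F) + N (val F)) / 2 - Lin (val F)"

definition Sr :: "('a \<Rightarrow> real) \<Rightarrow> ('a \<Rightarrow> real \<times> 'a) \<Rightarrow> real" where
  "Sr V F = (l2_sq M (der F) + (LINT x|M. V x * (val F x)\<^sup>2)) / 2 - Lin (val F)"

text \<open>The pairs on which \<open>J_functional\<close> is finite.\<close>

definition h10q :: "('a \<Rightarrow> real \<times> 'a) \<Rightarrow> bool" where
  "h10q F \<longleftrightarrow> h10_pair F \<and> val F \<in> Lq"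

lemma h10q_D:
  assumes "h10q F"
  shows "h10_pair F" "val F \<in> Lq" "square_integrable M F"
    "square_integrable M (val F)" "square_integrable M (der F)"
  using assms h10_pair_square_integrable[of F] by (auto simp: h10q_def)

lemma h10q_zero: "h10q (\<lambda>x. 0)"
  using h10_pair_zero by (simp add: h10q_def Lq_iff)

lemma h10q_jet: "\<phi> \<in> test_functions \<Omega> \<Longrightarrow> h10q (jet \<phi>)"
  using h10_pair_jet test_function_in_Lq by (simp add: h10q_def jet_def)

lemma h10q_add_scaleR:
  assumes "h10q F" "h10q G"
  shows "h10q (\<lambda>x. F x + c *\<^sub>R G x)"
  using h10_pair_add_scaleR[of F G c] Lq_add[OF _ Lq_scale[of "val G" c], of "val F"] assms
  by (auto simp: h10q_def)

lemma Lin_integrable: "square_integrable M u \<Longrightarrow> integrable M (\<lambda>x. u x * f x)"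
  using square_integrable_inner[OF _ f] by simp

lemma Lin_add_scale:
  assumes "square_integrable M u" "square_integrable M v"
  shows "Lin (\<lambda>x. u x + c * v x) = Lin u + c * Lin v"
  using Lin_integrable[OF assms(1)] Lin_integrable[OF assms(2)]
  by (simp add: Lin_def distrib_right mult.assoc)

lemma Vr_mult_integrable:
  assumes w: "w \<in> Lq" and u: "u \<in> Lq" and v: "v \<in> Lq"
  shows "integrable M (\<lambda>x. Vr w x * (u x * v x))"
proof (rule Bochner_Integration.integrable_bound)
  show "integrable M (\<lambda>x. Vr w x * (u x)\<^sup>2 + Vr w x * (v x)\<^sup>2)"
    using hoelder_Vr(1)[OF w u] hoelder_Vr(1)[OF w v] by simp
  have "w \<in> borel_measurable M" and [measurable]: "u \<in> borel_measurable M" "v \<in> borel_measurable M"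
    using assms by (auto simp: Lq_iff)
  then have [measurable]: "Vr w \<in> borel_measurable M" by (intro Vr_measurable)
  show "(\<lambda>x. Vr w x * (u x * v x)) \<in> borel_measurable M" by measurable
  have "\<bar>a * b\<bar> \<le> a\<^sup>2 + b\<^sup>2" for a b :: real
  proof -
    have "2 * \<bar>a\<bar> * \<bar>b\<bar> \<le> a\<^sup>2 + b\<^sup>2"
      using sum_squares_bound[of "\<bar>a\<bar>" "\<bar>b\<bar>"] by simp
    then show ?thesis using abs_ge_zero[of "a * b"] by (simp only: abs_mult)
  qed
  then show "AE x in M. norm (Vr w x * (u x * v x)) \<le> norm (Vr w x * (u x)\<^sup>2 + Vr w x * (v x)\<^sup>2)"
    using Vr_nonneg[of w]
    by (intro AE_I2) (simp add: abs_mult abs_of_nonneg mult_left_mono flip: distrib_left)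
qed

text \<open>With a frozen potential the functional is an exact quadratic polynomial along a line,
  with no remainder to estimate.\<close>

lemma Sr_expansion:
  assumes w: "w \<in> Lq" and F: "h10q F" and H: "h10q H"
  shows "Sr (Vr w) (\<lambda>x. F x + t *\<^sub>R H x) = Sr (Vr w) F
    + t * ((LINT x|M. der F x \<bullet> der H x) + (LINT x|M. Vr w x * (val F x * val H x)) - Lin (val H))
    + t\<^sup>2 / 2 * (l2_sq M (der H) + (LINT x|M. Vr w x * (val H x)\<^sup>2))"
proof -
  note F' = h10q_D[OF F] and H' = h10q_D[OF H]
  have "(LINT x|M. Vr w x * (val F x + t * val H x)\<^sup>2) =
      (LINT x|M. Vr w x * (val F x)\<^sup>2 + 2 * t * (Vr w x * (val F x * val H x)) + t\<^sup>2 * (Vr w x * (val H x)\<^sup>2))"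
    by (intro Bochner_Integration.integral_cong) (auto simp: power2_eq_square algebra_simps)
  also have "\<dots> = (LINT x|M. Vr w x * (val F x)\<^sup>2) + 2 * t * (LINT x|M. Vr w x * (val F x * val H x))
      + t\<^sup>2 * (LINT x|M. Vr w x * (val H x)\<^sup>2)"
    using hoelder_Vr(1)[OF w F'(2)] hoelder_Vr(1)[OF w H'(2)] Vr_mult_integrable[OF w F'(2) H'(2)]
    by simp
  finally show ?thesis
    using l2_sq_add_scaleR[OF F'(5) H'(5), of t] Lin_add_scale[OF F'(4) H'(4), of t]
    by (simp add: Sr_def field_simps)
qed

lemma Sr_le_Jr:
  assumes "w \<in> Lq" "h10q F"
  shows "Sr (Vr w) F \<le> Jr F"
  using hoelder_Vr(2)[OF assms(1) h10q_D(2)[OF assms(2)]] by (simp add: Sr_def Jr_def)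

lemma Sr_eq_Jr: "h10q F \<Longrightarrow> Sr (Vr (val F)) F = Jr F"
  using Vr_square_integral(2)[OF h10q_D(2)] by (simp add: Sr_def Jr_def)

text \<open>The parallelogram identity gains a quarter of the squared distance of the gradients, and
  the factor 1/2 of the Dirichlet term turns it into an eighth; \<open>N\<close> satisfies midpoint
  convexity and \<open>Lin\<close> is linear.\<close>

lemma Jr_midpoint:
  assumes F: "h10q F" and G: "h10q G"
  shows "h10q (\<lambda>x. (1/2) *\<^sub>R F x + (1/2) *\<^sub>R G x)"
    "Jr (\<lambda>x. (1/2) *\<^sub>R F x + (1/2) *\<^sub>R G x) \<le> (Jr F + Jr G) / 2 - l2_sq M (\<lambda>x. der F x - der G x) / 8"
proof -
  let ?H = "\<lambda>x. (1/2) *\<^sub>R F x + (1/2) *\<^sub>R G x"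
  note F' = h10q_D[OF F] and G' = h10q_D[OF G]
  have F2: "h10q (\<lambda>x. (1/2) *\<^sub>R F x)" using h10q_add_scaleR[OF h10q_zero F, of "1/2"] by simp
  show "h10q ?H" by (rule h10q_add_scaleR[OF F2 G])
  have "N (val ?H) \<le> (N (val F) + N (val G)) / 2"
    using N_midpoint[OF F'(2) G'(2)] by (simp add: add_divide_distrib)
  moreover have "Lin (val ?H) = (Lin (val F) + Lin (val G)) / 2"
  proof -
    have "square_integrable M (\<lambda>x. (1/2) * val F x)"
      using square_integrable_scaleR[OF F'(4), of "1/2"] by simp
    from Lin_add_scale[OF this G'(4), of "1/2"] show ?thesis
      by (simp add: Lin_def)
  qed
  moreover have "l2_sq M (der ?H) = (l2_sq M (der F) + l2_sq M (der G)) / 2 - l2_sq M (\<lambda>x. der F x - der G x) / 4"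
  proof -
    have "l2_sq M (\<lambda>x. (1/2) *\<^sub>R der F x) = l2_sq M (der F) / 4"
      by (simp add: l2_sq_def power_mult_distrib power_divide)
    then show ?thesis
      using l2_sq_add_scaleR[OF square_integrable_scaleR[OF F'(5), of "1/2"] G'(5), of "1/2"]
        l2_sq_diff[OF F'(5) G'(5)]
      by (simp add: power_divide field_simps)
  qed
  ultimately show "Jr ?H \<le> (Jr F + Jr G) / 2 - l2_sq M (\<lambda>x. der F x - der G x) / 8"
    by (simp add: Jr_def field_simps)
qed

text \<open>Cauchy-Schwarz and Poincare's inequality bound the square of the linear term by
  \<open>D * K\<close>. Hence the linear term is at most \<open>(D + K) / 2\<close>, and the
  Dirichlet term absorbs \<open>D / 2\<close>.\<close>

lemma Jr_bounded_below: "\<exists>B. \<forall>F. h10q F \<longrightarrow> B \<le> Jr F"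
proof -
  obtain C where C: "C > 0" "\<And>F. h10_pair F \<Longrightarrow> l2_sq M (val F) \<le> C * l2_sq M (der F)"
    using poincare_h10_pair by blast
  have "- (C * l2_sq M f / 2) \<le> Jr F" if F: "h10q F" for F
  proof -
    note F' = h10q_D[OF F]
    define D where "D = l2_sq M (der F)"
    define K where "K = C * l2_sq M f"
    have D: "D \<ge> 0" "K \<ge> 0"
      unfolding D_def K_def by (intro l2_sq_nonneg mult_nonneg_nonneg less_imp_le[OF C(1)])+
    have "(Lin (val F))\<^sup>2 \<le> l2_sq M (val F) * l2_sq M f"
      using l2_Cauchy_Schwarz[OF F'(4) f] by (simp add: Lin_def)
    also have "\<dots> \<le> (C * D) * l2_sq M f"
      unfolding D_def by (rule mult_right_mono[OF C(2)[OF F'(1)] l2_sq_nonneg])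
    also have "\<dots> = D * K" by (simp add: K_def)
    also have "\<dots> \<le> ((D + K) / 2)\<^sup>2"
    proof -
      have "((D + K) / 2)\<^sup>2 - D * K = ((D - K) / 2)\<^sup>2"
        by (simp add: power2_eq_square field_simps)
      then show ?thesis using zero_le_power2[of "(D - K) / 2"] by linarith
    qed
    finally have "Lin (val F) \<le> (D + K) / 2"
      by (rule power2_le_imp_le) (use D in simp)
    then show ?thesis 
      using N_nonneg[of "val F"] unfolding Jr_def D_def K_def by argo
  qed
  then show ?thesis by blast
qed

lemma A_eq_N_powr: "A u = N u powr (p / (p - 1))"
  using p A_nonneg[of u] by (simp add: N_def powr_powr)

text \<open>\<open>N\<close> is an increasing power of \<open>A\<close>, and Fatou's lemma applies
  to \<open>A\<close>. It also shows that the limit lies in \<open>Lq\<close>, which L^2 convergence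
  alone would not give.\<close>

lemma N_lower_semicontinuous:
  assumes u: "\<And>n. u n \<in> Lq" and v: "v \<in> borel_measurable M"
    and AE: "AE x in M. (\<lambda>n. u n x) \<longlonglongrightarrow> v x" and N: "(\<lambda>n. N (u n)) \<longlonglongrightarrow> L"
  shows "v \<in> Lq" "N v \<le> L"
proof -
  let ?r = "p / (p - 1)"
  have r: "?r > 0" using p by simp
  have L: "L \<ge> 0" using LIMSEQ_le_const[OF N] N_nonneg by blast
  have "(\<lambda>n. N (u n) powr ?r) \<longlonglongrightarrow> L powr ?r"
    using N_nonneg r by (intro tendsto_powr'[OF N tendsto_const]) auto
  then have A: "(\<lambda>n. A (u n)) \<longlonglongrightarrow> L powr ?r" by (simp flip: A_eq_N_powr)
  have fatou: "integrable M (\<lambda>x. \<bar>v x\<bar> powr q) \<and> A v \<le> e" if e: "e > L powr ?r" for e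
    unfolding A_def
  proof (rule integral_fatou_bound[where u = "\<lambda>n x. \<bar>u n x\<bar> powr q"])
    show "AE x in M. (\<lambda>n. \<bar>u n x\<bar> powr q) \<longlonglongrightarrow> \<bar>v x\<bar> powr q"
      using AE by eventually_elim
        (use q_gt_2 in \<open>auto intro!: tendsto_powr' tendsto_rabs\<close>)
    show "\<forall>\<^sub>F n in sequentially. (LINT x|M. \<bar>u n x\<bar> powr q) \<le> e"
      using order_tendstoD(2)[OF A e] by eventually_elim (simp add: A_def)
    show "(\<lambda>x. \<bar>v x\<bar> powr q) \<in> borel_measurable M" using v by measurable
  qed (use u in \<open>auto simp: Lq_iff\<close>)
  show "v \<in> Lq" using fatou[of "L powr ?r + 1"] v by (simp add: Lq_iff)
  have "A v \<le> L powr ?r"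
  proof (rule dense_ge)
    fix e assume "L powr ?r < e"
    then show "A v \<le> e" using fatou[of e] by simp
  qed
  then have "N v \<le> (L powr ?r) powr ((p - 1) / p)"
    unfolding N_def using p A_nonneg by (intro powr_mono2) auto
  then show "N v \<le> L" using p L by (simp add: powr_powr)
qed

lemma Jr_minimizer_exists: "\<exists>F. h10q F \<and> (\<forall>G. h10q G \<longrightarrow> Jr F \<le> Jr G)"
proof -
  define m where "m = Inf (Jr ` Collect h10q)"
  have bdd: "bdd_below (Jr ` Collect h10q)" 
  proof -
    obtain B where "\<And>F. h10q F \<Longrightarrow> B \<le> Jr F" using Jr_bounded_below by blast
    then show ?thesis by (intro bdd_belowI2[of _ B]) simp
  qed
  have ne: "Jr ` Collect h10q \<noteq> {}" using h10q_zero by blast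
  have m: "m \<le> Jr G" if "h10q G" for G unfolding m_def using bdd that by (auto intro: cInf_lower)
  have "\<exists>F. h10q F \<and> Jr F < m + inverse (real (Suc n))" for n
    using cInf_lessD[OF ne, of "m + inverse (real (Suc n))"] by (auto simp: m_def simp del: of_nat_Suc)
  then obtain F where F: "\<And>n. h10q (F n)" "\<And>n. Jr (F n) < m + inverse (real (Suc n))" by metis
  note F' = h10q_D[OF F(1)]
  have JF: "(\<lambda>n. Jr (F n)) \<longlonglongrightarrow> m"
  proof (rule tendsto_sandwich[OF always_eventually always_eventually tendsto_const])
    show "(\<lambda>n. m + inverse (real (Suc n))) \<longlonglongrightarrow> m"
      using tendsto_add[OF tendsto_const[of m] LIMSEQ_inverse_real_of_nat] by simp
  qed (use F m in \<open>auto intro: less_imp_le\<close>)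
  obtain C where C: "C > 0" "\<And>F. h10_pair F \<Longrightarrow> l2_sq M (val F) \<le> C * l2_sq M (der F)"
    using poincare_h10_pair by blast
  \<comment> \<open>The midpoint cannot fall below \<open>m\<close>, so the gain from
    \<open>Jr_midpoint\<close> is at most the mean excess of the two values over \<open>m\<close>.
    Poincare's inequality then controls the value component, whence \<open>C + 1\<close>.\<close>
  have close: "l2_sq M (\<lambda>x. F k x - F n x) \<le> (C + 1) * (4 * (Jr (F k) - m) + 4 * (Jr (F n) - m))" for k n
  proof -
    have diff: "h10_pair (\<lambda>x. F k x - F n x)"
      using h10_pair_add_scaleR[OF F'(1) F'(1), of k "-1" n] by simp
    have "l2_sq M (\<lambda>x. F k x - F n x) \<le> (C + 1) * l2_sq M (\<lambda>x. der (F k) x - der (F n) x)"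
      using C(2)[OF diff] l2_sq_pair(3)[OF h10_pair_square_integrable(1)[OF diff]]
      by (simp add: algebra_simps)
    also have "\<dots> \<le> (C + 1) * (4 * (Jr (F k) - m) + 4 * (Jr (F n) - m))"
    proof (intro mult_left_mono)
      show "l2_sq M (\<lambda>x. der (F k) x - der (F n) x) \<le> 4 * (Jr (F k) - m) + 4 * (Jr (F n) - m)"
        using m[OF Jr_midpoint(1)[OF F(1) F(1), of k n]] Jr_midpoint(2)[OF F(1) F(1), of k n]
        by (simp add: field_simps)
    qed (use C in auto)
    finally show ?thesis .
  qed
  have "\<exists>G. h10_pair G \<and> (\<lambda>n. l2_sq M (\<lambda>x. F n x - G x)) \<longlonglongrightarrow> 0"
  proof (rule h10_pair_complete[OF F'(1)])
    fix e :: real assume e: "e > 0"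
    have "m < m + e / (8 * (C + 1))" using e C by simp
    from order_tendstoD(2)[OF JF this] obtain K where K: "\<And>n. n \<ge> K \<Longrightarrow> Jr (F n) < m + e / (8 * (C + 1))"
      by (auto simp: eventually_sequentially)
    have "l2_sq M (\<lambda>x. F k x - F n x) < e" if "k \<ge> K" "n \<ge> K" for k n
    proof -
      have "4 * (Jr (F k) - m) + 4 * (Jr (F n) - m) < 8 * (e / (8 * (C + 1)))"
        using K[OF that(1)] K[OF that(2)] by argo
      then have "(C + 1) * (4 * (Jr (F k) - m) + 4 * (Jr (F n) - m)) < (C + 1) * (8 * (e / (8 * (C + 1))))"
        using C by (intro mult_strict_left_mono) auto
      also have "\<dots> = e" using C by (simp add: field_simps)
      finally show ?thesis using close[of k n] by linarith
    qed
    then show "\<exists>K. \<forall>k\<ge>K. \<forall>n\<ge>K. l2_sq M (\<lambda>x. F k x - F n x) < e" by blast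
  qed
  then obtain G where G: "h10_pair G" and lim: "(\<lambda>n. l2_sq M (\<lambda>x. F n x - G x)) \<longlonglongrightarrow> 0" by blast
  note G' = h10_pair_square_integrable[OF G]
  have d: "square_integrable M (\<lambda>x. F n x - G x)" for n
    by (rule square_integrable_diff[OF F'(3) G'(1)])
  have limv: "(\<lambda>n. l2_sq M (\<lambda>x. val (F n) x - val G x)) \<longlonglongrightarrow> 0"
    by (rule tendsto_sandwich[OF always_eventually always_eventually tendsto_const lim])
       (use l2_sq_pair(3)[OF d] in \<open>auto simp: l2_sq_nonneg\<close>)
  have limd: "(\<lambda>n. l2_sq M (\<lambda>x. der (F n) x - der G x)) \<longlonglongrightarrow> 0"
    by (rule tendsto_sandwich[OF always_eventually always_eventually tendsto_const lim])
       (use l2_sq_pair(3)[OF d] in \<open>auto simp: l2_sq_nonneg\<close>)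
  have "(\<lambda>n. Lin (val (F n))) \<longlonglongrightarrow> Lin (val G)"
    using l2_tendsto_inner[OF F'(4) G'(2) f limv] by (simp add: Lin_def)
  \<comment> \<open>All terms of \<open>Jr\<close> other than \<open>N\<close> converge, hence so
    does \<open>N\<close>, and the lower semicontinuity lemma can be used along a
    subsequence.\<close>
  then have "(\<lambda>n. 2 * (Jr (F n) + Lin (val (F n))) - l2_sq M (der (F n)))
      \<longlonglongrightarrow> 2 * (m + Lin (val G)) - l2_sq M (der G)"
    by (intro tendsto_intros JF l2_tendsto_l2_sq[OF F'(5) G'(3) limd])
  then have NF: "(\<lambda>n. N (val (F n))) \<longlonglongrightarrow> 2 * (m + Lin (val G)) - l2_sq M (der G)"
    by (simp add: Jr_def add_divide_distrib)
  obtain r :: "nat \<Rightarrow> nat" where r: "strict_mono r" "AE x in M. (\<lambda>n. val (F (r n)) x) \<longlonglongrightarrow> val G x"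
    using l2_tendsto_AE_subseq[OF F'(4) G'(2) limv] by blast
  note lsc = N_lower_semicontinuous[OF F'(2) square_integrable_measurable[OF G'(2)] r(2)
      LIMSEQ_subseq_LIMSEQ[OF NF r(1), unfolded o_def]]
  have "h10q G" using G lsc(1) by (simp add: h10q_def)
  moreover have "Jr G \<le> m" using lsc(2) unfolding Jr_def by argo
  ultimately show ?thesis using m by (meson order_trans)
qed

text \<open>The midpoint of two minimizers would be better than both unless their gradients agree
  almost everywhere; Poincare's inequality carries this over to the values.\<close>

lemma Jr_minimizer_unique:
  assumes F: "h10q F" "\<And>H. h10q H \<Longrightarrow> Jr F \<le> Jr H" and G: "h10q G" "\<And>H. h10q H \<Longrightarrow> Jr G \<le> Jr H"
  shows "AE x in M. val G x = val F x"
proof -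
  obtain C where C: "C > 0" "\<And>F. h10_pair F \<Longrightarrow> l2_sq M (val F) \<le> C * l2_sq M (der F)"
    using poincare_h10_pair by blast
  have diff: "h10_pair (\<lambda>x. F x - G x)"
    using h10_pair_add_scaleR[OF h10q_D(1)[OF F(1)] h10q_D(1)[OF G(1)], of "-1"] by simp
  have "l2_sq M (\<lambda>x. der F x - der G x) \<le> 0"
    using F(2)[OF Jr_midpoint(1)[OF F(1) G(1)]] G(2)[OF F(1)] Jr_midpoint(2)[OF F(1) G(1)] by argo
  then have "C * l2_sq M (\<lambda>x. der F x - der G x) \<le> 0" using C by (simp add: mult_le_0_iff)
  then have "l2_sq M (\<lambda>x. val F x - val G x) \<le> 0" using C(2)[OF diff] by simp
  then have "l2_sq M (\<lambda>x. val F x - val G x) = 0" 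
    using l2_sq_nonneg[of M "\<lambda>x. val F x - val G x"] by linarith
  then have "AE x in M. (norm (val F x - val G x))\<^sup>2 = 0"
    using h10_pair_square_integrable(2)[OF diff] unfolding l2_sq_def
    by (subst (asm) integral_nonneg_eq_0_iff_AE) (auto simp: square_integrable_def)
  then show ?thesis by eventually_elim simp
qed

subsection \<open>The Euler-Lagrange inequality\<close>

lemma A_perturbation_tendsto:
  assumes u: "u \<in> Lq" and h: "h \<in> Lq" and t: "t \<longlonglongrightarrow> 0" "\<And>n. 0 \<le> t n" "\<And>n. t n \<le> 1"
  shows "(\<lambda>n. A (\<lambda>x. u x + t n * h x)) \<longlonglongrightarrow> A u"
  unfolding A_def
proof (rule integral_dominated_convergence[where w = "\<lambda>x. (\<bar>u x\<bar> + \<bar>h x\<bar>) powr q"])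
  have [measurable]: "u \<in> borel_measurable M" "h \<in> borel_measurable M" using u h by (auto simp: Lq_iff)
  show "(\<lambda>x. \<bar>u x\<bar> powr q) \<in> borel_measurable M" "(\<lambda>x. \<bar>u x + t n * h x\<bar> powr q) \<in> borel_measurable M" for n
    by measurable
  show "AE x in M. (\<lambda>n. \<bar>u x + t n * h x\<bar> powr q) \<longlonglongrightarrow> \<bar>u x\<bar> powr q"
  proof (rule AE_I2)
    fix x
    have "(\<lambda>n. \<bar>u x + t n * h x\<bar>) \<longlonglongrightarrow> \<bar>u x + 0 * h x\<bar>" by (intro tendsto_intros t)
    then show "(\<lambda>n. \<bar>u x + t n * h x\<bar> powr q) \<longlonglongrightarrow> \<bar>u x\<bar> powr q"
      using q_gt_2 by (intro tendsto_powr'[OF _ tendsto_const]) auto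
  qed
  show "AE x in M. norm (\<bar>u x + t n * h x\<bar> powr q) \<le> (\<bar>u x\<bar> + \<bar>h x\<bar>) powr q" for n
  proof (rule AE_I2)
    fix x
    have "\<bar>t n * h x\<bar> \<le> \<bar>h x\<bar>" using t by (simp add: abs_mult mult_left_le_one_le)
    then have "\<bar>u x + t n * h x\<bar> \<le> \<bar>u x\<bar> + \<bar>h x\<bar>" by linarith
    then show "norm (\<bar>u x + t n * h x\<bar> powr q) \<le> (\<bar>u x\<bar> + \<bar>h x\<bar>) powr q"
      using q_gt_2 by (simp add: powr_mono2)
  qed
qed (rule Lq_abs_add[OF u h])

lemma Vr_perturbation_tendsto:
  assumes u: "u \<in> Lq" and h: "h \<in> Lq" and t: "t \<longlonglongrightarrow> 0" "\<And>n. 0 \<le> t n" "\<And>n. t n \<le> 1"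
  shows "(\<lambda>n. LINT x|M. Vr (\<lambda>x. u x + t n * h x) x * (u x * h x)) \<longlonglongrightarrow> (LINT x|M. Vr u x * (u x * h x))"
\<comment> \<open>The prefactor \<open>A powr (- 1 / p)\<close> may blow up near
  \<open>A u = 0\<close>, but in that case \<open>u\<close> vanishes almost everywhere, and so do
  all the integrands.\<close>
proof (cases "A u = 0")
  case True
  then have u0: "AE x in M. u x = 0" using A_zero_iff[OF u] by simp
  have "(LINT x|M. V x * (u x * h x)) = 0" for V :: "'a \<Rightarrow> real"
    using u0 by (intro integral_eq_zero_AE) (auto elim!: eventually_mono)
  then show ?thesis by simp
next
  case False
  define s where "s = 2 / (p - 1)"
  have s: "s > 0" using p by (simp add: s_def)
  note At = A_perturbation_tendsto[OF u h t]
  define a where "a n = A (\<lambda>x. u x + t n * h x) powr (- 1 / p)" for n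
  have a: "a \<longlonglongrightarrow> A u powr (- 1 / p)"
    unfolding a_def by (intro tendsto_powr[OF At tendsto_const False])
  then obtain K where K: "K > 0" "\<And>n. \<bar>a n\<bar> \<le> K"
    using convergent_imp_Bseq[of a] by (auto simp: convergent_def Bseq_def)
  have V: "Vr (\<lambda>x. u x + t n * h x) x = a n * \<bar>u x + t n * h x\<bar> powr s" for n x
    by (simp add: Vr_def a_def s_def)
  have Vu: "Vr u x = A u powr (- 1 / p) * \<bar>u x\<bar> powr s" for x by (simp add: Vr_def s_def)
  show ?thesis
    unfolding V Vu
  proof (rule integral_dominated_convergence[where w = "\<lambda>x. K * (\<bar>u x\<bar> + \<bar>h x\<bar>) powr q"])
    have [measurable]: "u \<in> borel_measurable M" "h \<in> borel_measurable M" using u h by (auto simp: Lq_iff)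
    show "(\<lambda>x. A u powr (- 1 / p) * \<bar>u x\<bar> powr s * (u x * h x)) \<in> borel_measurable M"
      "(\<lambda>x. a n * \<bar>u x + t n * h x\<bar> powr s * (u x * h x)) \<in> borel_measurable M" for n
      by measurable
    show "integrable M (\<lambda>x. K * (\<bar>u x\<bar> + \<bar>h x\<bar>) powr q)"
      using Lq_abs_add[OF u h] by simp
    show "AE x in M. (\<lambda>n. a n * \<bar>u x + t n * h x\<bar> powr s * (u x * h x))
        \<longlonglongrightarrow> A u powr (- 1 / p) * \<bar>u x\<bar> powr s * (u x * h x)"
    proof (rule AE_I2)
      fix x
      have "(\<lambda>n. \<bar>u x + t n * h x\<bar>) \<longlonglongrightarrow> \<bar>u x + 0 * h x\<bar>" by (intro tendsto_intros t)
      then have "(\<lambda>n. \<bar>u x + t n * h x\<bar> powr s) \<longlonglongrightarrow> \<bar>u x\<bar> powr s"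
        using s by (intro tendsto_powr'[OF _ tendsto_const]) auto
      then show "(\<lambda>n. a n * \<bar>u x + t n * h x\<bar> powr s * (u x * h x))
          \<longlonglongrightarrow> A u powr (- 1 / p) * \<bar>u x\<bar> powr s * (u x * h x)"
        by (intro tendsto_mult a tendsto_const)
    qed
    show "AE x in M. norm (a n * \<bar>u x + t n * h x\<bar> powr s * (u x * h x)) \<le> K * (\<bar>u x\<bar> + \<bar>h x\<bar>) powr q" for n
    proof (rule AE_I2)
      fix x
      define b where "b = \<bar>u x\<bar> + \<bar>h x\<bar>"
      have b: "b \<ge> 0" "\<bar>u x\<bar> \<le> b" "\<bar>h x\<bar> \<le> b" by (auto simp: b_def)
      have "\<bar>t n * h x\<bar> \<le> \<bar>h x\<bar>" using t by (simp add: abs_mult mult_left_le_one_le)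
      then have "\<bar>u x + t n * h x\<bar> \<le> b" by (simp add: b_def)
      then have 1: "\<bar>u x + t n * h x\<bar> powr s \<le> b powr s" using s by (intro powr_mono2) auto
      have 2: "\<bar>u x * h x\<bar> \<le> b * b" using b by (simp add: abs_mult mult_mono)
      \<comment> \<open>The exponents match because \<open>s + 2 = q\<close>.\<close>
      have 3: "b powr s * (b * b) = b powr q"
      proof (cases "b = 0")
        case False
        have "b powr q = b powr s * b powr 2" by (simp only: powr_add[symmetric] s_def q_eqs)
        then show ?thesis using b by (simp add: power2_eq_square)
      qed simp
      have "norm (a n * \<bar>u x + t n * h x\<bar> powr s * (u x * h x)) =
          \<bar>a n\<bar> * (\<bar>u x + t n * h x\<bar> powr s * \<bar>u x * h x\<bar>)"
        by (simp add: abs_mult)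
      also have "\<dots> \<le> K * (b powr s * (b * b))"
        using K 1 2 by (intro mult_mono mult_nonneg_nonneg) auto
      finally show "norm (a n * \<bar>u x + t n * h x\<bar> powr s * (u x * h x)) \<le> K * (\<bar>u x\<bar> + \<bar>h x\<bar>) powr q"
        unfolding 3 by (simp only: b_def)
    qed
  qed
qed

definition minimizer :: "('a \<Rightarrow> real \<times> 'a) \<Rightarrow> bool" where
  "minimizer F \<longleftrightarrow> h10q F \<and> (\<forall>G. h10q G \<longrightarrow> Jr F \<le> Jr G)"

lemma euler_lagrange:
  assumes F: "minimizer F" and H: "h10q H"
  shows "0 \<le> (LINT x|M. der F x \<bullet> der H x) + (LINT x|M. Vr (val F) x * (val F x * val H x)) - Lin (val H)"
proof -
  have qF: "h10q F" using F by (simp add: minimizer_def)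
  note F' = h10q_D[OF qF] and H' = h10q_D[OF H]
  define t where "t n = inverse (real (Suc n))" for n
  have t: "t \<longlonglongrightarrow> 0" "\<And>n. 0 \<le> t n" "\<And>n. t n \<le> 1" "\<And>n. 0 < t n"
    unfolding t_def by (rule LIMSEQ_inverse_real_of_nat) (auto simp: divide_simps)
  define w where "w n = (\<lambda>x. val F x + t n * val H x)" for n
  define a where "a = (LINT x|M. der F x \<bullet> der H x) - Lin (val H)"
  define K where "K = l2_sq M (der H) + N (val H)"
  have ineq: "0 \<le> a + (LINT x|M. Vr (w n) x * (val F x * val H x)) + t n / 2 * K" for n
  proof -
    let ?G = "\<lambda>x. F x + t n *\<^sub>R H x"
    let ?b = "LINT x|M. Vr (w n) x * (val F x * val H x)"
    let ?c = "LINT x|M. Vr (w n) x * (val H x)\<^sup>2"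
    have G: "h10q ?G" by (rule h10q_add_scaleR[OF qF H])
    have vG: "val ?G = w n" by (simp add: w_def)
    have w: "w n \<in> Lq" using h10q_D(2)[OF G] by (simp only: vG)
    have "Sr (Vr (w n)) F \<le> Jr F" by (rule Sr_le_Jr[OF w qF])
    also have "\<dots> \<le> Jr ?G" using F G by (simp add: minimizer_def)
    also have "\<dots> = Sr (Vr (w n)) ?G" using Sr_eq_Jr[OF G] by (simp only: vG)
    also have "\<dots> = Sr (Vr (w n)) F + t n * (a + ?b) + (t n)\<^sup>2 / 2 * (l2_sq M (der H) + ?c)"
      unfolding Sr_expansion[OF w qF H] by (simp add: a_def algebra_simps)
    finally have "0 \<le> t n * (a + ?b) + (t n)\<^sup>2 / 2 * (l2_sq M (der H) + ?c)" by simp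
    \<comment> \<open>The potential \<open>Vr (w n)\<close> varies with \<open>n\<close>; Hoelder's
      inequality bounds its second-order contribution by \<open>N (val H)\<close> uniformly, so that
      after division by \<open>t n\<close> the last term tends to 0.\<close>
    also have "\<dots> \<le> t n * (a + ?b) + (t n)\<^sup>2 / 2 * K"
      using hoelder_Vr(2)[OF w H'(2)] by (intro add_left_mono mult_left_mono) (auto simp: K_def)
    also have "\<dots> = t n * (a + ?b + t n / 2 * K)" by (simp add: power2_eq_square algebra_simps)
    finally show ?thesis using t(4)[of n] by (simp add: zero_le_mult_iff)
  qed
  have "(\<lambda>n. a + (LINT x|M. Vr (w n) x * (val F x * val H x)) + t n / 2 * K)
      \<longlonglongrightarrow> a + (LINT x|M. Vr (val F) x * (val F x * val H x)) + 0 / 2 * K"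
    unfolding w_def by (intro tendsto_intros t(1) Vr_perturbation_tendsto F' H' t(2,3)) simp
  then have "0 \<le> a + (LINT x|M. Vr (val F) x * (val F x * val H x)) + 0 / 2 * K"
    by (rule LIMSEQ_le_const) (use ineq in blast)
  then show ?thesis by (simp add: a_def)
qed

text \<open>For a fixed potential the second-order part is nonnegative, so the first-order
  inequality in the direction \<open>G - F\<close> already gives a global minimum on
  \<open>h10q\<close>.\<close>

lemma Sr_minimal:
  assumes F: "minimizer F" and G: "h10q G"
  shows "Jr F \<le> Sr (Vr (val F)) G"
proof -
  have qF: "h10q F" using F by (simp add: minimizer_def)
  let ?H = "\<lambda>x. G x + (-1) *\<^sub>R F x"
  have H: "h10q ?H" by (rule h10q_add_scaleR[OF G qF])
  note v = h10q_D(2)[OF qF]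
  have "Sr (Vr (val F)) G = Sr (Vr (val F)) (\<lambda>x. F x + 1 *\<^sub>R ?H x)" by simp
  also have "\<dots> \<ge> Sr (Vr (val F)) F"
  proof -
    have "s \<le> s + 1 * e + 1\<^sup>2 / 2 * (a + b)" if "0 \<le> e" "0 \<le> a" "0 \<le> b" for s e a b :: real
      using that by simp
    moreover have "0 \<le> (LINT x|M. Vr (val F) x * (val ?H x)\<^sup>2)" by (simp add: Vr_nonneg)
    ultimately show ?thesis
      unfolding Sr_expansion[OF v qF H] using euler_lagrange[OF F H] l2_sq_nonneg by blast
  qed
  finally show ?thesis by (simp add: Sr_eq_Jr[OF qF])
qed

section \<open>Truncation and competitors outside L^q\<close>

lemma continuous_on_sin_scaled: "continuous_on UNIV (\<lambda>s::real. c * sin (s / c))"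
  unfolding divide_inverse by (intro continuous_intros)

text \<open>The first bound dominates for a fixed level \<open>c\<close>; the second dominates
  uniformly in \<open>c\<close>, for the limit as the level tends to infinity.\<close>

lemma sin_scaled_bounds:
  fixes c v :: real
  assumes "c > 0"
  shows "\<bar>c * sin (v / c)\<bar> \<le> c" "\<bar>c * sin (v / c)\<bar> \<le> \<bar>v\<bar>"
proof -
  show "\<bar>c * sin (v / c)\<bar> \<le> c" using assms by (simp add: abs_mult mult_left_le)
  have "c * \<bar>sin (v / c)\<bar> \<le> c * \<bar>v / c\<bar>"
    using assms by (intro mult_left_mono abs_sin_x_le_abs_x) simp
  then show "\<bar>c * sin (v / c)\<bar> \<le> \<bar>v\<bar>" using assms by (simp add: abs_mult)
qed

lemma sin_scaled_tendsto:
  fixes v :: real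
  shows "(\<lambda>k. real (Suc k) * sin (v / real (Suc k))) \<longlonglongrightarrow> v"
proof -
  have "((\<lambda>t. sin (v * t)) has_real_derivative v) (at 0)"
    by (auto intro!: derivative_eq_intros)
  then have "((\<lambda>h. sin (v * h) / h) \<longlongrightarrow> v) (at 0)" by (simp add: DERIV_def)
  moreover have "filterlim (\<lambda>n. 1 / real (Suc n)) (at 0) sequentially"
    using LIMSEQ_inverse_real_of_nat by (simp add: filterlim_at inverse_eq_divide)
  ultimately have "(\<lambda>n. sin (v * (1 / real (Suc n))) / (1 / real (Suc n))) \<longlonglongrightarrow> v"
    by (rule filterlim_compose)
  then show ?thesis by (simp add: mult.commute)
qed

text \<open>On a bounded domain the constant 1 belongs to \<open>Lq\<close>, and Hoelder's
  inequality with it bounds the integral of the potential.\<close>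

lemma Vr_integrable: "w \<in> Lq \<Longrightarrow> integrable M (Vr w)"
  using hoelder_Vr(1)[OF _ bounded_in_Lq[of "\<lambda>_. 1" 1]] by simp

text \<open>
  A function of the energy space need not lie in \<open>L\<^sup>q\<close>. Composing approximating test functions with the
  bounded contraction \<open>\<lambda>s. c sin (s / c)\<close> yields test functions, does not increase the Dirichlet
  integral, and makes the potential term continuous under dominated convergence.
\<close>

lemma Sr_minimal_truncated:
  assumes F: "minimizer F" and G: "h10_pair G" and c: "c > 0"
  defines "v \<equiv> \<lambda>x. c * sin (val G x / c)"
  shows "Jr F \<le> (l2_sq M (der G) + (LINT x|M. Vr (val F) x * (v x)\<^sup>2)) / 2 - Lin v"
proof -
  have qF: "h10q F" using F by (simp add: minimizer_def)
  note G' = h10_pair_square_integrable[OF G]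
  obtain \<phi> where \<phi>: "\<And>n. \<phi> n \<in> test_functions \<Omega>" and lim: "(\<lambda>n. l2_sq M (\<lambda>x. jet (\<phi> n) x - G x)) \<longlonglongrightarrow> 0"
    using G by (auto simp: h10_pair_def)
  have d: "square_integrable M (\<lambda>x. jet (\<phi> n) x - G x)" for n
    by (rule square_integrable_diff[OF square_integrable_jet[OF \<phi>] G'(1)])
  have limv: "(\<lambda>n. l2_sq M (\<lambda>x. \<phi> n x - val G x)) \<longlonglongrightarrow> 0"
    by (rule tendsto_sandwich[OF always_eventually always_eventually tendsto_const lim])
       (use l2_sq_pair(3)[OF d] in \<open>auto simp: l2_sq_nonneg jet_def\<close>)
  have limd: "(\<lambda>n. l2_sq M (\<lambda>x. grad (\<phi> n) x - der G x)) \<longlonglongrightarrow> 0"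
    by (rule tendsto_sandwich[OF always_eventually always_eventually tendsto_const lim])
       (use l2_sq_pair(3)[OF d] in \<open>auto simp: l2_sq_nonneg jet_def\<close>)
  obtain r :: "nat \<Rightarrow> nat" where r: "strict_mono r" "AE x in M. (\<lambda>n. \<phi> (r n) x) \<longlonglongrightarrow> val G x"
    using l2_tendsto_AE_subseq[OF test_function_square_integrable[OF \<phi>] G'(2) limv] by blast
  define \<psi> where "\<psi> n = (\<lambda>x. c * sin (\<phi> (r n) x / c))" for n
  have \<psi>: "\<psi> n \<in> test_functions \<Omega>" for n unfolding \<psi>_def by (rule test_functions_sin[OF \<phi>])
  have AE\<psi>: "AE x in M. (\<lambda>n. \<psi> n x) \<longlonglongrightarrow> v x"
    using r(2) unfolding \<psi>_def v_def by eventually_elim (use c in \<open>auto intro!: tendsto_intros\<close>)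
  have \<psi>c: "\<bar>\<psi> n x\<bar> \<le> c" for n x unfolding \<psi>_def by (rule sin_scaled_bounds[OF c])
  have [measurable]: "\<psi> n \<in> borel_measurable M" for n by (rule test_function_measurable[OF \<psi>])
  have [measurable]: "val G \<in> borel_measurable M" by (rule square_integrable_measurable[OF G'(2)])
  have vm [measurable]: "v \<in> borel_measurable M"
    unfolding v_def using borel_measurable_continuous_on[OF continuous_on_sin_scaled square_integrable_measurable[OF G'(2)]] .
  have [measurable]: "Vr (val F) \<in> borel_measurable M"
    by (rule Vr_measurable[OF square_integrable_measurable[OF h10q_D(4)[OF qF]]])
  have [measurable]: "f \<in> borel_measurable M" by (rule square_integrable_measurable[OF f])
  \<comment> \<open>The Dirichlet term is that of \<open>\<phi> (r n)\<close>, whose limit is known;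
    the cosine factor in \<open>grad_sin\<close> makes it an upper bound for that of
    \<open>\<psi> n\<close>.\<close>
  have ineq: "Jr F \<le> (l2_sq M (grad (\<phi> (r n))) + (LINT x|M. Vr (val F) x * (\<psi> n x)\<^sup>2)) / 2 - Lin (\<psi> n)" for n
  proof -
    have "l2_sq M (grad (\<psi> n)) \<le> l2_sq M (grad (\<phi> (r n)))"
      unfolding l2_sq_def
    proof (rule integral_mono)
      show "integrable M (\<lambda>x. (norm (grad (\<psi> n) x))\<^sup>2)" "integrable M (\<lambda>x. (norm (grad (\<phi> (r n)) x))\<^sup>2)"
        using square_integrable_grad \<psi> \<phi> by (auto simp: square_integrable_def)
      show "(norm (grad (\<psi> n) x))\<^sup>2 \<le> (norm (grad (\<phi> (r n)) x))\<^sup>2" for x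
        unfolding \<psi>_def grad_sin[OF \<phi> c] by (intro power_mono) (auto intro: mult_left_le_one_le)
    qed
    moreover have "Jr F \<le> (l2_sq M (grad (\<psi> n)) + (LINT x|M. Vr (val F) x * (\<psi> n x)\<^sup>2)) / 2 - Lin (\<psi> n)"
      using Sr_minimal[OF F h10q_jet[OF \<psi>], of n] by (simp add: Sr_def jet_def)
    ultimately show ?thesis by argo
  qed
  have "(\<lambda>n. l2_sq M (grad (\<phi> (r n)))) \<longlonglongrightarrow> l2_sq M (der G)"
    using LIMSEQ_subseq_LIMSEQ[OF l2_tendsto_l2_sq[OF square_integrable_grad[OF \<phi>] G'(3) limd] r(1)]
    by (simp add: o_def)
  moreover have "(\<lambda>n. LINT x|M. Vr (val F) x * (\<psi> n x)\<^sup>2) \<longlonglongrightarrow> (LINT x|M. Vr (val F) x * (v x)\<^sup>2)"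
  proof (rule integral_dominated_convergence[where w = "\<lambda>x. c\<^sup>2 * Vr (val F) x"])
    show "integrable M (\<lambda>x. c\<^sup>2 * Vr (val F) x)" using Vr_integrable[OF h10q_D(2)[OF qF]] by simp
    show "AE x in M. (\<lambda>n. Vr (val F) x * (\<psi> n x)\<^sup>2) \<longlonglongrightarrow> Vr (val F) x * (v x)\<^sup>2"
      using AE\<psi> by eventually_elim (intro tendsto_intros)
    show "AE x in M. norm (Vr (val F) x * (\<psi> n x)\<^sup>2) \<le> c\<^sup>2 * Vr (val F) x" for n
    proof (rule AE_I2)
      fix x
      have "(\<psi> n x)\<^sup>2 \<le> c\<^sup>2" using \<psi>c[of n x] c by (simp add: abs_le_square_iff[symmetric])
      from mult_left_mono[OF this Vr_nonneg[of "val F" x]]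
      show "norm (Vr (val F) x * (\<psi> n x)\<^sup>2) \<le> c\<^sup>2 * Vr (val F) x"
        by (simp add: abs_mult Vr_nonneg mult.commute)
    qed
  qed measurable
  moreover have "(\<lambda>n. Lin (\<psi> n)) \<longlonglongrightarrow> Lin v"
    unfolding Lin_def
  proof (rule integral_dominated_convergence[where w = "\<lambda>x. c * \<bar>f x\<bar>"])
    show "integrable M (\<lambda>x. c * \<bar>f x\<bar>)" using square_integrable_imp_integrable[OF f] by simp
    show "AE x in M. (\<lambda>n. \<psi> n x * f x) \<longlonglongrightarrow> v x * f x"
      using AE\<psi> by eventually_elim (intro tendsto_intros)
    show "AE x in M. norm (\<psi> n x * f x) \<le> c * \<bar>f x\<bar>" for n
      using \<psi>c by (intro AE_I2) (simp add: abs_mult mult_right_mono)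
  qed measurable
  ultimately have "(\<lambda>n. (l2_sq M (grad (\<phi> (r n))) + (LINT x|M. Vr (val F) x * (\<psi> n x)\<^sup>2)) / 2 - Lin (\<psi> n))
      \<longlonglongrightarrow> (l2_sq M (der G) + (LINT x|M. Vr (val F) x * (v x)\<^sup>2)) / 2 - Lin v"
    by (intro tendsto_intros) auto
  then show ?thesis by (rule LIMSEQ_le_const) (use ineq in blast)
qed

text \<open>The truncation level \<open>Suc k\<close> tends to infinity. Finiteness of the potential
  term gives the dominating function, and the Dirichlet term in the truncated inequality is
  independent of the level.\<close>

lemma Sr_minimal_energy_space:
  assumes F: "minimizer F" and G: "h10_pair G" and int: "integrable M (\<lambda>x. Vr (val F) x * (val G x)\<^sup>2)"
  shows "Jr F \<le> Sr (Vr (val F)) G"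
proof -
  have qF: "h10q F" using F by (simp add: minimizer_def)
  note G' = h10_pair_square_integrable[OF G]
  define v where "v k = (\<lambda>x. real (Suc k) * sin (val G x / real (Suc k)))" for k
  have v: "(\<lambda>k. v k x) \<longlonglongrightarrow> val G x" for x unfolding v_def by (rule sin_scaled_tendsto)
  have vle: "\<bar>v k x\<bar> \<le> \<bar>val G x\<bar>" for k x unfolding v_def by (rule sin_scaled_bounds) simp
  have [measurable]: "val G \<in> borel_measurable M" by (rule square_integrable_measurable[OF G'(2)])
  have [measurable]: "v k \<in> borel_measurable M" for k
    unfolding v_def using borel_measurable_continuous_on[OF continuous_on_sin_scaled square_integrable_measurable[OF G'(2)]] .
  have [measurable]: "Vr (val F) \<in> borel_measurable M"
    by (rule Vr_measurable[OF square_integrable_measurable[OF h10q_D(4)[OF qF]]])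
  have [measurable]: "f \<in> borel_measurable M" by (rule square_integrable_measurable[OF f])
  have "(\<lambda>k. LINT x|M. Vr (val F) x * (v k x)\<^sup>2) \<longlonglongrightarrow> (LINT x|M. Vr (val F) x * (val G x)\<^sup>2)"
  proof (rule integral_dominated_convergence[where w = "\<lambda>x. Vr (val F) x * (val G x)\<^sup>2"])
    show "AE x in M. (\<lambda>k. Vr (val F) x * (v k x)\<^sup>2) \<longlonglongrightarrow> Vr (val F) x * (val G x)\<^sup>2"
      by (intro AE_I2 tendsto_intros v)
    show "AE x in M. norm (Vr (val F) x * (v k x)\<^sup>2) \<le> Vr (val F) x * (val G x)\<^sup>2" for k
    proof (rule AE_I2)
      fix x
      have "(v k x)\<^sup>2 \<le> (val G x)\<^sup>2" using vle[of k x] by (simp add: abs_le_square_iff[symmetric])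
      from mult_left_mono[OF this Vr_nonneg[of "val F" x]]
      show "norm (Vr (val F) x * (v k x)\<^sup>2) \<le> Vr (val F) x * (val G x)\<^sup>2"
        by (simp add: abs_mult Vr_nonneg)
    qed
  qed (use int in measurable)
  moreover have "(\<lambda>k. Lin (v k)) \<longlonglongrightarrow> Lin (val G)"
    unfolding Lin_def
  proof (rule integral_dominated_convergence[where w = "\<lambda>x. \<bar>val G x * f x\<bar>"])
    show "integrable M (\<lambda>x. \<bar>val G x * f x\<bar>)" using Lin_integrable[OF G'(2)] by (rule integrable_abs)
    show "AE x in M. (\<lambda>k. v k x * f x) \<longlonglongrightarrow> val G x * f x"
      by (intro AE_I2 tendsto_intros v)
    show "AE x in M. norm (v k x * f x) \<le> \<bar>val G x * f x\<bar>" for k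
      using vle by (intro AE_I2) (simp add: abs_mult mult_right_mono)
  qed (intro borel_measurable_times square_integrable_measurable[OF G'(2)] square_integrable_measurable[OF f], measurable)
  ultimately have "(\<lambda>k. (l2_sq M (der G) + (LINT x|M. Vr (val F) x * (v k x)\<^sup>2)) / 2 - Lin (v k))
      \<longlonglongrightarrow> (l2_sq M (der G) + (LINT x|M. Vr (val F) x * (val G x)\<^sup>2)) / 2 - Lin (val G)"
    by (intro tendsto_intros) auto
  then have "Jr F \<le> (l2_sq M (der G) + (LINT x|M. Vr (val F) x * (val G x)\<^sup>2)) / 2 - Lin (val G)"
  proof (rule LIMSEQ_le_const)
    have "Jr F \<le> (l2_sq M (der G) + (LINT x|M. Vr (val F) x * (v k x)\<^sup>2)) / 2 - Lin (v k)" for k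
      unfolding v_def by (rule Sr_minimal_truncated[OF F G]) simp
    then show "\<exists>N. \<forall>k\<ge>N. Jr F \<le> (l2_sq M (der G) + (LINT x|M. Vr (val F) x * (v k x)\<^sup>2)) / 2 - Lin (v k)"
      by blast
  qed
  then show ?thesis by (simp add: Sr_def)
qed

section \<open>The case of a vanishing minimizer\<close>

lemma h10q_scaleR_jet:
  assumes "\<phi> \<in> test_functions \<Omega>"
  shows "h10q (\<lambda>x. c *\<^sub>R jet \<phi> x)"
  using h10q_add_scaleR[OF h10q_zero h10q_jet[OF assms], of c] by simp

lemma N_scale: "N (\<lambda>x. c * u x) = c\<^sup>2 * N u"
proof -
  have "A (\<lambda>x. c * u x) = \<bar>c\<bar> powr q * A u"
    by (simp add: A_def abs_mult powr_mult)
  then have "N (\<lambda>x. c * u x) = (\<bar>c\<bar> powr q) powr ((p - 1) / p) * N u"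
    using A_nonneg by (simp add: N_def powr_mult)
  also have "(\<bar>c\<bar> powr q) powr ((p - 1) / p) = \<bar>c\<bar> powr 2"
  proof -
    have "q * ((p - 1) / p) = 2" using p by (simp add: q_def)
    then show ?thesis by (simp only: powr_powr)
  qed
  also have "\<bar>c\<bar> powr 2 = c\<^sup>2" by (cases "c = 0") auto
  finally show ?thesis .
qed

text \<open>If the minimizer vanishes, \<open>Jr\<close> is nonnegative on all competitors. On the
  multiples of a test function it is \<open>t^2 K - t Lin \<phi>\<close>, by quadratic homogeneity
  of \<open>N\<close>, and small \<open>t\<close> of the right sign forces
  \<open>Lin \<phi> = 0\<close>.\<close>

lemma f_zero_if_minimizer_zero:
  assumes F: "minimizer F" and A: "A (val F) = 0"
  shows "AE x in M. f x = 0"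
proof (rule fundamental_lemma[OF open_\<Omega> square_integrable_imp_locally_integrable[OF f]])
  fix \<phi> assume \<phi>: "\<phi> \<in> test_functions \<Omega>"
  have qF: "h10q F" using F by (simp add: minimizer_def)
  have u0: "AE x in M. val F x = 0" using A A_zero_iff[OF h10q_D(2)[OF qF]] by simp
  have "Lin (val F) = 0"
    unfolding Lin_def using u0 by (intro integral_eq_zero_AE) (auto elim!: eventually_mono)
  then have J0: "0 \<le> Jr F" using l2_sq_nonneg[of M "der F"] N_nonneg[of "val F"] by (simp add: Jr_def)
  define K where "K = (l2_sq M (grad \<phi>) + N \<phi>) / 2"
  have K: "K \<ge> 0" using l2_sq_nonneg[of M "grad \<phi>"] N_nonneg[of \<phi>] by (simp add: K_def)
  have quad: "0 \<le> t\<^sup>2 * K - t * Lin \<phi>" for t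
  proof -
    have "Jr F \<le> Jr (\<lambda>x. t *\<^sub>R jet \<phi> x)"
      using F h10q_scaleR_jet[OF \<phi>] by (simp add: minimizer_def)
    also have "\<dots> = t\<^sup>2 * K - t * Lin \<phi>"
      by (simp add: Jr_def jet_def N_scale l2_sq_def power_mult_distrib Lin_def K_def algebra_simps)
    finally show ?thesis using J0 by simp
  qed
  have "Lin \<phi> = 0"
  proof (rule ccontr)
    assume "Lin \<phi> \<noteq> 0"
    \<comment> \<open>Dividing by \<open>K + 1\<close> covers \<open>K = 0\<close> too; at
      \<open>t = y\<close> the polynomial equals \<open>-y^2\<close>.\<close>
    define y where "y = Lin \<phi> / (K + 1)"
    have y: "Lin \<phi> = y * (K + 1)" using K by (simp add: y_def)
    have "0 \<le> y\<^sup>2 * K - y * Lin \<phi>" by (rule quad)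
    also have "\<dots> = - y\<^sup>2" unfolding y by (simp add: power2_eq_square algebra_simps)
    finally have "y = 0" by simp
    then show False using \<open>Lin \<phi> \<noteq> 0\<close> y by simp
  qed
  then show "(LINT x|M. f x * \<phi> x) = 0" by (simp add: Lin_def mult.commute)
qed

section \<open>Transfer to the original functionals and energies\<close>

lemma J_functional_h10_pair:
  assumes "h10_pair F"
  shows "J_functional p \<Omega> f (val F) = (if val F \<in> Lq then ereal (Jr F) else \<infinity>)"
proof -
  have "(LINT x|M. (norm (weak_gradient \<Omega> (val F) x))\<^sup>2) = l2_sq M (der F)"
    using h10_pair_weak_gradient(4)[OF assms] by (simp add: l2_sq_def)
  then show ?thesis
    by (simp add: J_functional_def Jr_def N_def A_def Lin_def flip: q_def)
qed

lemma schroedinger_functional_h10_pair: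
  assumes "h10_pair F"
  shows "schroedinger_functional \<Omega> f V (val F) = ereal (l2_sq M (der F) / 2)
     + ereal (1/2) * enn2ereal (\<integral>\<^sup>+x. V x * ennreal ((val F x)\<^sup>2) \<partial>M) - ereal (Lin (val F))"
proof -
  have "(LINT x|M. (norm (weak_gradient \<Omega> (val F) x))\<^sup>2) = l2_sq M (der F)"
    using h10_pair_weak_gradient(4)[OF assms] by (simp add: l2_sq_def)
  then show ?thesis by (simp add: schroedinger_functional_def Lin_def mult.commute)
qed

lemma is_arg_min_J_iff:
  "is_arg_min (J_functional p \<Omega> f) (\<lambda>u. u \<in> H10 \<Omega>) u \<longleftrightarrow>
    u \<in> H10 \<Omega> \<and> minimizer (\<lambda>x. (u x, weak_gradient \<Omega> u x))"
proof
  assume u: "is_arg_min (J_functional p \<Omega> f) (\<lambda>u. u \<in> H10 \<Omega>) u"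
  let ?F = "\<lambda>x. (u x, weak_gradient \<Omega> u x)"
  have uH: "u \<in> H10 \<Omega>" using u by (simp add: is_arg_min_def)
  have F: "h10_pair ?F" by (rule H10_imp_h10_pair[OF uH])
  have le: "J_functional p \<Omega> f u \<le> ereal (Jr G)" if "h10q G" for G
  proof -
    have "\<not> J_functional p \<Omega> f (val G) < J_functional p \<Omega> f u"
      using u h10_pair_imp_H10[OF h10q_D(1)[OF that]] unfolding is_arg_min_def by blast
    then show ?thesis
      using J_functional_h10_pair[OF h10q_D(1)[OF that]] h10q_D(2)[OF that] by simp
  qed
  \<comment> \<open>Comparison with the zero pair makes the value finite, whereas
    \<open>J_functional\<close> is infinite outside \<open>Lq\<close>.\<close>
  have "u \<in> Lq"
    using le[OF h10q_zero] J_functional_h10_pair[OF F] by (auto split: if_splits)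
  then have "h10q ?F" using F by (simp add: h10q_def)
  moreover have "Jr ?F \<le> Jr G" if "h10q G" for G
    using le[OF that] J_functional_h10_pair[OF F] \<open>u \<in> Lq\<close> by simp
  ultimately show "u \<in> H10 \<Omega> \<and> minimizer ?F" using uH by (simp add: minimizer_def)
next
  assume u: "u \<in> H10 \<Omega> \<and> minimizer (\<lambda>x. (u x, weak_gradient \<Omega> u x))"
  let ?F = "\<lambda>x. (u x, weak_gradient \<Omega> u x)"
  have F: "h10q ?F" and min: "\<And>G. h10q G \<Longrightarrow> Jr ?F \<le> Jr G" using u by (auto simp: minimizer_def)
  have Ju: "J_functional p \<Omega> f u = ereal (Jr ?F)"
    using J_functional_h10_pair[OF h10q_D(1)[OF F]] h10q_D(2)[OF F] by simp
  have "J_functional p \<Omega> f u \<le> J_functional p \<Omega> f v" if "v \<in> H10 \<Omega>" for v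
  proof -
    let ?G = "\<lambda>x. (v x, weak_gradient \<Omega> v x)"
    have G: "h10_pair ?G" by (rule H10_imp_h10_pair[OF that])
    show ?thesis
      unfolding Ju using J_functional_h10_pair[OF G] min[of ?G] G by (auto simp: h10q_def)
  qed
  then show "is_arg_min (J_functional p \<Omega> f) (\<lambda>u. u \<in> H10 \<Omega>) u"
    using u by (simp add: is_arg_min_linorder)
qed

lemma J_minimizer_exists: "\<exists>u. is_arg_min (J_functional p \<Omega> f) (\<lambda>u. u \<in> H10 \<Omega>) u"
proof -
  obtain F where F: "h10q F" "\<And>G. h10q G \<Longrightarrow> Jr F \<le> Jr G"
    using Jr_minimizer_exists by blast
  have "val F \<in> H10 \<Omega>" by (rule h10_pair_imp_H10[OF h10q_D(1)[OF F(1)]])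
  moreover have "h10q (\<lambda>x. (val F x, weak_gradient \<Omega> (val F) x))"
    using H10_imp_h10_pair[OF \<open>val F \<in> H10 \<Omega>\<close>] h10q_D(2)[OF F(1)] by (simp add: h10q_def)
  moreover have "Jr (\<lambda>x. (val F x, weak_gradient \<Omega> (val F) x)) = Jr F"
    using h10_pair_weak_gradient(4)[OF h10q_D(1)[OF F(1)]] by (simp add: Jr_def)
  ultimately have "is_arg_min (J_functional p \<Omega> f) (\<lambda>u. u \<in> H10 \<Omega>) (val F)"
    unfolding is_arg_min_J_iff minimizer_def using F(2) by simp
  then show ?thesis by blast
qed

text \<open>Weak duality: every admissible potential bounds every value of J from below, because
  Hoelder's inequality compares the integrands of the two problems at the same function.\<close>

lemma energy_le:
  assumes V: "admissible_potential p \<Omega> V" and F: "h10q F"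
  shows "energy \<Omega> f V \<le> ereal (Jr F)"
proof -
  have "energy \<Omega> f V \<le> schroedinger_functional \<Omega> f V (val F)"
    unfolding energy_def by (rule INF_lower[OF h10_pair_imp_H10[OF h10q_D(1)[OF F]]])
  also have "\<dots> \<le> ereal (l2_sq M (der F) / 2) + ereal (1/2) * enn2ereal (ennreal (N (val F))) - ereal (Lin (val F))"
    unfolding schroedinger_functional_h10_pair[OF h10q_D(1)[OF F]]
    using hoelder_ennreal[OF V h10q_D(2)[OF F]]
    by (intro ereal_minus_mono add_left_mono ereal_mult_left_mono) (auto simp: less_eq_ennreal.rep_eq)
  also have "\<dots> = ereal (Jr F)"
    using N_nonneg[of "val F"] by (simp add: Jr_def add_divide_distrib)
  finally show ?thesis .
qed

text \<open>There is no duality gap: the lower bound tests all of \<open>H10\<close>, which is what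
  the extension of minimality beyond L^q is for.\<close>

lemma energy_Vr:
  assumes F: "minimizer F"
  shows "energy \<Omega> f (\<lambda>x. ennreal (Vr (val F) x)) = ereal (Jr F)"
proof (rule antisym)
  have qF: "h10q F" using F by (simp add: minimizer_def)
  show "energy \<Omega> f (\<lambda>x. ennreal (Vr (val F) x)) \<le> ereal (Jr F)"
    by (rule energy_le[OF admissible_Vr[OF h10q_D(2)[OF qF]] qF])
  show "ereal (Jr F) \<le> energy \<Omega> f (\<lambda>x. ennreal (Vr (val F) x))"
    unfolding energy_def
  proof (rule INF_greatest)
    fix v assume v: "v \<in> H10 \<Omega>"
    let ?G = "\<lambda>x. (v x, weak_gradient \<Omega> v x)"
    let ?X = "\<integral>\<^sup>+x. ennreal (Vr (val F) x) * ennreal ((v x)\<^sup>2) \<partial>M"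
    have G: "h10_pair ?G" by (rule H10_imp_h10_pair[OF v])
    have S: "schroedinger_functional \<Omega> f (\<lambda>x. ennreal (Vr (val F) x)) v =
        ereal (l2_sq M (der ?G) / 2) + ereal (1/2) * enn2ereal ?X - ereal (Lin v)"
      using schroedinger_functional_h10_pair[OF G] by simp
    have X: "?X = (\<integral>\<^sup>+x. ennreal (Vr (val F) x * (v x)\<^sup>2) \<partial>M)"
      by (simp add: ennreal_mult Vr_nonneg)
    show "ereal (Jr F) \<le> schroedinger_functional \<Omega> f (\<lambda>x. ennreal (Vr (val F) x)) v"
    \<comment> \<open>An infinite potential term makes the inequality trivial; a finite one provides
      the integrability that \<open>Sr_minimal_energy_space\<close> requires.\<close>
    proof (cases "?X = \<infinity>")
      case True
      then show ?thesis unfolding S by simp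
    next
      case False
      have "Vr (val F) \<in> borel_measurable M" "v \<in> borel_measurable M"
        using Vr_measurable square_integrable_measurable[OF h10q_D(4)[OF qF]]
          square_integrable_measurable[OF h10_pair_square_integrable(2)[OF G]] by auto
      then have int: "integrable M (\<lambda>x. Vr (val F) x * (v x)\<^sup>2)"
        using False unfolding X by (intro integrableI_nonneg) (auto simp: Vr_nonneg less_top)
      have "?X = ennreal (LINT x|M. Vr (val F) x * (v x)\<^sup>2)"
        unfolding X by (rule nn_integral_eq_integral[OF int]) (simp add: Vr_nonneg)
      moreover have "0 \<le> (LINT x|M. Vr (val F) x * (v x)\<^sup>2)" by (simp add: Vr_nonneg)
      ultimately have "schroedinger_functional \<Omega> f (\<lambda>x. ennreal (Vr (val F) x)) v = ereal (Sr (Vr (val F)) ?G)"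
        unfolding S by (simp add: Sr_def add_divide_distrib)
      then show ?thesis using Sr_minimal_energy_space[OF F G] int by simp
    qed
  qed
qed

text \<open>Optimality bounds the functional with potential \<open>V\<close> at the minimizer from
  below by \<open>Jr F\<close>; cancelling the Dirichlet and linear terms leaves equality in
  Hoelder's inequality. The condition on \<open>f\<close> ensures \<open>A (val F) > 0\<close>; for
  a vanishing minimizer every admissible potential would attain equality.\<close>

lemma optimal_potential_unique:
  assumes F: "minimizer F" and V: "admissible_potential p \<Omega> V" and E: "ereal (Jr F) \<le> energy \<Omega> f V"
    and f0: "\<not> (AE x in M. f x = 0)"
  shows "AE x in M. V x = ennreal (Vr (val F) x)"
proof -
  have qF: "h10q F" using F by (simp add: minimizer_def)
  note F' = h10q_D[OF qF]
  have A: "A (val F) > 0"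
    using f_zero_if_minimizer_zero[OF F] f0 A_nonneg[of "val F"] by linarith
  let ?X = "\<integral>\<^sup>+x. V x * ennreal ((val F x)\<^sup>2) \<partial>M"
  have X: "?X \<le> ennreal (N (val F))" by (rule hoelder_ennreal[OF V F'(2)])
  then obtain y where y: "?X = ennreal y" "y \<ge> 0" by (cases ?X) (auto simp: top_unique)
  have "ereal (Jr F) \<le> schroedinger_functional \<Omega> f V (val F)"
    using E INF_lower[OF h10_pair_imp_H10[OF F'(1)]] unfolding energy_def by (rule order_trans)
  also have "\<dots> = ereal (l2_sq M (der F) / 2 + y / 2 - Lin (val F))"
    unfolding schroedinger_functional_h10_pair[OF F'(1)] y using y(2) by simp
  finally have "N (val F) \<le> y" unfolding Jr_def ereal_less_eq by argo
  then have "ennreal (N (val F)) \<le> ?X" unfolding y by (rule ennreal_leI)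
  then show ?thesis by (rule hoelder_equality[OF V F'(2) A])
qed

end

theorem proposition3p6:
  fixes \<Omega> :: "'a::euclidean_space set" and p :: real and f :: "'a \<Rightarrow> real"
  assumes "open \<Omega>" and "bounded \<Omega>" and "1 < p" and "f \<in> Lp_space 2 \<Omega>"
  shows "(\<exists>u. is_arg_min (J_functional p \<Omega> f) (\<lambda>u. u \<in> H10 \<Omega>) u) \<and>
    (\<forall>u. is_arg_min (J_functional p \<Omega> f) (\<lambda>u. u \<in> H10 \<Omega>) u \<longrightarrow>
       u \<in> H10 \<Omega> \<inter> Lp_space (2 * p / (p - 1)) \<Omega> \<and>
       (\<forall>w. is_arg_min (J_functional p \<Omega> f) (\<lambda>u. u \<in> H10 \<Omega>) w \<longrightarrow>
          (AE x in lebesgue_on \<Omega>. w x = u x)) \<and>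
       is_arg_min (\<lambda>V. - energy \<Omega> f V) (admissible_potential p \<Omega>) (optimal_potential p \<Omega> u) \<and>
       (\<not> (AE x in lebesgue_on \<Omega>. f x = 0) \<longrightarrow>
          (\<forall>V. is_arg_min (\<lambda>V. - energy \<Omega> f V) (admissible_potential p \<Omega>) V \<longrightarrow>
             (AE x in lebesgue_on \<Omega>. V x = optimal_potential p \<Omega> u x))) \<and>
       energy \<Omega> f (optimal_potential p \<Omega> u) = J_functional p \<Omega> f u)"
proof -
  interpret schroedinger_problem \<Omega> p f
    using assms by unfold_locales (auto simp: Lp_space_2)
  show ?thesis
  proof (intro conjI allI impI)
    show "\<exists>u. is_arg_min (J_functional p \<Omega> f) (\<lambda>u. u \<in> H10 \<Omega>) u" by (rule J_minimizer_exists)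
  next
    fix u assume u: "is_arg_min (J_functional p \<Omega> f) (\<lambda>u. u \<in> H10 \<Omega>) u"
    let ?F = "\<lambda>x. (u x, weak_gradient \<Omega> u x)"
    have uH: "u \<in> H10 \<Omega>" and F: "minimizer ?F" using u by (auto simp: is_arg_min_J_iff)
    have qF: "h10q ?F" using F by (simp add: minimizer_def)
    have uq: "u \<in> Lq" using h10q_D(2)[OF qF] by simp
    show "u \<in> H10 \<Omega> \<inter> Lp_space (2 * p / (p - 1)) \<Omega>" using uH uq by (simp add: q_def)
    have opt: "optimal_potential p \<Omega> u = (\<lambda>x. ennreal (Vr (val ?F) x))"
      by (simp add: fun_eq_iff optimal_potential_eq)
    have adm: "admissible_potential p \<Omega> (optimal_potential p \<Omega> u)"
      unfolding opt using admissible_Vr[OF uq] by simp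
    have E: "energy \<Omega> f (optimal_potential p \<Omega> u) = ereal (Jr ?F)"
      unfolding opt by (rule energy_Vr[OF F])
    show "energy \<Omega> f (optimal_potential p \<Omega> u) = J_functional p \<Omega> f u"
      using E J_functional_h10_pair[OF h10q_D(1)[OF qF]] uq by simp
    show "is_arg_min (\<lambda>V. - energy \<Omega> f V) (admissible_potential p \<Omega>) (optimal_potential p \<Omega> u)"
      using adm energy_le[OF _ qF] by (simp add: is_arg_min_linorder E del: uminus_ereal.simps)
    show "AE x in lebesgue_on \<Omega>. w x = u x"
      if "is_arg_min (J_functional p \<Omega> f) (\<lambda>u. u \<in> H10 \<Omega>) w" for w
    proof -
      have "minimizer (\<lambda>x. (w x, weak_gradient \<Omega> w x))" using that by (simp add: is_arg_min_J_iff)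
      then show ?thesis
        using Jr_minimizer_unique[of ?F "\<lambda>x. (w x, weak_gradient \<Omega> w x)"] F by (simp add: minimizer_def)
    qed
    show "AE x in lebesgue_on \<Omega>. V x = optimal_potential p \<Omega> u x"
      if "\<not> (AE x in lebesgue_on \<Omega>. f x = 0)"
        and V: "is_arg_min (\<lambda>V. - energy \<Omega> f V) (admissible_potential p \<Omega>) V" for V
      unfolding opt
    proof (rule optimal_potential_unique[OF F])
      show "ereal (Jr ?F) \<le> energy \<Omega> f V"
        using V adm E by (simp add: is_arg_min_linorder) (metis ereal_minus_le_minus)
    qed (use that in \<open>auto simp: is_arg_min_def\<close>)
  qed
qed

end
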